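(* Let $l\in\mathbb{C}^{\times}$ and let $V(l,\mathbf 1)=\Pi(T(\widehat{E}_-))$, regarded via evaluation at $p$ as a subspace of $T(\widehat{E}_{p,-})$, where $\mathbf{k}$ acts by $l$. Then the vectors $$h_{i_1}(-m_1)\cdots h_{i_k}(-m_k)\mathbf 1,\qquad k\ge 0,\ m_1,\dots,m_k\in\mathbb{Z}_+,\ i_1,\dots,i_k\in\{+,-\},\ \#\{j:i_j=+\}=\#\{j:i_j=-\},$$ form a basis of $V(l,\mathbf 1)$. Moreover, the vertex operator map $$Y(h_{i_1}(-m_1)\cdots h_{i_k}(-m_k)\mathbf 1,x)={:}\,\frac{1}{(m_1-1)!}\frac{d^{m_1-1}}{dx^{m_1-1}}h_{i_1}(x)\cdots\frac{1}{(m_k-1)!}\frac{d^{m_k-1}}{dx^{m_k-1}}h_{i_k}(x)\,{:}$$ defines a meromorphic open-string vertex algebra structure on $V(l,\mathbf 1)$ with vacuum $\mathbf 1$, graded by $\mathrm{wt}\,(h_{i_1}(-m_1)\cdots h_{i_k}(-m_k)\mathbf 1)=m_1+\cdots+m_k$.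
   Context: Geometry: $M$ is a two-dimensional, connected, complete, orientable Riemannian manifold of constant sectional curvature $K\ne0$. $E=\mathbb{C}\otimes_{\mathbb R}TM$ is the complexified tangent bundle with the Levi-Civita connection extended complex-linearly and the metric extended to a complex bilinear form $(\cdot,\cdot)$. Fix $p\in M$ and an orthonormal basis $e_1,e_2$ of $T_pM$, and put $h_\pm=e_1\mp\sqrt{-1}\,e_2\in E_p$; so $(h_\pm,h_\pm)=0$, $(h_+,h_-)=2$. Bundles: $\widehat E_-=E\otimes t^{-1}\mathbb{C}[t^{-1}]$ (trivial connection on the second factor), $T(\widehat E_-)$ is its tensor algebra bundle with induced connection, and $\Pi(T(\widehat E_-))$ is the space of its global parallel sections. Evaluation at $p$ embeds it in $T(\widehat E_{p,-})$, $\widehat E_{p,-}=E_p\otimes t^{-1}\mathbb{C}[t^{-1}]$. Mode operators: for $a\in E_p$ and $m\in\mathbb Z$, $a(m)$ acts on $T(\widehat E_{p,-})$ (with $\mathbf 1$ the unit) as follows: $a(-m)$, $m>0$, is left multiplication by $a\otimes t^{-m}$; $a(0)=0$; $a(m)$ for $m>0$ is determined by $a(m)\mathbf 1=0$ and $a(m)b(-n)=b(-n)a(m)+m\,(a,b)\,\delta_{m,n}\,l$ for $n>0$ (no relation is imposed among modes of the same sign). Set $a(x)=\sum_{n\in\mathbb Z}a(n)x^{-n-1}$. The normal ordering ${:}a_1(n_1)\cdots a_k(n_k){:}$ reorders the factors so that negative modes come first, then positive modes, then zero modes, keeping the original relative order within each of the three groups. A meromorphic open-string vertex algebra (MOSVA)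 is a $\mathbb Z$-graded vector space $V=\coprod_{n\in\mathbb{Z}}V_{(n)}$ with a linear map $Y:V\otimes V\to V[[x,x^{-1}]]$ and $\mathbf 1\in V$ such that: (1) $V_{(n)}=0$ for $n$ sufficiently negative, and $[\mathbf d,Y(v,x)]=x\frac{d}{dx}Y(v,x)+Y(\mathbf d v,x)$, where $\mathbf d v=nv$ for $v\in V_{(n)}$; (2) $Y(\mathbf 1,x)=1_V$, and $Y(u,x)\mathbf 1\in V[[x]]$ with $\lim_{x\to0}Y(u,x)\mathbf 1=u$; (3) with $Dv=\lim_{x\to 0}\frac{d}{dx}Y(v,x)\mathbf 1$, $\frac{d}{dx}Y(v,x)=Y(Dv,x)=[D,Y(v,x)]$; (4) for all $u_1,v\in V$ there is $q\in\mathbb N$ such that for every $u_2\in V$, $(x_0+x_2)^qY(u_1,x_0+x_2)Y(u_2,x_2)v=(x_0+x_2)^qY(Y(u_1,x_0)u_2,x_2)v$. *)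

theory Defs
  imports "HOL-Analysis.Analysis" "HOL-Library.Poly_Mapping"
begin

section \<open>Smooth surfaces\<close>

text \<open>\<^term>\<open>C_diff k S f\<close> is meant for open \<^term>\<open>S\<close> in a finite-dimensional space only: there the
  clause for successors (all directional derivatives are of class \<open>C\<^sup>k\<close>) describes
  functions of class \<open>C\<^sup>k\<^sup>+\<^sup>1\<close>.\<close>

primrec C_diff :: "nat \<Rightarrow> 'a::real_normed_vector set \<Rightarrow> ('a \<Rightarrow> 'b::real_normed_vector) \<Rightarrow> bool" where
  "C_diff 0 S f \<longleftrightarrow> continuous_on S f"
| "C_diff (Suc k) S f \<longleftrightarrow> (\<forall>x\<in>S. f differentiable at x) \<and>
     (\<forall>v. C_diff k S (\<lambda>x. frechet_derivative f (at x) v))"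

definition smooth_on :: "'a::real_normed_vector set \<Rightarrow> ('a \<Rightarrow> 'b::real_normed_vector) \<Rightarrow> bool" where
  "smooth_on S f \<longleftrightarrow> (\<forall>k. C_diff k S f)"

definition pd :: "2 \<Rightarrow> (real^2 \<Rightarrow> 'b::real_normed_vector) \<Rightarrow> real^2 \<Rightarrow> 'b" where
  "pd i f x = frechet_derivative f (at x) (axis i 1)"

text \<open>A chart is a pair of its domain and its coordinate map (irrelevant outside the domain).\<close>

type_synonym 'm chart = "'m set \<times> ('m \<Rightarrow> real^2)"

abbreviation cdom :: "'m chart \<Rightarrow> 'm set" where "cdom c \<equiv> fst c"
abbreviation cimg :: "'m chart \<Rightarrow> (real^2) set" where "cimg c \<equiv> snd c ` fst c"

definition cinv :: "'m chart \<Rightarrow> real^2 \<Rightarrow> 'm" where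
  "cinv c = inv_into (cdom c) (snd c)"

definition is_chart :: "'m::topological_space chart \<Rightarrow> bool" where
  "is_chart c \<longleftrightarrow> open (cdom c) \<and> open (cimg c) \<and> homeomorphism (cdom c) (cimg c) (snd c) (cinv c)"

definition smooth_atlas :: "'m::topological_space chart set \<Rightarrow> bool" where
  "smooth_atlas A \<longleftrightarrow> (\<forall>c\<in>A. is_chart c) \<and> (\<Union>c\<in>A. cdom c) = UNIV \<and>
     (\<forall>c\<in>A. \<forall>d\<in>A. smooth_on (snd c ` (cdom c \<inter> cdom d)) (snd d \<circ> cinv c))"

definition jac :: "'m chart \<Rightarrow> 'm chart \<Rightarrow> 'm \<Rightarrow> real^2^2" where
  "jac c d q = matrix (frechet_derivative (snd d \<circ> cinv c) (at (snd c q)))"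

definition orientable :: "'m::topological_space chart set \<Rightarrow> bool" where
  "orientable A \<longleftrightarrow> (\<exists>B. smooth_atlas B \<and> smooth_atlas (A \<union> B) \<and>
     (\<forall>c\<in>B. \<forall>d\<in>B. \<forall>q\<in>cdom c \<inter> cdom d. det (jac c d q) > 0))"

text \<open>Every point \<^term>\<open>q\<close> has a preferred chart \<^term>\<open>chart_at A q\<close>. A tangent vector at
  \<^term>\<open>q\<close> is represented by its coordinates in this chart, so that every tangent space
  is \<^typ>\<open>real^2\<close> as a vector space and every fibre of the complexified tangent bundle \<open>E\<close> is
  \<^typ>\<open>complex^2\<close>. The preferred chart does not vary continuously with the point: smoothness
  of a section is always tested on its components in fixed charts, obtained with \<^const>\<open>jac\<close>.\<close>

definition chart_at :: "'m chart set \<Rightarrow> 'm \<Rightarrow> 'm chart" where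
  "chart_at A q = (SOME c. c \<in> A \<and> q \<in> cdom c)"

text \<open>\<^term>\<open>coord_vec A c i q\<close> is the coordinate vector \<open>\<partial>\<^sub>i\<close> of the chart \<^term>\<open>c\<close>, as an
  element of the tangent space at \<^term>\<open>q\<close>.\<close>

definition coord_vec :: "'m chart set \<Rightarrow> 'm chart \<Rightarrow> 2 \<Rightarrow> 'm \<Rightarrow> real^2" where
  "coord_vec A c i q = column i (jac c (chart_at A q) q)"


section \<open>Riemannian geometry of surfaces\<close>

type_synonym 'm metric = "'m \<Rightarrow> real^2 \<Rightarrow> real^2 \<Rightarrow> real"

definition gmat :: "'m chart set \<Rightarrow> 'm metric \<Rightarrow> 'm chart \<Rightarrow> real^2 \<Rightarrow> real^2^2" where
  "gmat A g c x = (\<chi> i j. g (cinv c x) (coord_vec A c i (cinv c x)) (coord_vec A c j (cinv c x)))"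

definition riemannian_metric :: "'m::topological_space chart set \<Rightarrow> 'm metric \<Rightarrow> bool" where
  "riemannian_metric A g \<longleftrightarrow>
     (\<forall>q. bilinear (g q) \<and> (\<forall>u v. g q u v = g q v u) \<and> (\<forall>u. u \<noteq> 0 \<longrightarrow> g q u u > 0)) \<and>
     (\<forall>c\<in>A. \<forall>i j. smooth_on (cimg c) (\<lambda>x. gmat A g c x $ i $ j))"

text \<open>The Levi-Civita connection, through its Christoffel symbols: in the chart \<^term>\<open>c\<close>,
  \<open>\<nabla>\<close> of \<open>\<partial>\<^sub>j\<close> along \<open>\<partial>\<^sub>i\<close> is the sum over \<^term>\<open>k\<close> of \<^term>\<open>christoffel A g c k i j x\<close> times
  \<open>\<partial>\<^sub>k\<close>.\<close>

definition christoffel ::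
  "'m chart set \<Rightarrow> 'm metric \<Rightarrow> 'm chart \<Rightarrow> 2 \<Rightarrow> 2 \<Rightarrow> 2 \<Rightarrow> real^2 \<Rightarrow> real" where
  "christoffel A g c k i j x = 1/2 * (\<Sum>m\<in>UNIV. matrix_inv (gmat A g c x) $ k $ m *
     (pd i (\<lambda>y. gmat A g c y $ j $ m) x + pd j (\<lambda>y. gmat A g c y $ i $ m) x
       - pd m (\<lambda>y. gmat A g c y $ i $ j) x))"

text \<open>\<^term>\<open>curvature A g c m k i j x\<close> is the \<open>\<partial>\<^sub>m\<close>-component of \<open>R(\<partial>\<^sub>i, \<partial>\<^sub>j)\<partial>\<^sub>k\<close>, where
  \<open>R(X, Y) = [\<nabla>\<^sub>X, \<nabla>\<^sub>Y] - \<nabla>\<^bsub>[X, Y]\<^esub>\<close>.\<close>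

definition curvature ::
  "'m chart set \<Rightarrow> 'm metric \<Rightarrow> 'm chart \<Rightarrow> 2 \<Rightarrow> 2 \<Rightarrow> 2 \<Rightarrow> 2 \<Rightarrow> real^2 \<Rightarrow> real" where
  "curvature A g c m k i j x =
     pd i (christoffel A g c m j k) x - pd j (christoffel A g c m i k) x
     + (\<Sum>r\<in>UNIV. christoffel A g c m i r x * christoffel A g c r j k x
                 - christoffel A g c m j r x * christoffel A g c r i k x)"

definition curv_op ::
  "'m chart set \<Rightarrow> 'm metric \<Rightarrow> 'm chart \<Rightarrow> real^2 \<Rightarrow> real^2 \<Rightarrow> real^2 \<Rightarrow> real^2 \<Rightarrow> real^2" where
  "curv_op A g c x u v w = (\<chi> m. \<Sum>i\<in>UNIV. \<Sum>j\<in>UNIV. \<Sum>k\<in>UNIV.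
     u $ i * v $ j * w $ k * curvature A g c m k i j x)"

definition sectional_curvature ::
  "'m chart set \<Rightarrow> 'm metric \<Rightarrow> 'm chart \<Rightarrow> real^2 \<Rightarrow> real^2 \<Rightarrow> real^2 \<Rightarrow> real" where
  "sectional_curvature A g c x u v =
     (let ip = (\<lambda>a b. a \<bullet> (gmat A g c x *v b))
      in ip (curv_op A g c x u v v) u / (ip u u * ip v v - (ip u v)\<^sup>2))"

definition constant_curvature :: "'m chart set \<Rightarrow> 'm metric \<Rightarrow> real \<Rightarrow> bool" where
  "constant_curvature A g K \<longleftrightarrow> (\<forall>c\<in>A. \<forall>x\<in>cimg c. \<forall>u v. u \<noteq> v \<and> independent {u, v} \<longrightarrow>
     sectional_curvature A g c x u v = K)"

definition geodesic :: "'m::topological_space chart set \<Rightarrow> 'm metric \<Rightarrow> (real \<Rightarrow> 'm) \<Rightarrow> bool" where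
  "geodesic A g \<gamma> \<longleftrightarrow> continuous_on UNIV \<gamma> \<and> (\<forall>c\<in>A. \<forall>t. \<gamma> t \<in> cdom c \<longrightarrow>
     (let \<xi> = snd c \<circ> \<gamma>; \<eta> = (\<lambda>s. vector_derivative \<xi> (at s))
      in \<xi> differentiable at t \<and>
         (\<eta> has_vector_derivative
            (\<chi> k. - (\<Sum>i\<in>UNIV. \<Sum>j\<in>UNIV. christoffel A g c k i j (\<xi> t) * \<eta> t $ i * \<eta> t $ j))) (at t)))"

text \<open>Geodesic completeness, which is the same as completeness of the Riemannian distance by the
  theorem of Hopf and Rinow.\<close>

definition geodesically_complete :: "'m::topological_space chart set \<Rightarrow> 'm metric \<Rightarrow> bool" where
  "geodesically_complete A g \<longleftrightarrow> (\<forall>q v. \<exists>\<gamma>. geodesic A g \<gamma> \<and> \<gamma> 0 = q \<and>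
     vector_derivative (snd (chart_at A q) \<circ> \<gamma>) (at 0) = v)"


section \<open>The tensor algebra\<close>

type_synonym word = "(2 \<times> nat) list"
type_synonym tens = "word \<Rightarrow>\<^sub>0 complex"

text \<open>The letter \<^term>\<open>(i, m)\<close> with \<^term>\<open>m > 0\<close> stands for \<open>e\<^sub>i \<otimes> t\<^sup>-\<^sup>m\<close>, where \<open>e\<^sub>i\<close> is the
  standard basis of \<^typ>\<open>complex^2\<close>; the word \<^term>\<open>[(i, m), (j, n)]\<close> stands for
  \<open>(e\<^sub>i \<otimes> t\<^sup>-\<^sup>m) \<otimes> (e\<^sub>j \<otimes> t\<^sup>-\<^sup>n)\<close>. The words in such letters are a basis of the tensor algebra of
  \<open>\<complex>\<^sup>2 \<otimes> t\<^sup>-\<^sup>1\<complex>[t\<^sup>-\<^sup>1]\<close>. The type \<^typ>\<open>tens\<close> also contains words with a letter \<^term>\<open>(i, 0)\<close>; the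
  algebra is the subspace \<open>tensor_alg\<close>.\<close>

definition tensor_alg :: "tens set" where
  "tensor_alg = {t. \<forall>w\<in>Poly_Mapping.keys t. \<forall>(i, m)\<in>set w. m > 0}"

definition scaleT :: "complex \<Rightarrow> tens \<Rightarrow> tens" where
  "scaleT z t = Poly_Mapping.map ((*) z) t"

definition vac :: tens where
  "vac = Poly_Mapping.single [] 1"

definition lin_ext :: "(word \<Rightarrow> tens) \<Rightarrow> tens \<Rightarrow> tens" where
  "lin_ext f t = (\<Sum>w\<in>Poly_Mapping.keys t. scaleT (Poly_Mapping.lookup t w) (f w))"

text \<open>Left multiplication by \<open>a \<otimes> t\<^sup>-\<^sup>m\<close>.\<close>

definition lmul :: "complex^2 \<Rightarrow> nat \<Rightarrow> tens \<Rightarrow> tens" where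
  "lmul a m = lin_ext (\<lambda>w. \<Sum>i\<in>UNIV. Poly_Mapping.single ((i, m) # w) (a $ i))"

text \<open>The algebra map of the tensor algebras induced by the linear map with matrix \<^term>\<open>L\<close>.\<close>

primrec tmap_word :: "complex^2^2 \<Rightarrow> word \<Rightarrow> tens" where
  "tmap_word L [] = vac"
| "tmap_word L (b # w) = lmul (column (fst b) L) (snd b) (tmap_word L w)"

definition tmap :: "complex^2^2 \<Rightarrow> tens \<Rightarrow> tens" where
  "tmap L = lin_ext (tmap_word L)"


section \<open>Parallel sections\<close>

text \<open>A section of the bundle \<open>T(E \<otimes> t\<^sup>-\<^sup>1\<complex>[t\<^sup>-\<^sup>1])\<close> maps every point \<^term>\<open>q\<close> to an element of the tensor algebra
  over the fibre of \<open>E\<close> at \<^term>\<open>q\<close>, which is \<^typ>\<open>complex^2\<close> through the preferred chart at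
  \<^term>\<open>q\<close>. \<^term>\<open>tensor_comp A s c w x\<close> is its component in the chart \<^term>\<open>c\<close> with respect to
  the word \<^term>\<open>w\<close>, a word with letters \<open>\<partial>\<^sub>i \<otimes> t\<^sup>-\<^sup>m\<close>.\<close>

definition tensor_comp ::
  "'m chart set \<Rightarrow> ('m \<Rightarrow> tens) \<Rightarrow> 'm chart \<Rightarrow> word \<Rightarrow> real^2 \<Rightarrow> complex" where
  "tensor_comp A s c w x = (let q = cinv c x in
     Poly_Mapping.lookup (tmap (map_matrix of_real (jac (chart_at A q) c q)) (s q)) w)"

text \<open>\<^term>\<open>cov_deriv A g s c i w x\<close> is the component at \<^term>\<open>w\<close> of the covariant derivative of
  \<^term>\<open>s\<close> along \<open>\<partial>\<^sub>i\<close>: the connection is a derivation of the tensor algebra and is trivial on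
  powers of \<open>t\<close>.\<close>

definition cov_deriv :: "'m chart set \<Rightarrow> 'm metric \<Rightarrow> ('m \<Rightarrow> tens) \<Rightarrow> 'm chart \<Rightarrow> 2 \<Rightarrow> word \<Rightarrow>
    real^2 \<Rightarrow> complex" where
  "cov_deriv A g s c i w x = pd i (tensor_comp A s c w) x +
     (\<Sum>r<length w. \<Sum>k\<in>UNIV. of_real (christoffel A g c (fst (w ! r)) i k x) *
        tensor_comp A s c (w[r := (k, snd (w ! r))]) x)"

definition parallel_sections :: "'m chart set \<Rightarrow> 'm metric \<Rightarrow> ('m \<Rightarrow> tens) set" where
  "parallel_sections A g = {s. (\<forall>q. s q \<in> tensor_alg) \<and>
     (\<forall>c\<in>A. \<forall>w. smooth_on (cimg c) (tensor_comp A s c w)) \<and>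
     (\<forall>c\<in>A. \<forall>w i. \<forall>x\<in>cimg c. cov_deriv A g s c i w x = 0)}"

text \<open>\<open>V(l, \<one>)\<close>, regarded via evaluation at \<^term>\<open>p\<close> as a subspace of the tensor algebra.\<close>

definition V_par :: "'m chart set \<Rightarrow> 'm metric \<Rightarrow> 'm \<Rightarrow> tens set" where
  "V_par A g p = (\<lambda>s. s p) ` parallel_sections A g"


section \<open>Mode operators and vertex operators\<close>

definition complexify :: "real^2 \<Rightarrow> complex^2" where
  "complexify u = (\<chi> i. of_real (u $ i))"

definition cmetric :: "'m metric \<Rightarrow> 'm \<Rightarrow> complex^2 \<Rightarrow> complex^2 \<Rightarrow> complex" where
  "cmetric g p a b = (\<Sum>i\<in>UNIV. \<Sum>j\<in>UNIV. a $ i * b $ j * of_real (g p (axis i 1) (axis j 1)))"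

text \<open>The operator \<open>a(m)\<close>, \<^term>\<open>m > 0\<close>, on words: \<open>a(m)\<one> = 0\<close> and
  \<open>a(m)b(-n) = b(-n)a(m) + m (a, b) \<delta>\<^bsub>m,n\<^esub> l\<close>. Here \<^term>\<open>G\<close> is the bilinear form.\<close>

primrec ann_word :: "(complex^2 \<Rightarrow> complex^2 \<Rightarrow> complex) \<Rightarrow> complex \<Rightarrow> complex^2 \<Rightarrow> nat \<Rightarrow> word \<Rightarrow> tens"
  where
  "ann_word G l a m [] = 0"
| "ann_word G l a m (b # w) = lmul (axis (fst b) 1) (snd b) (ann_word G l a m w) +
     (if m = snd b then Poly_Mapping.single w (of_nat m * G a (axis (fst b) 1) * l) else 0)"

definition mode :: "(complex^2 \<Rightarrow> complex^2 \<Rightarrow> complex) \<Rightarrow> complex \<Rightarrow> complex^2 \<Rightarrow> int \<Rightarrow> tens \<Rightarrow> tens"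
  where
  "mode G l a n = (if n < 0 then lmul a (nat (- n))
     else if n = 0 then (\<lambda>_. 0) else lin_ext (ann_word G l a (nat n)))"

text \<open>The following results lead up to \<open>mode_vac\<close> and \<open>mode_commute\<close>, the relations that
  determine the operators \<^const>\<open>mode\<close>.\<close>

lemma lookup_scaleT: "Poly_Mapping.lookup (scaleT z t) w = z * Poly_Mapping.lookup t w"
  by (simp add: scaleT_def map.rep_eq when_def)

lemma vector_space_scaleT: "vector_space scaleT"
  by unfold_locales (auto intro!: poly_mapping_eqI simp: lookup_scaleT lookup_add algebra_simps)

interpretation T: vector_space scaleT by (rule vector_space_scaleT)

lemma lin_ext_superset:
  assumes "finite S" "Poly_Mapping.keys t \<subseteq> S"
  shows "lin_ext f t = (\<Sum>w\<in>S. scaleT (Poly_Mapping.lookup t w) (f w))"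
  unfolding lin_ext_def using assms
  by (intro sum.mono_neutral_left) (auto simp: in_keys_iff)

lemma lin_ext_add: "lin_ext f (s + t) = lin_ext f s + lin_ext f t"
proof -
  let ?S = "Poly_Mapping.keys s \<union> Poly_Mapping.keys t"
  have "Poly_Mapping.keys (s+t) \<subseteq> ?S" by (rule keys_add)
  then show ?thesis
    by (subst (1 2 3) lin_ext_superset[of ?S]) (auto simp: lookup_add T.scale_left_distrib sum.distrib)
qed

lemma lin_ext_scaleT: "lin_ext f (scaleT z t) = scaleT z (lin_ext f t)"
proof -
  have "Poly_Mapping.keys (scaleT z t) \<subseteq> Poly_Mapping.keys t"
    by (auto simp: in_keys_iff lookup_scaleT)
  then show ?thesis
    by (subst (1 2) lin_ext_superset[of "Poly_Mapping.keys t"]) (auto simp: lookup_scaleT T.scale_sum_right)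
qed

lemma lin_ext_single: "lin_ext f (Poly_Mapping.single w z) = scaleT z (f w)"
  by (subst lin_ext_superset[of "{w}"]) auto

lemma lin_ext_sum: "lin_ext f (\<Sum>i\<in>S. t i) = (\<Sum>i\<in>S. lin_ext f (t i))"
  by (induction S rule: infinite_finite_induct) (auto simp: lin_ext_add lin_ext_def[of _ 0])

lemma scaleT_single: "scaleT z (Poly_Mapping.single w y) = Poly_Mapping.single w (z*y)"
  by (rule poly_mapping_eqI) (auto simp: lookup_scaleT lookup_single when_def)

lemma tens_induct:
  assumes "P 0" "\<And>s t. P s \<Longrightarrow> P t \<Longrightarrow> P (s+t)" "\<And>w z. P (Poly_Mapping.single w z)"
  shows "P (t::tens)"
proof -
  have "t = (\<Sum>w\<in>Poly_Mapping.keys t. Poly_Mapping.single w (Poly_Mapping.lookup t w))"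
    by (rule poly_mapping_eqI) (auto simp: lookup_sum lookup_single when_def in_keys_iff)
  moreover have "finite S \<Longrightarrow> P (\<Sum>w\<in>S. Poly_Mapping.single w (Poly_Mapping.lookup t w))" for S
    by (induction S rule: finite_induct) (auto intro: assms)
  ultimately show ?thesis by (metis finite_keys)
qed

lemma mode_vac: "n > 0 \<Longrightarrow> mode G l a n vac = 0"
  by (simp add: mode_def vac_def lin_ext_single)

lemma lmul_sum_axis: "lmul b m t = (\<Sum>i\<in>UNIV. scaleT (b $ i) (lmul (axis i 1) m t))"
proof (induction t rule: tens_induct)
  case 1 show ?case by (simp add: lmul_def lin_ext_def)
next
  case (2 s t) then show ?case
    by (simp add: lmul_def lin_ext_add T.scale_right_distrib sum.distrib)
next
  case (3 w z) show ?case
    by (simp add: lmul_def lin_ext_single scaleT_single axis_def UNIV_2 T.scale_right_distrib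
      mult.commute)
qed

lemma mode_commute:
  assumes "m > 0" "n > 0" "G = cmetric g p"
  shows "mode G l a m (mode G l b (- n) t) = mode G l b (- n) (mode G l a m t) +
    (if m = n then scaleT (of_int m * G a b * l) t else 0)"
proof (induction t rule: tens_induct)
  case 1 show ?case using assms by (simp add: mode_def lmul_def lin_ext_def)
next
  case (2 s t) then show ?case
    using assms by (simp add: mode_def lmul_def lin_ext_add T.scale_right_distrib split: if_splits)
next
  case (3 w z)
  have Gb: "G a b = (\<Sum>i\<in>UNIV. b $ i * G a (axis i 1))"
    unfolding assms cmetric_def
    by (simp add: sum_2 axis_def algebra_simps)
  have Gb2: "cmetric g p a b = b $ 1 * cmetric g p a (axis 1 1) + b $ 2 * cmetric g p a (axis 2 1)"
    using Gb by (simp add: assms UNIV_2)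
  have [simp]: "(nat m = nat n) = (m = n)" using assms by auto
  have one: "ann_word G l a (nat m) ((i, nat n) # w) = lmul (axis i 1) (nat n) (ann_word G l a (nat m) w)
     + (if m = n then Poly_Mapping.single w (of_int m * G a (axis i 1) * l) else 0)" for i
    using assms by simp
  have L: "mode G l a m (mode G l b (- n) (Poly_Mapping.single w z)) =
    (\<Sum>i\<in>UNIV. scaleT (z * b $ i) (ann_word G l a (nat m) ((i, nat n) # w)))"
    using assms by (simp add: mode_def lmul_def lin_ext_single T.scale_sum_right scaleT_single lin_ext_sum del: ann_word.simps)
  show ?case
    unfolding L one
    using assms
    apply (simp add: mode_def lin_ext_single)
    apply (simp add: lmul_def lin_ext_scaleT)
    apply (simp add: lmul_def[symmetric] lmul_sum_axis[of b] T.scale_right_distrib sum.distrib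
        T.scale_sum_right scaleT_single)
    apply (auto simp: UNIV_2 algebra_simps single_add[symmetric] Gb2)
    done
qed

definition normal_ordered :: "(complex^2 \<Rightarrow> complex^2 \<Rightarrow> complex) \<Rightarrow> complex \<Rightarrow>
    ((complex^2) \<times> int) list \<Rightarrow> tens \<Rightarrow> tens" where
  "normal_ordered G l xs = foldr (\<lambda>(a, n). mode G l a n)
     (filter (\<lambda>(a, n). n < 0) xs @ filter (\<lambda>(a, n). n > 0) xs @ filter (\<lambda>(a, n). n = 0) xs)"

datatype sign = Pos | Neg

definition hvec :: "real^2 \<Rightarrow> real^2 \<Rightarrow> sign \<Rightarrow> complex^2" where
  "hvec e1 e2 i = (case i of Pos \<Rightarrow> complexify e1 - \<i> *s complexify e2
                           | Neg \<Rightarrow> complexify e1 + \<i> *s complexify e2)"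

text \<open>For \<^term>\<open>h :: sign \<Rightarrow> complex^2\<close>, the list \<^term>\<open>[(i, m), (j, n)]\<close> encodes the vector
  \<open>h\<^sub>i(-m)h\<^sub>j(-n)\<one>\<close>.\<close>

definition mode_vec :: "(complex^2 \<Rightarrow> complex^2 \<Rightarrow> complex) \<Rightarrow> complex \<Rightarrow> (sign \<Rightarrow> complex^2) \<Rightarrow>
    (sign \<times> nat) list \<Rightarrow> tens" where
  "mode_vec G l h ws = foldr (\<lambda>(i, m). mode G l (h i) (- int m)) ws vac"

definition balanced :: "(sign \<times> nat) list set" where
  "balanced = {ws. (\<forall>(i, m)\<in>set ws. m > 0) \<and>
     count_list (map fst ws) Pos = count_list (map fst ws) Neg}"

definition weight :: "(sign \<times> nat) list \<Rightarrow> int" where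
  "weight ws = int (sum_list (map snd ws))"

text \<open>The coefficient of \<open>x\<^sup>N\<close> in
  \<open>:1/(m\<^sub>1-1)! d\<^bsup>m\<^sub>1-1\<^esup>/dx\<^bsup>m\<^sub>1-1\<^esup> h\<^bsub>i\<^sub>1\<^esub>(x) \<cdots> 1/(m\<^sub>k-1)! d\<^bsup>m\<^sub>k-1\<^esup>/dx\<^bsup>m\<^sub>k-1\<^esup> h\<^bsub>i\<^sub>k\<^esub>(x): v\<close>,
  a sum over the modes \<open>n\<^sub>1, \<dots>, n\<^sub>k\<close> in the \<open>k\<close> factors. In \<open>h(x)\<close> the mode \<open>h(n)\<close> comes with
  \<open>x\<^sup>-\<^sup>n\<^sup>-\<^sup>1\<close>, whose derivative of order \<open>m - 1\<close>, divided by \<open>(m - 1)!\<close>, is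
  \<open>x\<^sup>-\<^sup>n\<^sup>-\<^sup>m\<close> times \<open>-n-1\<close> choose \<open>m-1\<close>. For each \<open>v\<close> only finitely many summands are
  nonzero; the index set is restricted to these because sums over infinite sets are 0.\<close>

definition vertex_term :: "(complex^2 \<Rightarrow> complex^2 \<Rightarrow> complex) \<Rightarrow> complex \<Rightarrow> (sign \<Rightarrow> complex^2) \<Rightarrow>
    (sign \<times> nat) list \<Rightarrow> tens \<Rightarrow> int list \<Rightarrow> tens" where
  "vertex_term G l h ws v ns =
     scaleT (prod_list (map2 (\<lambda>(i, m) n. of_int (- n - 1) gchoose (m - 1)) ws ns))
       (normal_ordered G l (map2 (\<lambda>(i, m) n. (h i, n)) ws ns) v)"

definition vertex_coeff :: "(complex^2 \<Rightarrow> complex^2 \<Rightarrow> complex) \<Rightarrow> complex \<Rightarrow> (sign \<Rightarrow> complex^2) \<Rightarrow>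
    (sign \<times> nat) list \<Rightarrow> tens \<Rightarrow> int \<Rightarrow> tens" where
  "vertex_coeff G l h ws v N =
     (\<Sum>ns | length ns = length ws \<and>
             sum_list (map2 (\<lambda>(i, m) n. - n - int m) ws ns) = N \<and> vertex_term G l h ws v ns \<noteq> 0.
        vertex_term G l h ws v ns)"


section \<open>Meromorphic open-string vertex algebras\<close>

text \<open>A formal series in \<open>V[[x, x\<^sup>-\<^sup>1]]\<close> is the function mapping \<^term>\<open>n :: int\<close> to the coefficient of
  \<open>x\<^sup>n\<close>. In particular \<^term>\<open>Y u v n\<close> below is the coefficient of \<open>x\<^sup>n\<close> (not of \<open>x\<^sup>-\<^sup>n\<^sup>-\<^sup>1\<close>)
  in \<open>Y(u, x)v\<close>. Series in \<open>x\<^sub>0, x\<^sub>2\<close> are curried in the same way.\<close>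

definition fdx :: "(complex \<Rightarrow> 'v \<Rightarrow> 'v) \<Rightarrow> (int \<Rightarrow> 'v) \<Rightarrow> int \<Rightarrow> 'v" where
  "fdx smul f n = smul (of_int (n + 1)) (f (n + 1))"

text \<open>\<open>Y(u\<^sub>1, x\<^sub>0+x\<^sub>2)Y(u\<^sub>2, x\<^sub>2)v\<close>, where \<open>(x\<^sub>0+x\<^sub>2)\<^sup>n\<close> is expanded in nonnegative powers
  of \<open>x\<^sub>2\<close>. If \<open>Y(u\<^sub>2, x)v\<close> has only finitely many negative powers (as a consequence of the
  grading axioms), then the index set is finite.\<close>

definition product_series :: "(complex \<Rightarrow> 'v \<Rightarrow> 'v) \<Rightarrow> ('v \<Rightarrow> 'v \<Rightarrow> int \<Rightarrow> 'v::ab_group_add) \<Rightarrow>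
    'v \<Rightarrow> 'v \<Rightarrow> 'v \<Rightarrow> int \<Rightarrow> int \<Rightarrow> 'v" where
  "product_series smul Y u1 u2 v a b = (\<Sum>j::nat | Y u2 v (b - int j) \<noteq> 0.
     smul (of_int (a + int j) gchoose j) (Y u1 (Y u2 v (b - int j)) (a + int j)))"

text \<open>\<open>Y(Y(u\<^sub>1, x\<^sub>0)u\<^sub>2, x\<^sub>2)v\<close>.\<close>

definition iterate_series :: "('v \<Rightarrow> 'v \<Rightarrow> int \<Rightarrow> 'v) \<Rightarrow> 'v \<Rightarrow> 'v \<Rightarrow> 'v \<Rightarrow> int \<Rightarrow> int \<Rightarrow> 'v" where
  "iterate_series Y u1 u2 v a b = Y (Y u1 u2 a) v b"

text \<open>Multiplication of a series in \<open>x\<^sub>0, x\<^sub>2\<close> by the polynomial \<open>(x\<^sub>0+x\<^sub>2)\<^sup>q\<close>.\<close>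

definition binomial_mult :: "(complex \<Rightarrow> 'v \<Rightarrow> 'v) \<Rightarrow> nat \<Rightarrow> (int \<Rightarrow> int \<Rightarrow> 'v::ab_group_add) \<Rightarrow>
    int \<Rightarrow> int \<Rightarrow> 'v" where
  "binomial_mult smul q F a b =
     (\<Sum>j\<le>q. smul (of_nat (q choose j)) (F (a - int (q - j)) (b - int j)))"

definition linear_on_subspace :: "(complex \<Rightarrow> 'v \<Rightarrow> 'v) \<Rightarrow> 'v set \<Rightarrow> ('v \<Rightarrow> 'v::ab_group_add) \<Rightarrow> bool"
  where
  "linear_on_subspace smul V f \<longleftrightarrow> (\<forall>u\<in>V. \<forall>v\<in>V. f (u + v) = f u + f v) \<and>
     (\<forall>z. \<forall>v\<in>V. f (smul z v) = smul z (f v))"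

definition graded_by :: "(complex \<Rightarrow> 'v \<Rightarrow> 'v) \<Rightarrow> 'v set \<Rightarrow> (int \<Rightarrow> 'v::ab_group_add set) \<Rightarrow> bool" where
  "graded_by smul V Vn \<longleftrightarrow> (\<forall>n. module.subspace smul (Vn n) \<and> Vn n \<subseteq> V) \<and>
     (\<forall>v\<in>V. \<exists>!f. (\<forall>n. f n \<in> Vn n) \<and> finite {n. f n \<noteq> 0} \<and> v = (\<Sum>n | f n \<noteq> 0. f n))"

text \<open>The underlying space \<^term>\<open>V\<close> is a subspace of a vector space given by a type; the values
  of \<^term>\<open>Y\<close> outside of \<^term>\<open>V\<close> are irrelevant. In the last axiom \<^term>\<open>q\<close> depends only
  on \<^term>\<open>u1\<close> and \<^term>\<open>v\<close>.\<close>

definition is_MOSVA :: "(complex \<Rightarrow> 'v \<Rightarrow> 'v) \<Rightarrow> 'v set \<Rightarrow> (int \<Rightarrow> 'v set) \<Rightarrow>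
    ('v \<Rightarrow> 'v \<Rightarrow> int \<Rightarrow> 'v::ab_group_add) \<Rightarrow> 'v \<Rightarrow> bool" where
  "is_MOSVA smul V Vn Y vacuum \<longleftrightarrow>
     vector_space smul \<and> module.subspace smul V \<and> graded_by smul V Vn \<and> vacuum \<in> V \<and>
     (\<forall>u\<in>V. \<forall>v\<in>V. \<forall>n. Y u v n \<in> V) \<and>
     (\<forall>u\<in>V. \<forall>n. linear_on_subspace smul V (\<lambda>v. Y u v n)) \<and>
     (\<forall>v\<in>V. \<forall>n. linear_on_subspace smul V (\<lambda>u. Y u v n)) \<and>
     (\<exists>n0. \<forall>n<n0. Vn n = {0}) \<and>
     (\<exists>d. linear_on_subspace smul V d \<and> (\<forall>n. \<forall>v\<in>Vn n. d v = smul (of_int n) v) \<and>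
        (\<forall>u\<in>V. \<forall>v\<in>V. \<forall>n. d (Y u v n) - Y u (d v) n = smul (of_int n) (Y u v n) + Y (d u) v n)) \<and>
     (\<forall>v\<in>V. \<forall>n. Y vacuum v n = (if n = 0 then v else 0)) \<and>
     (\<forall>u\<in>V. (\<forall>n<0. Y u vacuum n = 0) \<and> Y u vacuum 0 = u) \<and>
     (let D = (\<lambda>v. fdx smul (Y v vacuum) 0) in
        \<forall>u\<in>V. \<forall>v\<in>V. \<forall>n. fdx smul (Y u v) n = Y (D u) v n \<and>
          fdx smul (Y u v) n = D (Y u v n) - Y u (D v) n) \<and>
     (\<forall>u1\<in>V. \<forall>v\<in>V. \<exists>q. \<forall>u2\<in>V.
        binomial_mult smul q (product_series smul Y u1 u2 v) =
        binomial_mult smul q (iterate_series Y u1 u2 v))"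

end

theory Submission
  imports Defs
begin

text \<open>The Levi-Civita connection preserves the two null lines of \<open>E\<close>, so in a frame \<open>h\<^sub>+, h\<^sub>-\<close> of null
  vectors with \<open>(h\<^sub>+, h\<^sub>-) = 2\<close> it is diagonal, with connection form \<open>\<theta>\<close> on \<open>h\<^sub>+\<close> and \<open>-\<theta>\<close> on \<open>h\<^sub>-\<close>.
  The coefficient \<open>f\<close> of a parallel tensor at a word of charge \<open>n\<close> (the number of \<open>h\<^sub>+\<close> minus the number
  of \<open>h\<^sub>-\<close>) satisfies \<open>df = -n\<theta>f\<close>. Hence \<open>n d\<theta> f = 0\<close>, and \<open>d\<theta>\<close> vanishes nowhere as \<open>K \<noteq> 0\<close>: only the
  words of charge \<open>0\<close> occur, and their coefficients are constant. Two oriented null frames differ by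
  \<open>diag(z, z\<^sup>-\<^sup>1)\<close>, which acts trivially on words of charge \<open>0\<close>; so these words define global parallel sections.

  The modes \<open>a(n)\<close> with \<open>n > 0\<close> act on the tensor algebra as commuting derivations. With
  \<open>a\<^sup>-(x)\<close> and \<open>a\<^sup>+(x)\<close> the parts of a (divided derivative of a) field with negative and with positive modes, the
  vertex operators satisfy \<open>Y(a(-m)u, x) = a\<^sup>-(x)Y(u, x) + Y(u, x)a\<^sup>+(x)\<close>, and all axioms follow by induction on
  \<open>u\<close>. In the associativity axiom both sides obey the same recursion, except that \<open>a\<^sup>+(x\<^sub>0 + x\<^sub>2)v\<close> is expanded
  in \<open>x\<^sub>2\<close> on one side and in \<open>x\<^sub>0\<close> on the other; a power of \<open>x\<^sub>0 + x\<^sub>2\<close> that depends only on \<open>u\<^sub>1\<close> and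
  \<open>v\<close> removes this difference.\<close>

section \<open>Words and linear maps of the tensor algebra\<close>

text \<open>The formula for Y is given on the basis vectors in h_+ and h_- only, and its sum over
  mode lists hides bilinearity. So \<open>Y\<close> is built on the whole tensor algebra, by
  recursion on words in the standard basis, where the weights of the words bound the sums. All
  axioms are proved there; V enters only through closure. Closure holds because h_+(n) contracts
  with letters h_- only and vice versa, so that charges add under \<open>Y\<close>. The normally
  ordered product obeys the same recursion because positive modes commute.

  On the geometric side the preferred charts jump from point to point, and charts may have either
  orientation. Each chart therefore carries its own smooth null frame, with a sign \<sigma> in front
  of the imaginary unit, and the connection is computed in that frame. To compare charts it is
  enough that two null frames with equal determinant differ by diag(z, 1/z). A further sign \<tau>
  adapts the orientation to (e_1, e_2) at p.\<close>

abbreviation lk :: "tens \<Rightarrow> word \<Rightarrow> complex" where "lk \<equiv> Poly_Mapping.lookup"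

lemma lmul_add: "lmul a m (s + t) = lmul a m s + lmul a m t"
  by (simp add: lmul_def lin_ext_add)

lemma lmul_scaleT: "lmul a m (scaleT z t) = scaleT z (lmul a m t)"
  by (simp add: lmul_def lin_ext_scaleT)

lemma scaleT_zero [simp]: "scaleT z 0 = 0" "scaleT 0 t = 0"
  by (auto intro!: poly_mapping_eqI simp: lookup_scaleT)

lemma lin_ext_zero [simp]: "lin_ext f 0 = 0"
  by (simp add: lin_ext_def)

lemma lmul_zero [simp]: "lmul a m 0 = 0"
  by (simp add: lmul_def)

lemma lmul_sum: "lmul a m (\<Sum>i\<in>S. t i) = (\<Sum>i\<in>S. lmul a m (t i))"
  by (simp add: lmul_def lin_ext_sum)

lemma lookup_lmul_Nil [simp]: "lk (lmul a m t) [] = 0"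
  by (induction t rule: tens_induct)
    (auto simp: lmul_add lookup_add, auto simp: lmul_def lin_ext_single lookup_scaleT lookup_sum lookup_single)

lemma lookup_lmul_Cons [simp]:
  "lk (lmul a m t) (b # w) = (if snd b = m then a $ fst b * lk t w else 0)"
proof (induction t rule: tens_induct)
  case (3 v z)
  have "(\<Sum>i\<in>UNIV. lk (Poly_Mapping.single ((i, m) # v) (a $ i)) (b # w)) =
    (\<Sum>i\<in>UNIV. if i = fst b then (if snd b = m \<and> v = w then a $ i else 0) else 0)"
    by (rule sum.cong) (auto simp: lookup_single when_def prod_eq_iff)
  then show ?case
    by (auto simp: lmul_def lin_ext_single lookup_scaleT lookup_sum) (auto simp: lookup_single when_def)
qed (auto simp: lmul_add lookup_add algebra_simps)

lemma tens_eqI: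
  assumes "lk s [] = lk t []" "\<And>i m w. lk s ((i, m) # w) = lk t ((i, m) # w)"
  shows "s = t"
proof (rule poly_mapping_eqI)
  fix w show "lk s w = lk t w" using assms by (cases w) auto
qed

text \<open>The action of \<^const>\<open>tmap\<close> on component functions, see \<open>lookup_tmap\<close>; it also applies to
  families of components that depend on a point.\<close>

fun tmc :: "complex^2^2 \<Rightarrow> (word \<Rightarrow> complex) \<Rightarrow> word \<Rightarrow> complex" where
  "tmc L T [] = T []"
| "tmc L T (b # w) = (\<Sum>j\<in>UNIV. L $ fst b $ j * tmc L (\<lambda>v. T ((j, snd b) # v)) w)"

lemma tmc_add: "tmc L (\<lambda>w. S w + T w) w = tmc L S w + tmc L T w"
  by (induction w arbitrary: S T) (auto simp: algebra_simps sum.distrib)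

lemma tmc_scale: "tmc L (\<lambda>w. z * T w) w = z * tmc L T w"
  by (induction w arbitrary: T) (auto simp: algebra_simps sum_distrib_left)

lemma tmc_zero [simp]: "tmc L (\<lambda>w. 0) w = 0"
  using tmc_scale[of L 0 "\<lambda>_. 0" w] by simp

lemma tmc_sum: "tmc L (\<lambda>w. \<Sum>i\<in>I. T i w) w = (\<Sum>i\<in>I. tmc L (T i) w)"
  by (induction I rule: infinite_finite_induct) (auto simp: tmc_add)

lemma tmap_add: "tmap L (s + t) = tmap L s + tmap L t"
  by (simp add: tmap_def lin_ext_add)

lemma tmap_scaleT: "tmap L (scaleT z t) = scaleT z (tmap L t)"
  by (simp add: tmap_def lin_ext_scaleT)

lemma tmap_zero [simp]: "tmap L 0 = 0"
  by (simp add: tmap_def)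

lemma lookup_tmap_word: "lk (tmap_word L v) w = tmc L (lk (Poly_Mapping.single v 1)) w"
proof (induction v arbitrary: w)
  case Nil
  show ?case by (cases w) (auto simp: vac_def lookup_single when_def)
next
  case (Cons c v)
  show ?case
  proof (cases w)
    case Nil then show ?thesis by (auto simp: lookup_single when_def)
  next
    case w: (Cons b w')
    have "tmc L (\<lambda>u. lk (Poly_Mapping.single (c # v) 1) ((j, snd b) # u)) w' =
        (if j = fst c then if snd b = snd c then tmc L (lk (Poly_Mapping.single v 1)) w' else 0 else 0)" for j
    proof -
      have *: "(\<lambda>u. lk (Poly_Mapping.single (c # v) 1) ((j, snd b) # u)) =
         (\<lambda>u. (if j = fst c \<and> snd b = snd c then 1 else 0) * lk (Poly_Mapping.single v 1) u)"
        by (auto simp: fun_eq_iff lookup_single when_def prod_eq_iff)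
      show ?thesis unfolding * tmc_scale by simp
    qed
    then show ?thesis
      using Cons[of w'] by (auto simp: w column_def if_distrib[where f="\<lambda>x. _ * x"] cong: if_cong)
  qed
qed

lemma lookup_tmap: "lk (tmap L t) w = tmc L (lk t) w"
proof (induction t rule: tens_induct)
  case (2 s t) then show ?case by (simp add: tmap_add lookup_add tmc_add)
next
  case (3 v z)
  have "lk (Poly_Mapping.single v z) = (\<lambda>w. z * lk (Poly_Mapping.single v 1) w)"
    by (auto simp: fun_eq_iff lookup_single when_def)
  then show ?case by (simp add: tmap_def lin_ext_single lookup_scaleT lookup_tmap_word tmc_scale)
qed simp

lemma tmc_mult: "tmc (L ** M) T w = tmc L (tmc M T) w"
proof (induction w arbitrary: T)
  case (Cons b w)
  have "tmc (L ** M) T (b # w) = (\<Sum>j\<in>UNIV. \<Sum>k\<in>UNIV. L $ fst b $ k * M $ k $ j * tmc L (tmc M (\<lambda>v. T ((j, snd b) # v))) w)"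
    unfolding tmc.simps Cons by (simp add: matrix_matrix_mult_def sum_distrib_right)
  also have "\<dots> = (\<Sum>k\<in>UNIV. \<Sum>j\<in>UNIV. L $ fst b $ k * M $ k $ j * tmc L (tmc M (\<lambda>v. T ((j, snd b) # v))) w)"
    by (rule sum.swap)
  also have "\<dots> = tmc L (tmc M T) (b # w)"
    by (simp add: tmc_sum tmc_scale sum_distrib_left mult.assoc)
  finally show ?case .
qed simp

lemma tmc_one [simp]: "tmc (mat 1) T w = T w"
proof (induction w arbitrary: T)
  case (Cons b w)
  have "tmc (mat 1) T (b # w) = (\<Sum>j\<in>UNIV. if j = fst b then T ((j, snd b) # w) else 0)"
    unfolding tmc.simps Cons by (rule sum.cong) (auto simp: mat_def)
  then show ?case by simp
qed simp

lemma tmap_mult: "tmap (L ** M) t = tmap L (tmap M t)"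
  by (rule poly_mapping_eqI) (simp add: lookup_tmap tmc_mult ext[OF lookup_tmap])

lemma tmap_one [simp]: "tmap (mat 1) t = t"
  by (rule poly_mapping_eqI) (simp add: lookup_tmap)

lemma tmap_lmul: "tmap L (lmul a m t) = lmul (L *v a) m (tmap L t)"
proof (rule tens_eqI)
  fix i n w
  have *: "tmc L (\<lambda>v. lk (lmul a m t) ((j, n) # v)) w = (if n = m then a $ j * tmc L (lk t) w else 0)" for j
    by (simp add: tmc_scale)
  show "lk (tmap L (lmul a m t)) ((i, n) # w) = lk (lmul (L *v a) m (tmap L t)) ((i, n) # w)"
    unfolding lookup_tmap tmc.simps snd_conv fst_conv *
    by (simp add: lookup_tmap matrix_vector_mult_def sum_distrib_right mult.assoc)
qed (simp add: lookup_tmap)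

lemma tmap_vac [simp]: "tmap L vac = vac"
  by (simp add: vac_def tmap_def lin_ext_single)

lemma single_Cons: "Poly_Mapping.single ((i, m) # w) z = lmul (axis i 1) m (Poly_Mapping.single w z)"
  by (rule tens_eqI) (auto simp: lookup_single when_def axis_def)

lemma matrix_vector_mul_axis: "H *v axis i 1 = column i (H :: complex^2^2)"
  by (simp add: vec_eq_iff matrix_vector_mult_def column_def axis_def if_distrib[where f="\<lambda>x. _ * x"] cong: if_cong)

section \<open>Words in h_+ and h_- as words in the standard basis\<close>

definition sidx :: "sign \<Rightarrow> 2" where "sidx s = (case s of Pos \<Rightarrow> 1 | Neg \<Rightarrow> 2)"

definition wordof :: "(sign \<times> nat) list \<Rightarrow> word" where "wordof = map (map_prod sidx id)"

definition positive :: "('a \<times> nat) list set" where "positive = {ws. \<forall>(i, m)\<in>set ws. m > 0}"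

lemma positive_Nil [simp]: "[] \<in> positive" by (simp add: positive_def)
lemma positive_Cons [simp]: "b # w \<in> positive \<longleftrightarrow> snd b > 0 \<and> w \<in> positive"
  by (cases b) (auto simp: positive_def)

lemma sidx_simps [simp]: "sidx Pos = 1" "sidx Neg = 2" by (simp_all add: sidx_def)

lemma inj_sidx: "inj sidx"
  by (rule injI) (auto simp: sidx_def split: sign.splits)

lemma sidx_surj: "\<exists>s. i = sidx s"
  by (metis exhaust_2 sidx_simps)

lemma inj_wordof: "inj wordof"
  unfolding wordof_def by (intro inj_mapI prod.inj_map inj_sidx inj_on_id)

lemma wordof_simps [simp]: "wordof [] = []" "wordof ((s, m) # ws) = (sidx s, m) # wordof ws"
  by (simp_all add: wordof_def)

lemma surj_wordof: "\<exists>ws. w = wordof ws"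
proof (induction w)
  case Nil then show ?case by (intro exI[of _ "[]"]) simp
next
  case (Cons b w)
  then obtain ws where "w = wordof ws" by blast
  moreover obtain s where "fst b = sidx s" using sidx_surj by blast
  ultimately show ?case by (intro exI[of _ "(s, snd b) # ws"]) (auto simp: prod_eq_iff)
qed

lemma wordof_positive [simp]: "wordof ws \<in> positive \<longleftrightarrow> ws \<in> positive"
  by (auto simp: positive_def wordof_def split: prod.splits)

lemma mode_vec_Nil [simp]: "mode_vec G l h [] = vac"
  by (simp add: mode_vec_def)

lemma mode_vec_Cons [simp]: "m > 0 \<Longrightarrow> mode_vec G l h ((i, m) # ws) = lmul (h i) m (mode_vec G l h ws)"
  by (simp add: mode_vec_def mode_def)

text \<open>The algebra map of H sends e_1, e_2 to h_+, h_-, so the vectors in question are images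
  of monomials. When H is invertible, span and independence become questions about supports of
  words.\<close>

lemma mode_vec_tmap:
  assumes "ws \<in> positive" "\<And>s. column (sidx s) H = h s"
  shows "mode_vec G l h ws = tmap H (Poly_Mapping.single (wordof ws) 1)"
  using assms(1)
proof (induction ws)
  case Nil show ?case by (simp flip: vac_def)
next
  case (Cons b ws)
  then show ?case
    by (cases b) (simp add: single_Cons tmap_lmul matrix_vector_mul_axis assms(2))
qed

section \<open>Locally finite sums\<close>

lemma tensor_alg_0 [simp]: "0 \<in> tensor_alg" and tensor_alg_vac [simp]: "vac \<in> tensor_alg"
  by (auto simp: tensor_alg_def vac_def)

lemma tensor_alg_iff: "t \<in> tensor_alg \<longleftrightarrow> (\<forall>w. lk t w \<noteq> 0 \<longrightarrow> w \<in> positive)"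
  by (auto simp: tensor_alg_def positive_def in_keys_iff)

lemma subspace_tensor_alg: "T.subspace tensor_alg"
proof (rule T.subspaceI)
  fix x y :: tens assume "x \<in> tensor_alg" "y \<in> tensor_alg"
  then show "x + y \<in> tensor_alg" unfolding tensor_alg_iff lookup_add by (metis add.right_neutral)
qed (auto simp: tensor_alg_iff lookup_scaleT)

lemma lmul_tensor_alg [intro]: "t \<in> tensor_alg \<Longrightarrow> m > 0 \<Longrightarrow> lmul a m t \<in> tensor_alg"
  unfolding tensor_alg_iff
  by (intro allI, rename_tac w, case_tac w) auto

text \<open>The tensor algebra arises from the vacuum by left multiplications. Allowing any vector
  a, not just a basis vector, keeps the inductions independent of a frame; the index
  \<open>Suc m\<close> matches the divided derivative of order m in the vertex operator.\<close>

lemma tensor_alg_induct [consumes 1, case_names vac add scale lmul]: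
  assumes "t \<in> tensor_alg"
    and vac: "P vac" and add: "\<And>s t. s \<in> tensor_alg \<Longrightarrow> t \<in> tensor_alg \<Longrightarrow> P s \<Longrightarrow> P t \<Longrightarrow> P (s + t)"
    and scale: "\<And>z t. t \<in> tensor_alg \<Longrightarrow> P t \<Longrightarrow> P (scaleT z t)"
    and lmul: "\<And>a m t. t \<in> tensor_alg \<Longrightarrow> P t \<Longrightarrow> P (lmul a (Suc m) t)"
  shows "P t"
proof -
  have 1: "Poly_Mapping.single w 1 \<in> tensor_alg \<and> P (Poly_Mapping.single w 1)" if "w \<in> positive" for w
    using that
  proof (induction w)
    case Nil then show ?case using vac by (simp flip: vac_def)
  next
    case (Cons b w)
    then obtain m where m: "snd b = Suc m" by (cases "snd b") auto
    have "Poly_Mapping.single (b # w) 1 = lmul (axis (fst b) 1) (Suc m) (Poly_Mapping.single w (1::complex))"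
      using single_Cons[of "fst b" "snd b" w 1] by (simp add: m[symmetric])
    with Cons lmul show ?case by auto
  qed
  have P0: "P 0" using scale[OF _ vac, of 0] by simp
  have *: "finite S \<Longrightarrow> S \<subseteq> positive \<Longrightarrow> (\<Sum>w\<in>S. scaleT (c w) (Poly_Mapping.single w 1)) \<in> tensor_alg \<and>
     P (\<Sum>w\<in>S. scaleT (c w) (Poly_Mapping.single w 1))" for S c
  proof (induction S rule: finite_induct)
    case (insert w S)
    then show ?case using 1[of w]
      by (auto intro!: add scale T.subspace_add[OF subspace_tensor_alg] T.subspace_scale[OF subspace_tensor_alg])
  qed (simp add: P0)
  have t: "t = (\<Sum>w\<in>Poly_Mapping.keys t. scaleT (lk t w) (Poly_Mapping.single w 1))"
    by (rule poly_mapping_eqI) (auto simp: lookup_sum lookup_single when_def in_keys_iff lookup_scaleT if_distrib[where f="\<lambda>x. _ * x"] cong: if_cong)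
  have k: "Poly_Mapping.keys t \<subseteq> positive"
    using assms(1) by (auto simp: tensor_alg_iff in_keys_iff)
  show ?thesis by (subst t) (rule conjunct2[OF *[OF finite_keys k]])
qed

section \<open>Weight\<close>

definition wt :: "word \<Rightarrow> int" where "wt w = int (sum_list (map snd w))"

lemma wt_simps [simp]: "wt [] = 0" "wt (b # w) = int (snd b) + wt w"
  by (simp_all add: wt_def)

lemma wt_nonneg [simp]: "wt w \<ge> 0" by (simp add: wt_def)

definition hom :: "int \<Rightarrow> tens \<Rightarrow> bool" where "hom n t \<longleftrightarrow> (\<forall>w. lk t w \<noteq> 0 \<longrightarrow> wt w = n)"

lemma hom_0 [simp]: "hom n 0" by (simp add: hom_def)
lemma hom_add: "hom n s \<Longrightarrow> hom n t \<Longrightarrow> hom n (s + t)"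
  unfolding hom_def lookup_add by (metis add.right_neutral)
lemma hom_scaleT: "hom n t \<Longrightarrow> hom n (scaleT z t)"
  by (auto simp: hom_def lookup_scaleT)
lemma hom_sum: "(\<And>i. i \<in> I \<Longrightarrow> hom n (f i)) \<Longrightarrow> hom n (\<Sum>i\<in>I. f i)"
  by (induction I rule: infinite_finite_induct) (auto intro: hom_add)
lemma hom_lmul: "hom n t \<Longrightarrow> k = n + int m \<Longrightarrow> hom k (lmul a m t)"
  unfolding hom_def by (intro allI, rename_tac w, case_tac w) auto
lemma hom_lin_ext: "(\<And>w. lk t w \<noteq> 0 \<Longrightarrow> hom n (f w)) \<Longrightarrow> hom n (lin_ext f t)"
  unfolding lin_ext_def by (intro hom_sum hom_scaleT) (simp add: in_keys_iff)
lemma hom_single: "wt w = n \<Longrightarrow> hom n (Poly_Mapping.single w z)"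
  by (auto simp: hom_def lookup_single when_def)
text \<open>Words have nonnegative weight. The truncation of vertex operators and of positive modes
  rests on this: what would have negative weight is zero.\<close>

lemma hom_neg: "hom n t \<Longrightarrow> n < 0 \<Longrightarrow> t = 0"
  unfolding hom_def by (intro poly_mapping_eqI) (metis wt_nonneg lookup_zero not_le)

text \<open>Sums with finitely many nonzero terms. Quantifying over all large bounds makes it unnecessary to
  find a common bound for the sums in an identity.\<close>

definition esum :: "(nat \<Rightarrow> tens) \<Rightarrow> tens \<Rightarrow> bool" where
  "esum f s \<longleftrightarrow> (\<forall>\<^sub>F B in sequentially. (\<Sum>k<B. f k) = s)"

lemma esum_unique: "esum f s \<Longrightarrow> esum f t \<Longrightarrow> s = t"
  unfolding esum_def
  by (drule (1) eventually_conj, drule eventually_happens'[OF sequentially_bot]) auto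

lemma esum_cong: "esum f s \<Longrightarrow> (\<And>k. f k = g k) \<Longrightarrow> s = t \<Longrightarrow> esum g t"
  by (simp add: esum_def)

lemma esum_add: "esum f s \<Longrightarrow> esum g t \<Longrightarrow> esum (\<lambda>k. f k + g k) (s + t)"
  unfolding esum_def by (drule (1) eventually_conj, erule eventually_mono) (simp add: sum.distrib)

lemma esum_map:
  assumes "esum f s" "\<And>x y. L (x + y) = L x + L y"
  shows "esum (\<lambda>k. L (f k)) (L s)"
proof -
  have "L 0 = 0" using assms(2)[of 0 0] by simp
  then have "L (\<Sum>k<B. f k) = (\<Sum>k<B. L (f k))" for B :: nat
    by (induction B) (auto simp: assms(2))
  then show ?thesis using assms(1) by (auto simp: esum_def elim!: eventually_mono)
qed

lemma esum_scaleT: "esum f s \<Longrightarrow> esum (\<lambda>k. scaleT z (f k)) (scaleT z s)"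
  by (erule esum_map) (simp add: T.scale_right_distrib)

lemma esum_diff: "esum f s \<Longrightarrow> esum g t \<Longrightarrow> esum (\<lambda>k. f k - g k) (s - t)"
  unfolding esum_def by (drule (1) eventually_conj, erule eventually_mono) (simp add: sum_subtractf)

lemma esum_0 [simp]: "esum (\<lambda>k. 0) 0" by (simp add: esum_def)

lemma esum_sum: "finite I \<Longrightarrow> (\<And>i. i \<in> I \<Longrightarrow> esum (f i) (s i)) \<Longrightarrow> esum (\<lambda>k. \<Sum>i\<in>I. f i k) (\<Sum>i\<in>I. s i)"
  by (induction I rule: finite_induct) (auto intro!: esum_add)

lemma esum_finite: "(\<And>k. k \<ge> n \<Longrightarrow> f k = 0) \<Longrightarrow> esum f (\<Sum>k<n. f k)"
  unfolding esum_def eventually_sequentially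
  by (intro exI[of _ n] allI impI sum.mono_neutral_right) auto

lemma esum_single: "esum (\<lambda>k. if k = n then f k else 0) (f n)"
  using esum_finite[of "Suc n" "\<lambda>k. if k = n then f k else 0"] by simp

lemma esum_Suc: "esum f s \<Longrightarrow> esum (\<lambda>k. case k of 0 \<Rightarrow> 0 | Suc k \<Rightarrow> f k) s"
proof -
  assume "esum f s"
  then obtain n where n: "\<And>B. B \<ge> n \<Longrightarrow> (\<Sum>k<B. f k) = s"
    by (auto simp: esum_def eventually_sequentially)
  have "(\<Sum>k<B. case k of 0 \<Rightarrow> 0 | Suc k \<Rightarrow> f k) = s" if "B \<ge> Suc n" for B
    using that n[of "B - 1"] by (cases B) (auto simp: sum.lessThan_Suc_shift simp del: sum.lessThan_Suc)
  then show ?thesis unfolding esum_def eventually_sequentially by blast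
qed

lemma esum_subspace:
  assumes "esum f s" "T.subspace S" "\<And>k. f k \<in> S" shows "s \<in> S"
proof -
  obtain B where "(\<Sum>k<B. f k) = s"
    using assms(1) by (auto simp: esum_def eventually_sequentially)
  then show ?thesis using T.subspace_sum[OF assms(2)] assms(3) by metis
qed

lemma esum_shift_up: "esum f s \<Longrightarrow> (\<And>k. g (Suc k) = f k) \<Longrightarrow> g 0 = 0 \<Longrightarrow> esum g s"
  by (drule esum_Suc, erule esum_cong) (auto split: nat.split)

text \<open>For nested expansions: a double family of finite support is regrouped by the total
  degree k + i.\<close>

lemma esum_antidiagonal:
  assumes f: "\<And>k i. k \<ge> n \<or> i \<ge> n \<Longrightarrow> f k i = 0"
    and s: "\<And>k. esum (f k) (s k)"
  shows "esum (\<lambda>K. \<Sum>k\<le>K. f k (K - k)) (\<Sum>k<n. s k)"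
proof -
  have s': "s k = (\<Sum>i<n. f k i)" for k
    using esum_unique[OF s esum_finite[of n]] f by blast
  \<comment> \<open>The family vanishes outside a square of side n, and the triangle k + i < B
    contains this square once B \<ge> 2n.\<close>
  have "(\<Sum>K<B. \<Sum>k\<le>K. f k (K - k)) = (\<Sum>k<n. s k)" if "B \<ge> 2 * n" for B
  proof -
    have "(\<Sum>K<B. \<Sum>k\<le>K. f k (K - k)) = (\<Sum>(k, i)\<in>{(k, i). k + i < B}. f k i)"
      by (rule sum.triangle_reindex[symmetric])
    also have "\<dots> = (\<Sum>(k, i)\<in>{..<n} \<times> {..<n}. f k i)"
    proof (rule sum.mono_neutral_right)
      show "finite {(k, i). k + i < B}"
        by (rule finite_subset[of _ "{..<B} \<times> {..<B}"]) auto
      show "{..<n} \<times> {..<n} \<subseteq> {(k, i). k + i < B}" using that by auto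
      show "\<forall>x\<in>{(k, i). k + i < B} - {..<n} \<times> {..<n}. (case x of (k, i) \<Rightarrow> f k i) = 0"
      proof
        fix x assume x: "x \<in> {(k, i). k + i < B} - {..<n} \<times> {..<n}"
        obtain k i where [simp]: "x = (k, i)" by (cases x)
        have "k \<ge> n \<or> i \<ge> n" using x by auto
        then show "(case x of (k, i) \<Rightarrow> f k i) = 0" using f by simp
      qed
    qed
    finally show ?thesis by (simp add: s' sum.cartesian_product)
  qed
  then show ?thesis unfolding esum_def eventually_sequentially by blast
qed

section \<open>Annihilation operators and the vertex operator map\<close>

locale metric_modes =
  fixes g :: "'m metric" and p :: 'm and l :: complex
begin

abbreviation G :: "complex^2 \<Rightarrow> complex^2 \<Rightarrow> complex" where "G \<equiv> cmetric g p"

section \<open>Positive modes\<close>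

definition ann :: "complex^2 \<Rightarrow> nat \<Rightarrow> tens \<Rightarrow> tens" where "ann a n = mode G l a (int n)"

lemma ann_0 [simp]: "ann a 0 t = 0" by (simp add: ann_def mode_def)

lemma ann_add: "ann a n (s + t) = ann a n s + ann a n t"
  by (simp add: ann_def mode_def lin_ext_add)

lemma ann_scaleT: "ann a n (scaleT z t) = scaleT z (ann a n t)"
  by (simp add: ann_def mode_def lin_ext_scaleT)

lemma ann_zero [simp]: "ann a n 0 = 0"
  by (simp add: ann_def mode_def)

lemma ann_vac [simp]: "ann a n vac = 0"
  using mode_vac[of "int n" G l a] by (cases n) (auto simp: ann_def mode_def)

lemma ann_lmul:
  assumes "m > 0"
  shows "ann a n (lmul b m t) = lmul b m (ann a n t) + (if n = m then scaleT (of_nat n * G a b * l) t else 0)"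
proof (cases "n = 0")
  case False
  then show ?thesis
    using mode_commute[of "int n" "int m" G g p l a b t] assms by (cases "n = m") (simp_all add: ann_def, simp_all add: mode_def)
qed (use assms in auto)

lemma G_axis: "G a b = (\<Sum>i\<in>UNIV. a $ i * G (axis i 1) b)"
  by (simp add: cmetric_def sum_2 axis_def algebra_simps)

lemma ann_word_axis: "ann_word G l a n w = (\<Sum>i\<in>UNIV. scaleT (a $ i) (ann_word G l (axis i 1) n w))"
proof (induction w)
  case (Cons b w)
  have "Poly_Mapping.single w (of_nat n * G a (axis (fst b) 1) * l) =
     (\<Sum>i\<in>UNIV. scaleT (a $ i) (Poly_Mapping.single w (of_nat n * G (axis i 1) (axis (fst b) 1) * l)))"
    by (subst G_axis) (simp add: scaleT_single sum_2 algebra_simps flip: single_add)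
  then show ?case
    unfolding ann_word.simps
    by (subst Cons, cases "n = snd b") (simp_all add: T.scale_right_distrib sum.distrib lmul_sum lmul_scaleT)
qed simp

lemma ann_axis: "ann a n t = (\<Sum>i\<in>UNIV. scaleT (a $ i) (ann (axis i 1) n t))"
proof (induction t rule: tens_induct)
  case (3 w z)
  show ?case
    by (simp add: ann_def mode_def lin_ext_single ann_word_axis[of a] T.scale_sum_right mult.commute)
qed (simp_all add: ann_add T.scale_right_distrib sum.distrib)

lemma ann_tensor_alg [intro]: "t \<in> tensor_alg \<Longrightarrow> ann a n t \<in> tensor_alg"
  by (induction t rule: tensor_alg_induct)
    (auto simp: ann_add ann_scaleT ann_lmul intro!: T.subspace_add[OF subspace_tensor_alg] T.subspace_scale[OF subspace_tensor_alg])

text \<open>Both sides contract one letter with a and another with b, with scalar factors, so the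
  order is irrelevant. The commutation is not imposed as a relation; it follows from the action on
  the vacuum.\<close>

lemma ann_commute: "t \<in> tensor_alg \<Longrightarrow> ann a n (ann b k t) = ann b k (ann a n t)"
  by (induction t rule: tensor_alg_induct) (auto simp: ann_add ann_scaleT ann_lmul)

lemma hom_ann_word: "n > 0 \<Longrightarrow> hom (wt w - int n) (ann_word G l a n w)"
  by (induction w) (auto intro!: hom_add hom_single elim!: hom_lmul)

lemma hom_ann: "hom d t \<Longrightarrow> hom (d - int n) (ann a n t)"
proof (cases "n = 0")
  case False
  assume "hom d t"
  then show ?thesis using False hom_ann_word[of n _ a]
    unfolding ann_def mode_def by (auto simp: hom_def[of d t] intro!: hom_lin_ext)
qed simp

lemma ann_vanish: "\<exists>B. \<forall>n\<ge>B. ann a n t = 0"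
proof (induction t rule: tens_induct)
  case (2 s t)
  then obtain B C where "\<forall>n\<ge>B. ann a n s = 0" "\<forall>n\<ge>C. ann a n t = 0" by blast
  then show ?case by (intro exI[of _ "max B C"]) (auto simp: ann_add)
next
  case (3 w z)
  have "ann a n (Poly_Mapping.single w z) = 0" if "n \<ge> nat (wt w + 1)" for n
    by (rule hom_neg[OF hom_ann[OF hom_single[OF refl]]]) (use that wt_nonneg[of w] in linarith)
  then show ?case by blast
qed auto

text \<open>The coefficients of the divided \<open>m\<close>-th derivatives of \<open>x\<^sup>m\<^sup>+\<^sup>k\<close> and of \<open>x\<^sup>-\<^sup>k\<^sup>-\<^sup>1\<close>.\<close>

definition cp :: "nat \<Rightarrow> nat \<Rightarrow> complex" where "cp m k = of_nat ((m + k) choose k)"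
definition cm :: "nat \<Rightarrow> nat \<Rightarrow> complex" where "cm m k = (-1) ^ m * of_nat ((m + k) choose k)"

text \<open>The recursion Y(a(-m)u, x) = a^-(x)Y(u, x) + Y(u, x)a^+(x) on pairs of words. The ranges
  of k come from weights: \<open>Yw w z (N - int k)\<close> has weight
  \<open>wt w + wt z + N - int k\<close>, and a(k) lowers the weight of z by k, so a term beyond the
  range would have negative weight.\<close>

primrec Yw :: "word \<Rightarrow> word \<Rightarrow> int \<Rightarrow> tens" where
  "Yw [] z N = (if N = 0 then Poly_Mapping.single z 1 else 0)"
| "Yw (b # w) z N =
     (\<Sum>k<nat (N + wt w + wt z + 1). scaleT (cp (snd b - 1) k) (lmul (axis (fst b) 1) (snd b + k) (Yw w z (N - int k)))) +
     (\<Sum>k<nat (wt z + 1). scaleT (cm (snd b - 1) k)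
        (lin_ext (\<lambda>z'. Yw w z' (N + int k + int (snd b))) (ann (axis (fst b) 1) k (Poly_Mapping.single z 1))))"

lemma hom_Yw: "hom (wt w + wt z + N) (Yw w z N)"
proof (induction w arbitrary: z N)
  case (Cons b w)
  show ?case unfolding Yw.simps
  proof (intro hom_add hom_sum hom_scaleT)
    fix k
    show "hom (wt (b # w) + wt z + N) (lmul (axis (fst b) 1) (snd b + k) (Yw w z (N - int k)))"
      by (rule hom_lmul[OF Cons]) simp
    have "wt z' = wt z - int k" if "lk (ann (axis (fst b) 1) k (Poly_Mapping.single z 1)) z' \<noteq> 0" for z'
      using hom_ann[OF hom_single[OF refl], of z k "axis (fst b) 1" 1] that by (simp add: hom_def)
    then have "wt (b # w) + wt z + N = wt w + wt z' + (N + int k + int (snd b))"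
      if "lk (ann (axis (fst b) 1) k (Poly_Mapping.single z 1)) z' \<noteq> 0" for z'
      using that by simp
    then show "hom (wt (b # w) + wt z + N) (lin_ext (\<lambda>z'. Yw w z' (N + int k + int (snd b)))
        (ann (axis (fst b) 1) k (Poly_Mapping.single z 1)))"
      by (intro hom_lin_ext) (metis Cons)
  qed
qed (auto intro: hom_single)

definition Y :: "tens \<Rightarrow> tens \<Rightarrow> int \<Rightarrow> tens" where
  "Y u v N = lin_ext (\<lambda>w. lin_ext (\<lambda>z. Yw w z N) v) u"

lemma lin_ext_fun_add: "lin_ext (\<lambda>w. f w + f' w) t = lin_ext f t + lin_ext f' t"
  by (simp add: lin_ext_def T.scale_right_distrib sum.distrib)

lemma lin_ext_fun_scaleT: "lin_ext (\<lambda>w. scaleT z (f w)) t = scaleT z (lin_ext f t)"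
  by (simp add: lin_ext_def T.scale_sum_right mult.commute)

lemma Y_add_left: "Y (s + t) v N = Y s v N + Y t v N"
  and Y_add_right: "Y u (s + t) N = Y u s N + Y u t N"
  and Y_scaleT_left: "Y (scaleT z u) v N = scaleT z (Y u v N)"
  and Y_scaleT_right: "Y u (scaleT z v) N = scaleT z (Y u v N)"
  and Y_zero_left [simp]: "Y 0 v N = 0"
  by (simp_all add: Y_def lin_ext_add lin_ext_scaleT lin_ext_fun_add lin_ext_fun_scaleT)

lemma Y_zero_right [simp]: "Y u 0 N = 0"
  using Y_scaleT_right[of u 0 0] by simp

lemma Y_sum_left: "Y (\<Sum>i\<in>I. f i) v N = (\<Sum>i\<in>I. Y (f i) v N)"
  by (induction I rule: infinite_finite_induct) (auto simp: Y_add_left)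

lemma Y_sum_right: "Y u (\<Sum>i\<in>I. f i) N = (\<Sum>i\<in>I. Y u (f i) N)"
  by (induction I rule: infinite_finite_induct) (auto simp: Y_add_right)

lemma Y_single: "Y (Poly_Mapping.single w x) (Poly_Mapping.single z y) N = scaleT (x * y) (Yw w z N)"
  by (simp add: Y_def lin_ext_single)

lemma Y_single_left: "Y (Poly_Mapping.single w x) v N = scaleT x (lin_ext (\<lambda>z. Yw w z N) v)"
  by (simp add: Y_def lin_ext_single)

lemma Y_vanish: "\<exists>B::nat. \<forall>N < - int B. Y u v N = 0"
proof (induction u rule: tens_induct)
  case (2 s t)
  then obtain B C :: nat where "\<forall>N < - int B. Y s v N = 0" "\<forall>N < - int C. Y t v N = 0" by blast
  then show ?case by (intro exI[of _ "max B C"]) (auto simp: Y_add_left)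
next
  case (3 w x)
  show ?case
  proof (induction v rule: tens_induct)
    case (2 s t)
    then obtain B C :: nat where "\<forall>N < - int B. Y (Poly_Mapping.single w x) s N = 0"
      "\<forall>N < - int C. Y (Poly_Mapping.single w x) t N = 0" by blast
    then show ?case by (intro exI[of _ "max B C"]) (auto simp: Y_add_right)
  next
    case (3 z y)
    have "Yw w z N = 0" if "N < - int (nat (wt w + wt z))" for N
      by (rule hom_neg[OF hom_Yw]) (use that wt_nonneg[of w] wt_nonneg[of z] in linarith)
    then show ?case by (metis Y_single scaleT_zero(1))
  qed auto
qed auto

lemma Y_vac [simp]: "Y vac v N = (if N = 0 then v else 0)"
proof -
  have "lin_ext (\<lambda>z. Poly_Mapping.single z 1) v = v"
    by (rule poly_mapping_eqI) (auto simp: lin_ext_def lookup_sum lookup_scaleT lookup_single when_def in_keys_iff if_distrib[where f="\<lambda>x. _ * x"] cong: if_cong)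
  then show ?thesis by (simp add: vac_def Y_single_left) (simp add: lin_ext_def)
qed

text \<open>The terms of the coefficients of \<open>x\<^sup>N\<close> in \<open>a\<^sup>-(x)Y(u, x)v\<close> and in \<open>Y(u, x)a\<^sup>+(x)v\<close>, where \<open>a\<^sup>\<plusminus>\<close> is
  the divided \<open>m\<close>-th derivative of \<open>a(x)\<close>.\<close>

abbreviation cterm :: "nat \<Rightarrow> complex^2 \<Rightarrow> tens \<Rightarrow> tens \<Rightarrow> int \<Rightarrow> nat \<Rightarrow> tens" where
  "cterm m a u v N k \<equiv> scaleT (cp m k) (lmul a (Suc m + k) (Y u v (N - int k)))"

abbreviation aterm :: "nat \<Rightarrow> complex^2 \<Rightarrow> tens \<Rightarrow> tens \<Rightarrow> int \<Rightarrow> nat \<Rightarrow> tens" where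
  "aterm m a u v N k \<equiv> scaleT (cm m k) (Y u (ann a k v) (N + int k + int (Suc m)))"

lemma Y_lmul_axis:
  "esum (\<lambda>k. cterm m (axis i 1) t v N k + aterm m (axis i 1) t v N k) (Y (lmul (axis i 1) (Suc m) t) v N)"
proof (induction t rule: tens_induct)
  case (2 s t)
  show ?case
    by (rule esum_cong[OF esum_add[OF 2]])
      (simp_all add: Y_add_left lmul_add T.scale_right_distrib algebra_simps)
next
  case (3 w x)
  show ?case
  proof (induction v rule: tens_induct)
    case (2 s t)
    show ?case
      by (rule esum_cong[OF esum_add[OF 2]])
        (simp_all add: Y_add_right lmul_add ann_add T.scale_right_distrib algebra_simps)
  next
    case (3 z y)
    let ?L = "\<lambda>k. scaleT (cp m k) (lmul (axis i 1) (Suc m + k) (Yw w z (N - int k)))"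
    have 1: "esum ?L (\<Sum>k<nat (N + wt w + wt z + 1). ?L k)"
    proof (rule esum_finite)
      fix k assume "nat (N + wt w + wt z + 1) \<le> k"
      then have "Yw w z (N - int k) = 0"
        by (intro hom_neg[OF hom_Yw]) linarith
      then show "?L k = 0" by simp
    qed
    let ?R = "\<lambda>k. scaleT (cm m k) (lin_ext (\<lambda>z'. Yw w z' (N + int k + int (Suc m))) (ann (axis i 1) k (Poly_Mapping.single z 1)))"
    have 2: "esum ?R (\<Sum>k<nat (wt z + 1). ?R k)"
    proof (rule esum_finite)
      fix k assume "nat (wt z + 1) \<le> k"
      then have "ann (axis i 1) k (Poly_Mapping.single z 1) = 0"
        by (intro hom_neg[OF hom_ann[OF hom_single[OF refl]]]) linarith
      then show "?R k = 0" by simp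
    qed
    have y: "Poly_Mapping.single z y = scaleT y (Poly_Mapping.single z 1)" by (simp add: scaleT_single)
    show ?case
    proof (rule esum_cong[OF esum_scaleT[OF esum_add[OF 1 2], of "x * y"]], goal_cases)
      case (1 k)
      have "Y (Poly_Mapping.single w x) (ann (axis i 1) k (Poly_Mapping.single z y)) (N + int k + int (Suc m)) =
        scaleT (x * y) (lin_ext (\<lambda>z'. Yw w z' (N + int k + int (Suc m))) (ann (axis i 1) k (Poly_Mapping.single z 1)))"
        unfolding y ann_scaleT Y_scaleT_right Y_single_left by (simp add: mult.commute)
      then show ?case
        by (simp add: Y_single lmul_scaleT T.scale_right_distrib mult.commute mult.left_commute)
    next
      case 2
      show ?case
        by (simp add: Y_single flip: single_Cons)
    qed
  qed simp
qed simp

text \<open>The bounds in \<open>Yw\<close> cut off zero terms only, so as a locally finite sum the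
  recursion no longer mentions words; and it is linear in a, hence valid in every frame. The
  inductions on the left argument of \<open>Y\<close> use this form.\<close>

lemma Y_lmul:
  "esum (\<lambda>k. cterm m a t v N k + aterm m a t v N k) (Y (lmul a (Suc m) t) v N)"
proof -
  have "esum (\<lambda>k. \<Sum>i\<in>UNIV. scaleT (a $ i) (cterm m (axis i 1) t v N k + aterm m (axis i 1) t v N k))
     (\<Sum>i\<in>UNIV. scaleT (a $ i) (Y (lmul (axis i 1) (Suc m) t) v N))"
    by (intro esum_sum esum_scaleT Y_lmul_axis) auto
  then show ?thesis
  proof (rule esum_cong)
    show "(\<Sum>i\<in>UNIV. scaleT (a $ i) (Y (lmul (axis i 1) (Suc m) t) v N)) = Y (lmul a (Suc m) t) v N"
      by (subst lmul_sum_axis[of a]) (simp add: Y_sum_left Y_scaleT_left)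
  qed (simp add: T.scale_right_distrib sum.distrib lmul_sum_axis[of a] ann_axis[of a] Y_sum_right Y_scaleT_right T.scale_sum_right mult.commute)
qed

text \<open>The part with positive modes is finite because a(k)v = 0 for large k; the part with
  negative modes is then locally finite as a difference.\<close>

lemma Y_lmul_split:
  obtains s1 s2 where "esum (\<lambda>k. cterm m a t v N k) s1"
    "esum (\<lambda>k. aterm m a t v N k) s2"
    "Y (lmul a (Suc m) t) v N = s1 + s2"
proof -
  obtain B where B: "ann a n v = 0" if "n \<ge> B" for n using ann_vanish by blast
  have 2: "esum (\<lambda>k. aterm m a t v N k)
    (\<Sum>k<B. aterm m a t v N k)"
    by (rule esum_finite) (simp add: B)
  from esum_diff[OF Y_lmul[of m a t v N] this]
  show ?thesis by (intro that[OF _ 2, of "_ - _"]) auto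
qed

lemma Y_tensor_alg [intro]: "u \<in> tensor_alg \<Longrightarrow> v \<in> tensor_alg \<Longrightarrow> Y u v N \<in> tensor_alg"
proof (induction u arbitrary: v N rule: tensor_alg_induct)
  case (lmul a m t)
  show ?case
    by (rule esum_subspace[OF Y_lmul subspace_tensor_alg])
      (auto intro!: T.subspace_add[OF subspace_tensor_alg] T.subspace_scale[OF subspace_tensor_alg] lmul)
qed (auto simp: Y_add_left Y_scaleT_left intro!: T.subspace_add[OF subspace_tensor_alg] T.subspace_scale[OF subspace_tensor_alg])

section \<open>Creation property, the operator D and the commutator with positive modes\<close>

lemma cp_0 [simp]: "cp m 0 = 1" by (simp add: cp_def)

text \<open>With d^(m) the divided derivative, applied to x^(m+j+1): here d/dx commutes with d^(m),
  while \<open>cp_Suc_left\<close> says that the derivative of d^(m) is m + 1 times d^(m+1).\<close>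

lemma cp_Suc: "of_nat (Suc m + j) * cp m j = of_nat (Suc j) * cp m (Suc j)"
  unfolding cp_def of_nat_mult[symmetric] of_nat_eq_iff
  using Suc_times_binomial_eq[of "m + j" j] by simp

lemma cp_Suc_left: "of_nat (Suc m) * cp (Suc m) j = of_nat (Suc j) * cp m (Suc j)"
proof -
  have "(Suc m) * ((Suc m + j) choose j) = (Suc m + j) * ((m + j) choose j)"
  proof -
    have "(Suc m + j) choose j = Suc (m + j) choose Suc m" "(m + j) choose j = (m + j) choose m"
      using binomial_symmetric[of j "Suc m + j"] binomial_symmetric[of j "m + j"] by simp_all
    then show ?thesis using Suc_times_binomial_eq[of "m + j" m] by (simp only: mult.commute add_Suc)
  qed
  then have "of_nat (Suc m) * cp (Suc m) j = of_nat (Suc m + j) * cp m j"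
    unfolding cp_def of_nat_mult[symmetric] of_nat_eq_iff .
  then show ?thesis by (simp only: cp_Suc)
qed

lemma cm_cp: "cm m k = (- 1) ^ m * cp m k" by (simp add: cm_def cp_def)

lemma Y_creation:
  assumes "t \<in> tensor_alg"
  shows "N < 0 \<Longrightarrow> Y t vac N = 0" and "Y t vac 0 = t"
proof -
  have "(\<forall>N<0. Y t vac N = 0) \<and> Y t vac 0 = t"
    using assms
  proof (induction t rule: tensor_alg_induct)
    case (lmul a m t)
    have 1: "Y (lmul a (Suc m) t) vac N = 0" if "N < 0" for N
      by (rule esum_unique[OF Y_lmul]) (use lmul that in simp)
    have "esum (\<lambda>k. if k = 0 then lmul a (Suc m) t else 0) (lmul a (Suc m) t)"
      by (rule esum_single)
    then have "esum (\<lambda>k. cterm m a t vac 0 k + aterm m a t vac 0 k) (lmul a (Suc m) t)"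
      by (rule esum_cong) (use lmul in auto)
    then show ?case using 1 esum_unique[OF Y_lmul] by blast
  qed (simp_all add: Y_add_left Y_scaleT_left)
  then show "N < 0 \<Longrightarrow> Y t vac N = 0" and "Y t vac 0 = t" by auto
qed

definition D :: "tens \<Rightarrow> tens" where "D v = Y v vac 1"

lemma D_add: "D (s + t) = D s + D t" and D_scaleT: "D (scaleT z s) = scaleT z (D s)"
  and D_vac [simp]: "D vac = 0" and D_0 [simp]: "D 0 = 0"
  by (simp_all add: D_def Y_add_left Y_scaleT_left)

text \<open>Only k = 0 and k = 1 reach x^1, because positive modes kill the vacuum and Y(t, x)1 has
  no negative powers. So D is the derivation induced by -d/dt, sending a(-m) to m a(-m-1).\<close>

lemma D_lmul:
  assumes "t \<in> tensor_alg"
  shows "D (lmul a (Suc m) t) = lmul a (Suc m) (D t) + scaleT (of_nat (Suc m)) (lmul a (Suc (Suc m)) t)"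
proof -
  have "esum (\<lambda>k. (if k = 0 then lmul a (Suc m) (D t) else 0) + (if k = 1 then scaleT (of_nat (Suc m)) (lmul a (Suc (Suc m)) t) else 0))
     (lmul a (Suc m) (D t) + scaleT (of_nat (Suc m)) (lmul a (Suc (Suc m)) t))"
    by (intro esum_add esum_single)
  then have "esum (\<lambda>k. cterm m a t vac 1 k + aterm m a t vac 1 k)
     (lmul a (Suc m) (D t) + scaleT (of_nat (Suc m)) (lmul a (Suc (Suc m)) t))"
  proof (rule esum_cong)
    fix k show "(if k = 0 then lmul a (Suc m) (D t) else 0) + (if k = 1 then scaleT (of_nat (Suc m)) (lmul a (Suc (Suc m)) t) else 0) =
      cterm m a t vac 1 k + aterm m a t vac 1 k"
      using Y_creation(1)[OF assms, of "1 - int k"] Y_creation(2)[OF assms]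
      by (cases "k \<le> 1") (auto simp: D_def le_Suc_eq cp_def)
  qed auto
  then show ?thesis unfolding D_def[of "lmul _ _ _"] by (intro esum_unique[OF Y_lmul])
qed

lemma Y_D_left: "u \<in> tensor_alg \<Longrightarrow> Y (D u) v N = scaleT (of_int (N + 1)) (Y u v (N + 1))"
proof (induction u arbitrary: v N rule: tensor_alg_induct)
  case (lmul a m t)
  obtain s1 s2 where s: "esum (\<lambda>k. cterm (Suc m) a t v N k) s1"
    "esum (\<lambda>k. aterm (Suc m) a t v N k) s2"
    "Y (lmul a (Suc (Suc m)) t) v N = s1 + s2" by (rule Y_lmul_split)
  \<comment> \<open>Index k here is index k - 1 of the terms for \<open>Suc m\<close>; both carry
    the mode a(-m-1-k).\<close>
  have s1: "esum (\<lambda>k. scaleT (of_nat k * cp m k) (lmul a (Suc m + k) (Y t v (N + 1 - int k)))) (scaleT (of_nat (Suc m)) s1)"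
  proof (rule esum_shift_up[OF esum_scaleT[OF s(1)]])
    fix k
    show "scaleT (of_nat (Suc k) * cp m (Suc k)) (lmul a (Suc m + Suc k) (Y t v (N + 1 - int (Suc k)))) =
         scaleT (of_nat (Suc m)) (cterm (Suc m) a t v N k)"
      unfolding cp_Suc_left[symmetric] by simp
  qed simp
  have "esum (\<lambda>k. cterm m a (D t) v N k + aterm m a (D t) v N k +
      (scaleT (of_nat k * cp m k) (lmul a (Suc m + k) (Y t v (N + 1 - int k))) +
       scaleT (of_nat (Suc m)) (aterm (Suc m) a t v N k)))
     (Y (lmul a (Suc m) (D t)) v N + (scaleT (of_nat (Suc m)) s1 + scaleT (of_nat (Suc m)) s2))"
    by (intro esum_add Y_lmul s1 esum_scaleT s(2))
  moreover have "Y (D (lmul a (Suc m) t)) v N = Y (lmul a (Suc m) (D t)) v N + (scaleT (of_nat (Suc m)) s1 + scaleT (of_nat (Suc m)) s2)"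
    by (simp add: D_lmul lmul Y_add_left Y_scaleT_left s(3) T.scale_right_distrib)
  ultimately have E: "esum (\<lambda>k. cterm m a (D t) v N k + aterm m a (D t) v N k +
      (scaleT (of_nat k * cp m k) (lmul a (Suc m + k) (Y t v (N + 1 - int k))) +
       scaleT (of_nat (Suc m)) (aterm (Suc m) a t v N k)))
     (Y (D (lmul a (Suc m) t)) v N)" by simp
  have F: "esum (\<lambda>k. scaleT (of_int (N + 1)) (cterm m a t v (N + 1) k + aterm m a t v (N + 1) k))
     (scaleT (of_int (N + 1)) (Y (lmul a (Suc m) t) v (N + 1)))"
    by (intro esum_scaleT Y_lmul)
  have eq: "of_nat (Suc m) * cm (Suc m) k = - (of_nat (Suc m + k) * cm m k)" for k
    unfolding cm_cp using cp_Suc_left[of m k] cp_Suc[of m k] by simp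
  show ?case
  proof (rule esum_unique[OF E esum_cong[OF F _ refl]])
    fix k
    have idx: "N - int k + 1 = N + 1 - int k" by simp
    have a: "lmul a (Suc m + k) (Y (D t) v (N - int k)) = scaleT (of_int (N - int k + 1)) (lmul a (Suc m + k) (Y t v (N + 1 - int k)))"
      by (simp only: lmul.IH lmul_scaleT idx)
    have b: "Y (D t) (ann a k v) (N + int k + int (Suc m)) =
       scaleT (of_int (N + int k + int (Suc m) + 1)) (Y t (ann a k v) (N + 1 + int k + int (Suc m)))"
      by (simp add: lmul algebra_simps)
    have c: "Y t (ann a k v) (N + int k + int (Suc (Suc m))) = Y t (ann a k v) (N + 1 + int k + int (Suc m))"
      by (simp add: algebra_simps)
    \<comment> \<open>\<open>d\<close> and \<open>e\<close> are the product rule at one power of x: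
      N + 1 is the exponent left for Y(t, x) plus the exponent contributed by the field.\<close>
    have d: "cp m k * of_int (N - int k + 1) + of_nat k * cp m k = of_int (N + 1) * cp m k"
      by (simp add: algebra_simps)
    have e: "cm m k * of_int (N + int k + int (Suc m) + 1) + of_nat (Suc m) * cm (Suc m) k = of_int (N + 1) * cm m k"
      unfolding eq by (simp add: algebra_simps)
    show "scaleT (of_int (N + 1)) (cterm m a t v (N + 1) k + aterm m a t v (N + 1) k) =
      cterm m a (D t) v N k + aterm m a (D t) v N k +
      (scaleT (of_nat k * cp m k) (lmul a (Suc m + k) (Y t v (N + 1 - int k))) +
       scaleT (of_nat (Suc m)) (aterm (Suc m) a t v N k))"
      unfolding a b c T.scale_scale T.scale_right_distrib d[symmetric] e[symmetric] T.scale_left_distrib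
      by (simp only: ac_simps)
  qed
next
  case vac
  show ?case by (cases "N + 1 = 0") (simp_all del: of_int_add)
qed (auto simp: Y_add_left Y_scaleT_left D_add D_scaleT T.scale_right_distrib mult.commute)

text \<open>In the induction a(n) passes both halves of the recursion by \<open>ann_lmul\<close> and
  \<open>ann_commute\<close>; the only new contribution is the contraction with the letter split
  off. In generating form this is the commutator formula [a(n), Y(u, x)] = sum over j of C(n, j)
  x^(n-j) Y(a(j)u, x).\<close>

lemma ann_Y:
  "u \<in> tensor_alg \<Longrightarrow> v \<in> tensor_alg \<Longrightarrow>
   ann a n (Y u v N) = Y u (ann a n v) N + (\<Sum>j\<le>n. scaleT (of_nat (n choose j)) (Y (ann a j u) v (N - int (n - j))))"
proof (induction u arbitrary: v N rule: tensor_alg_induct)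
  case (lmul b m t)
  \<comment> \<open>The contractions of a(j) with the new letter b(-m-1), present for j = m + 1
    only. On the other side a(n) meets b(-m-1-k) for the single k with n = m + 1 + k, and C(n,
    m+1)(m+1) = n C(m+k, k) matches the factors.\<close>
  define S where "S = (\<Sum>j\<le>n. scaleT (of_nat (n choose j)) (if j = Suc m then scaleT (of_nat j * G a b * l) (Y t v (N - int (n - j))) else 0))"
  have S: "esum (\<lambda>k. if n = Suc m + k then scaleT (cp m k) (scaleT (of_nat n * G a b * l) (Y t v (N - int k))) else 0) S"
  proof (cases "Suc m \<le> n")
    case True
    then obtain k0 where k0: "n = Suc m + k0" using le_Suc_ex by blast
    have "esum (\<lambda>k. if k = k0 then scaleT (cp m k) (scaleT (of_nat n * G a b * l) (Y t v (N - int k))) else 0)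
       (scaleT (cp m k0) (scaleT (of_nat n * G a b * l) (Y t v (N - int k0))))" by (rule esum_single)
    moreover have "S = scaleT (cp m k0) (scaleT (of_nat n * G a b * l) (Y t v (N - int k0)))"
    proof -
      have "S = scaleT (of_nat (n choose Suc m)) (scaleT (of_nat (Suc m) * G a b * l) (Y t v (N - int k0)))"
        unfolding S_def using True by (simp add: if_distrib[where f="scaleT _"] k0 cong: if_cong)
      moreover have "(n choose Suc m) * Suc m = n * ((m + k0) choose k0)"
        using Suc_times_binomial_eq[of "m + k0" m] by (simp add: k0 binomial_symmetric[of k0 "m + k0"] mult.commute)
      then have "of_nat (n choose Suc m) * of_nat (Suc m) = cp m k0 * of_nat n"
        unfolding cp_def of_nat_mult[symmetric] of_nat_eq_iff by (simp add: mult.commute)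
      ultimately show ?thesis by (simp add: mult.assoc[symmetric])
    qed
    ultimately show ?thesis by (elim esum_cong) (auto simp: k0)
  next
    case False
    then have "S = 0" unfolding S_def by (intro sum.neutral) auto
    with False show ?thesis by (auto simp: esum_def)
  qed
  have L: "esum (\<lambda>k. ann a n (cterm m b t v N k + aterm m b t v N k)) (ann a n (Y (lmul b (Suc m) t) v N))"
    by (rule esum_map[OF Y_lmul ann_add])
  let ?N = "\<lambda>j. N - int (n - j)"
  have R: "esum (\<lambda>k. cterm m b t (ann a n v) N k + aterm m b t (ann a n v) N k +
      ((\<Sum>j\<le>n. scaleT (of_nat (n choose j)) (cterm m b (ann a j t) v (?N j) k + aterm m b (ann a j t) v (?N j) k)) +
      (if n = Suc m + k then scaleT (cp m k) (scaleT (of_nat n * G a b * l) (Y t v (N - int k))) else 0)))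
     (Y (lmul b (Suc m) t) (ann a n v) N + ((\<Sum>j\<le>n. scaleT (of_nat (n choose j)) (Y (lmul b (Suc m) (ann a j t)) v (?N j))) + S))"
    by (intro esum_add Y_lmul esum_sum esum_scaleT S) auto
  have "ann a n (Y (lmul b (Suc m) t) v N) = Y (lmul b (Suc m) t) (ann a n v) N +
     ((\<Sum>j\<le>n. scaleT (of_nat (n choose j)) (Y (lmul b (Suc m) (ann a j t)) v (?N j))) + S)"
  proof (rule esum_unique[OF L esum_cong[OF R _ refl]])
    fix k
    have ac: "N - int k - int (n - j) = ?N j - int k" "N + int k + int (Suc m) - int (n - j) = ?N j + int k + int (Suc m)" for j
      by simp_all
    have "ann a n (cterm m b t v N k + aterm m b t v N k) =
      scaleT (cp m k) (lmul b (Suc m + k) (ann a n (Y t v (N - int k))) + (if n = Suc m + k then scaleT (of_nat n * G a b * l) (Y t v (N - int k)) else 0)) +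
      scaleT (cm m k) (ann a n (Y t (ann b k v) (N + int k + int (Suc m))))"
      by (simp add: ann_add ann_scaleT ann_lmul)
    also have "ann a n (Y t v (N - int k)) = Y t (ann a n v) (N - int k) + (\<Sum>j\<le>n. scaleT (of_nat (n choose j)) (Y (ann a j t) v (?N j - int k)))"
      by (simp only: lmul.IH[OF lmul.prems] ac)
    also have "ann a n (Y t (ann b k v) (N + int k + int (Suc m))) = Y t (ann b k (ann a n v)) (N + int k + int (Suc m)) +
      (\<Sum>j\<le>n. scaleT (of_nat (n choose j)) (Y (ann a j t) (ann b k v) (?N j + int k + int (Suc m))))"
      by (simp only: lmul.IH[OF ann_tensor_alg[OF lmul.prems]] ann_commute[OF lmul.prems, of a n b k] ac)
    finally show "cterm m b t (ann a n v) N k + aterm m b t (ann a n v) N k +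
      ((\<Sum>j\<le>n. scaleT (of_nat (n choose j)) (cterm m b (ann a j t) v (?N j) k + aterm m b (ann a j t) v (?N j) k)) +
      (if n = Suc m + k then scaleT (cp m k) (scaleT (of_nat n * G a b * l) (Y t v (N - int k))) else 0)) =
      ann a n (cterm m b t v N k + aterm m b t v N k)"
      by (simp add: T.scale_right_distrib lmul_add lmul_sum lmul_scaleT T.scale_sum_right sum.distrib mult.commute algebra_simps)
  qed
  also have "(\<Sum>j\<le>n. scaleT (of_nat (n choose j)) (Y (lmul b (Suc m) (ann a j t)) v (?N j))) + S =
     (\<Sum>j\<le>n. scaleT (of_nat (n choose j)) (Y (ann a j (lmul b (Suc m) t)) v (?N j)))"
    unfolding S_def sum.distrib[symmetric] T.scale_right_distrib[symmetric]
    by (intro sum.cong arg_cong[where f="scaleT _"] refl) (auto simp: ann_lmul Y_add_left Y_scaleT_left)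
  finally show ?case .
qed (simp_all add: Y_add_left Y_scaleT_left ann_add ann_scaleT T.scale_right_distrib sum.distrib T.scale_sum_right mult.commute algebra_simps)

end

section \<open>Associativity\<close>

text \<open>Multiplication of a series in \<open>x\<^sub>0, x\<^sub>2\<close> by \<open>x\<^sub>0 + x\<^sub>2\<close>.\<close>

definition X :: "(int \<Rightarrow> int \<Rightarrow> tens) \<Rightarrow> int \<Rightarrow> int \<Rightarrow> tens" where
  "X F \<alpha> \<beta> = F (\<alpha> - 1) \<beta> + F \<alpha> (\<beta> - 1)"

lemma X_pow_expand:
  "(X ^^ q) F \<alpha> \<beta> = (\<Sum>j\<le>q. scaleT (of_nat (q choose j)) (F (\<alpha> - int j) (\<beta> - int (q - j))))"
proof (induction q arbitrary: \<alpha> \<beta>)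
  case (Suc q)
  let ?h = "\<lambda>j. F (\<alpha> - int j) (\<beta> - int (Suc q - j))"
  have 1: "(X ^^ q) F (\<alpha> - 1) \<beta> = (\<Sum>j\<le>q. scaleT (of_nat (q choose j)) (?h (Suc j)))"
    unfolding Suc by (intro sum.cong refl) (simp add: algebra_simps)
  have 2: "(X ^^ q) F \<alpha> (\<beta> - 1) = (\<Sum>j\<le>q. scaleT (of_nat (q choose j)) (?h j))"
    unfolding Suc by (intro sum.cong refl arg_cong[where f="scaleT _"] arg_cong[where f="F _"]) (auto simp: Suc_diff_le)
  also have "\<dots> = (\<Sum>j\<le>Suc q. scaleT (of_nat (q choose j)) (?h j))" by simp
  also have "\<dots> = ?h 0 + (\<Sum>j\<le>q. scaleT (of_nat (q choose Suc j)) (?h (Suc j)))"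
    by (subst sum.atMost_Suc_shift) simp
  finally have 2: "(X ^^ q) F \<alpha> (\<beta> - 1) = ?h 0 + (\<Sum>j\<le>q. scaleT (of_nat (q choose Suc j)) (?h (Suc j)))" .
  have "(X ^^ Suc q) F \<alpha> \<beta> = ?h 0 + (\<Sum>j\<le>q. scaleT (of_nat (Suc q choose Suc j)) (?h (Suc j)))"
    by (simp add: X_def 1 2 T.scale_left_distrib sum.distrib algebra_simps)
  also have "\<dots> = (\<Sum>j\<le>Suc q. scaleT (of_nat (Suc q choose j)) (?h j))"
    by (subst sum.atMost_Suc_shift) simp
  finally show ?case .
qed simp

text \<open>As iterates of one operator, the multiplications by powers of x_0 + x_2 commute with
  each other and with additive maps of the coefficients. The index is reversed because
  \<open>binomial_mult\<close> counts powers of x_2.\<close>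

lemma binomial_mult_X: "binomial_mult scaleT q F = (X ^^ q) F"
proof (intro ext)
  fix \<alpha> \<beta>
  show "binomial_mult scaleT q F \<alpha> \<beta> = (X ^^ q) F \<alpha> \<beta>"
    unfolding binomial_mult_def X_pow_expand
    by (rule sum.reindex_bij_witness[of _ "\<lambda>j. q - j" "\<lambda>j. q - j"]) (auto simp: binomial_symmetric[symmetric])
qed

lemma X_pow_add: "(X ^^ q) (\<lambda>\<alpha> \<beta>. F \<alpha> \<beta> + H \<alpha> \<beta>) = (\<lambda>\<alpha> \<beta>. (X ^^ q) F \<alpha> \<beta> + (X ^^ q) H \<alpha> \<beta>)"
  by (induction q) (auto simp: X_def fun_eq_iff)

lemma X_pow_map:
  assumes "\<And>x y. L (x + y) = L x + L y"
  shows "(X ^^ q) (\<lambda>\<alpha> \<beta>. L (F \<alpha> \<beta>)) = (\<lambda>\<alpha> \<beta>. L ((X ^^ q) F \<alpha> \<beta>))"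
  by (induction q) (auto simp: X_def fun_eq_iff assms)

lemma X_pow_scaleT: "(X ^^ q) (\<lambda>\<alpha> \<beta>. scaleT z (F \<alpha> \<beta>)) = (\<lambda>\<alpha> \<beta>. scaleT z ((X ^^ q) F \<alpha> \<beta>))"
  by (rule X_pow_map) (rule T.scale_right_distrib)

lemma X_pow_lmul: "(X ^^ q) (\<lambda>\<alpha> \<beta>. lmul a m (F \<alpha> \<beta>)) = (\<lambda>\<alpha> \<beta>. lmul a m ((X ^^ q) F \<alpha> \<beta>))"
  by (rule X_pow_map) (rule lmul_add)

lemma X_pow_shift: "(X ^^ q) (\<lambda>\<alpha> \<beta>. F (\<alpha> + c) \<beta>) = (\<lambda>\<alpha> \<beta>. (X ^^ q) F (\<alpha> + c) \<beta>)"
  by (induction q) (auto simp: X_def fun_eq_iff algebra_simps)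

lemma X_pow_eq_mono: "(X ^^ q) F = (X ^^ q) H \<Longrightarrow> q \<le> r \<Longrightarrow> (X ^^ r) F = (X ^^ r) H"
  using funpow_add[of "r - q" q X] by simp

lemma X_pow_commute: "(X ^^ q) ((X ^^ r) F) = (X ^^ r) ((X ^^ q) F)"
proof -
  have "(X ^^ (q + r)) F = (X ^^ (r + q)) F" by (simp add: add.commute)
  then show ?thesis by (simp only: funpow_add comp_apply)
qed

lemma X_pow_zero [simp]: "(X ^^ q) (\<lambda>_ _. 0) = (\<lambda>_ _. 0)"
  by (induction q) (auto simp: X_def fun_eq_iff)

lemma esum_X_pow:
  assumes "\<And>\<alpha> \<beta>. esum (\<lambda>k. f k \<alpha> \<beta>) (F \<alpha> \<beta>)"
  shows "esum (\<lambda>k. (X ^^ q) (f k) \<alpha> \<beta>) ((X ^^ q) F \<alpha> \<beta>)"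
  by (induction q arbitrary: \<alpha> \<beta>) (auto simp: X_def intro!: esum_add assms)

text \<open>Substitution of \<open>x\<^sub>0 + x\<^sub>2\<close> for the first variable, expanded in nonnegative powers of
  \<open>x\<^sub>2\<close>.\<close>

definition subst_term :: "(int \<Rightarrow> int \<Rightarrow> tens) \<Rightarrow> int \<Rightarrow> int \<Rightarrow> nat \<Rightarrow> tens" where
  "subst_term S \<alpha> \<beta> j = scaleT (of_int (\<alpha> + int j) gchoose j) (S (\<alpha> + int j) (\<beta> - int j))"

definition subst :: "(int \<Rightarrow> int \<Rightarrow> tens) \<Rightarrow> int \<Rightarrow> int \<Rightarrow> tens" where
  "subst S \<alpha> \<beta> = (THE s. esum (subst_term S \<alpha> \<beta>) s)"

definition trunc2 :: "(int \<Rightarrow> int \<Rightarrow> tens) \<Rightarrow> bool" where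
  "trunc2 S \<longleftrightarrow> (\<exists>n::nat. \<forall>b < - int n. \<forall>c. S c b = 0)"

lemma trunc2_shift: "trunc2 S \<Longrightarrow> trunc2 (\<lambda>c b. S (h c) b)"
  unfolding trunc2_def by blast

lemma subst_eq: "esum (subst_term S \<alpha> \<beta>) s \<Longrightarrow> subst S \<alpha> \<beta> = s"
  unfolding subst_def by (rule the_equality) (auto dest: esum_unique)

lemma esum_subst:
  assumes "trunc2 S" shows "esum (subst_term S \<alpha> \<beta>) (subst S \<alpha> \<beta>)"
proof -
  obtain n :: nat where n: "S c b = 0" if "b < - int n" for b c using assms by (auto simp: trunc2_def)
  have "esum (subst_term S \<alpha> \<beta>) (\<Sum>j<nat (\<beta> + int n + 1). subst_term S \<alpha> \<beta> j)"
    by (rule esum_finite) (auto simp: subst_term_def intro!: arg_cong[where f="scaleT _", of _ 0, simplified] n)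
  then show ?thesis using subst_eq by metis
qed

text \<open>Pascal's rule with an integer upper entry of either sign: a factor of the first variable
  turns into the factor x_0 + x_2.\<close>

lemma subst_shift1:
  assumes "trunc2 S" shows "subst (\<lambda>c b. S (c - 1) b) = X (subst S)"
proof (intro ext subst_eq)
  fix \<alpha> \<beta>
  let ?g = "\<lambda>k. scaleT (of_int (\<alpha> - 1 + int k) gchoose (k - 1)) (S (\<alpha> - 1 + int k) (\<beta> - int k))"
  have 1: "esum (\<lambda>k. if k = 0 then 0 else ?g k) (subst S \<alpha> (\<beta> - 1))"
    by (rule esum_shift_up[OF esum_subst[OF assms]]) (auto simp: subst_term_def algebra_simps)
  have "esum (\<lambda>k. subst_term S (\<alpha> - 1) \<beta> k + (if k = 0 then 0 else ?g k)) (X (subst S) \<alpha> \<beta>)"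
    unfolding X_def by (intro esum_add esum_subst assms 1)
  then show "esum (subst_term (\<lambda>c b. S (c - 1) b) \<alpha> \<beta>) (X (subst S) \<alpha> \<beta>)"
  proof (rule esum_cong)
    fix k show "subst_term S (\<alpha> - 1) \<beta> k + (if k = 0 then 0 else ?g k) = subst_term (\<lambda>c b. S (c - 1) b) \<alpha> \<beta> k"
    proof (cases k)
      case (Suc j)
      have "(of_int (\<alpha> + int k) :: complex) = of_int (\<alpha> - 1 + int k) + 1" by simp
      then have "(of_int (\<alpha> + int k) gchoose k :: complex) = (of_int (\<alpha> - 1 + int k) gchoose j) + (of_int (\<alpha> - 1 + int k) gchoose k)"
        unfolding Suc by (simp only: gbinomial_Suc_Suc)
      moreover have "\<alpha> + int k - 1 = \<alpha> - 1 + int k" by simp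
      ultimately show ?thesis
        unfolding subst_term_def by (simp only: T.scale_left_distrib) (simp add: Suc)
    qed (simp add: subst_term_def)
  qed auto
qed

text \<open>The inner series is S divided by the n-th power of the first variable; a power of x_0 +
  x_2 clears this denominator after its expansion in x_2.\<close>

lemma subst_shift:
  assumes "trunc2 S" shows "(X ^^ n) (subst (\<lambda>c b. S (c + int n) b)) = subst S"
proof (induction n)
  case (Suc n)
  have "X (subst (\<lambda>c b. S (c + int (Suc n)) b)) = subst (\<lambda>c b. S (c + int n) b)"
    using subst_shift1[OF trunc2_shift[OF assms, of "\<lambda>c. c + int (Suc n)"]] by (simp add: algebra_simps)
  then show ?case using Suc by (simp add: funpow_swap1)
qed simp

text \<open>Multiplication by \<open>(x\<^sub>2 + x\<^sub>0)\<^sup>-\<^sup>M\<close>, expanded in nonnegative powers of \<open>x\<^sub>0\<close>.\<close>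

definition expand_term :: "nat \<Rightarrow> (int \<Rightarrow> int \<Rightarrow> tens) \<Rightarrow> int \<Rightarrow> int \<Rightarrow> nat \<Rightarrow> tens" where
  "expand_term M F \<alpha> \<beta> i = scaleT ((- of_nat M) gchoose i) (F (\<alpha> - int i) (\<beta> + int M + int i))"

definition expand :: "nat \<Rightarrow> (int \<Rightarrow> int \<Rightarrow> tens) \<Rightarrow> int \<Rightarrow> int \<Rightarrow> tens" where
  "expand M F \<alpha> \<beta> = (THE s. esum (expand_term M F \<alpha> \<beta>) s)"

definition trunc1 :: "(int \<Rightarrow> int \<Rightarrow> tens) \<Rightarrow> bool" where
  "trunc1 F \<longleftrightarrow> (\<exists>n::nat. \<forall>a < - int n. \<forall>b. F a b = 0)"

lemma expand_eq: "esum (expand_term M F \<alpha> \<beta>) s \<Longrightarrow> expand M F \<alpha> \<beta> = s"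
  unfolding expand_def by (rule the_equality) (auto dest: esum_unique)

lemma esum_expand:
  assumes "trunc1 F" shows "esum (expand_term M F \<alpha> \<beta>) (expand M F \<alpha> \<beta>)"
proof -
  obtain n :: nat where n: "F a b = 0" if "a < - int n" for a b using assms by (auto simp: trunc1_def)
  have "esum (expand_term M F \<alpha> \<beta>) (\<Sum>j<nat (\<alpha> + int n + 1). expand_term M F \<alpha> \<beta> j)"
    by (rule esum_finite) (auto simp: expand_term_def intro!: arg_cong[where f="scaleT _", of _ 0, simplified] n)
  then show ?thesis using expand_eq by metis
qed

lemma X_expand:
  assumes "trunc1 F" shows "X (expand (Suc M) F) = expand M F"
proof (intro ext expand_eq[symmetric])
  fix \<alpha> \<beta>
  let ?g = "\<lambda>k. scaleT ((- of_nat (Suc M)) gchoose (k - 1)) (F (\<alpha> - int k) (\<beta> + int M + int k))"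
  have 1: "esum (\<lambda>k. if k = 0 then 0 else ?g k) (expand (Suc M) F (\<alpha> - 1) \<beta>)"
    by (rule esum_shift_up[OF esum_expand[OF assms]]) (auto simp: expand_term_def algebra_simps)
  have "esum (\<lambda>k. (if k = 0 then 0 else ?g k) + expand_term (Suc M) F \<alpha> (\<beta> - 1) k) (X (expand (Suc M) F) \<alpha> \<beta>)"
    unfolding X_def by (intro esum_add esum_expand assms 1)
  then show "esum (expand_term M F \<alpha> \<beta>) (X (expand (Suc M) F) \<alpha> \<beta>)"
  proof (rule esum_cong)
    fix k show "(if k = 0 then 0 else ?g k) + expand_term (Suc M) F \<alpha> (\<beta> - 1) k = expand_term M F \<alpha> \<beta> k"
    proof (cases k)
      case (Suc j)
      have "(- of_nat M :: complex) = - of_nat (Suc M) + 1" by simp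
      then have "((- of_nat M) gchoose k :: complex) = ((- of_nat (Suc M)) gchoose j) + ((- of_nat (Suc M)) gchoose k)"
        unfolding Suc by (simp only: gbinomial_Suc_Suc)
      moreover have "\<beta> - 1 + int (Suc M) + int k = \<beta> + int M + int k" by simp
      ultimately show ?thesis
        unfolding expand_term_def by (simp only: T.scale_left_distrib) (simp add: Suc)
    qed (simp add: expand_term_def)
  qed auto
qed

text \<open>Counterpart of \<open>subst_shift\<close> for the expansion in x_0. Both expansions of a
  negative power are undone by the same multiplication, which is why a power of x_0 + x_2 makes them
  agree.\<close>

lemma X_pow_expand_inverse:
  assumes "trunc1 F" shows "(X ^^ M) (expand M F) = F"
proof (induction M)
  case 0
  have "esum (\<lambda>k. if k = 0 then F \<alpha> \<beta> else 0) (F \<alpha> \<beta>)" for \<alpha> \<beta> by (rule esum_single)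
  then have "esum (expand_term 0 F \<alpha> \<beta>) (F \<alpha> \<beta>)" for \<alpha> \<beta>
    by (rule esum_cong) (auto simp: expand_term_def gbinomial_0_left)
  then show ?case by (auto simp: fun_eq_iff intro: expand_eq)
next
  case (Suc M)
  then show ?case by (simp add: funpow_swap1 X_expand[OF assms])
qed

text \<open>Compare the coefficients of y^e in (1-y)^(-A-1) (1-y)^(-z-1) = (1-y)^(-A-z-2). Negating
  the upper entries turns this into Vandermonde's identity.\<close>

lemma gchoose_sum:
  "(\<Sum>d\<le>e. of_nat ((A + d) choose d) * (of_int (z + int (e - d)) gchoose (e - d))) =
    (of_int (z + int A + 1 + int e) gchoose e :: complex)"
proof -
  have 1: "(of_int (z + int k) gchoose k :: complex) = (- 1) ^ k * (of_int (- z - 1) gchoose k)" for k z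
    using gbinomial_negated_upper[of "of_int (z + int k) :: complex" k] by (simp add: algebra_simps)
  have 2: "(of_nat ((A + d) choose d) :: complex) = (- 1) ^ d * (of_int (- int A - 1) gchoose d)" for d
    using 1[of "int A" d] binomial_gbinomial[of "A + d" d, where 'a=complex] by simp
  have "(\<Sum>d\<le>e. of_nat ((A + d) choose d) * (of_int (z + int (e - d)) gchoose (e - d))) =
     (\<Sum>d\<le>e. (- 1) ^ e * ((of_int (- int A - 1) gchoose d) * (of_int (- z - 1) gchoose (e - d)) :: complex))"
  proof (rule sum.cong[OF refl])
    fix d assume "d \<in> {..e}"
    then have "(- 1) ^ e = (- 1) ^ d * ((- 1) ^ (e - d) :: complex)" by (simp flip: power_add)
    then show "of_nat ((A + d) choose d) * (of_int (z + int (e - d)) gchoose (e - d)) =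
       (- 1) ^ e * ((of_int (- int A - 1) gchoose d) * (of_int (- z - 1) gchoose (e - d)) :: complex)"
      unfolding 1[of z "e - d"] 2 by simp
  qed
  also have "\<dots> = (- 1) ^ e * ((of_int (- int A - 1) + of_int (- z - 1)) gchoose e)"
    by (simp only: sum_distrib_left[symmetric] gbinomial_Vandermonde atMost_atLeast0)
  also have "of_int (- int A - 1) + of_int (- z - 1) = (of_int (- (z + int A + 1) - 1) :: complex)" by simp
  also have "(- 1) ^ e * (\<dots> gchoose e) = (of_int (z + int A + 1 + int e) gchoose e)"
    by (rule 1[symmetric])
  finally show ?thesis .
qed

text \<open>Both products are the trinomial coefficient (m+i+d)!/(m! i! d!).\<close>

lemma choose_choose: "((m + (i + d)) choose (i + d)) * ((i + d) choose i) = ((m + i) choose i) * ((m + i + d) choose d)"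
proof -
  have "((m + i + d) choose (i + d)) * ((i + d) choose i) = ((m + i + d) choose i) * ((m + i + d - i) choose (i + d - i))"
    by (rule choose_mult) auto
  moreover have "((m + i + d) choose (m + i)) * ((m + i) choose i) = ((m + i + d) choose i) * ((m + i + d - i) choose (m + i - i))"
    by (rule choose_mult) auto
  moreover have "(m + i + d) choose (m + i) = (m + i + d) choose d" "(m + i + d - i) choose (m + i - i) = (m + d) choose d"
    using binomial_symmetric[of d "m + i + d"] binomial_symmetric[of d "m + d"] by simp_all
  ultimately show ?thesis by (simp add: add.assoc mult.commute add.commute add.left_commute)
qed

lemma finite_uniform_bound:
  assumes "\<And>i::nat. i < n \<Longrightarrow> \<exists>B::nat. \<forall>b< - int B. P i b"
  shows "\<exists>B::nat. \<forall>i<n. \<forall>b< - int B. P i b"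
  using assms
proof (induction n)
  case (Suc n)
  then obtain B where B: "\<And>i b. i < n \<Longrightarrow> b < - int B \<Longrightarrow> P i b"
    by (metis less_SucI)
  obtain C where C: "\<And>b. b < - int C \<Longrightarrow> P n b" using Suc.prems[of n] by auto
  have "P i b" if "i < Suc n" "b < - int (max B C)" for i b
    using B[of i b] C[of b] that by (cases "i = n") auto
  then show ?case by blast
qed auto

context metric_modes
begin

abbreviation P :: "tens \<Rightarrow> tens \<Rightarrow> tens \<Rightarrow> int \<Rightarrow> int \<Rightarrow> tens" where
  "P \<equiv> product_series scaleT Y"

abbreviation I :: "tens \<Rightarrow> tens \<Rightarrow> tens \<Rightarrow> int \<Rightarrow> int \<Rightarrow> tens" where
  "I \<equiv> iterate_series Y"

lemma trunc2_Y: "trunc2 (\<lambda>c b. Y u1 (Y u2 v b) c)"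
proof -
  obtain B :: nat where "Y u2 v b = 0" if "b < - int B" for b using Y_vanish by blast
  then show ?thesis unfolding trunc2_def by (intro exI[of _ B]) simp
qed

lemma P_subst: "P u1 u2 v = subst (\<lambda>c b. Y u1 (Y u2 v b) c)"
proof (intro ext subst_eq[symmetric])
  fix \<alpha> \<beta>
  obtain n :: nat where n: "Y u2 v b = 0" if "b < - int n" for b using Y_vanish by blast
  let ?m = "nat (\<beta> + int n + 1)"
  let ?S = "\<lambda>c b. Y u1 (Y u2 v b) c"
  have "esum (subst_term ?S \<alpha> \<beta>) (\<Sum>j<?m. subst_term ?S \<alpha> \<beta> j)"
    by (rule esum_finite) (auto simp: subst_term_def n)
  also have "(\<Sum>j<?m. subst_term ?S \<alpha> \<beta> j) = P u1 u2 v \<alpha> \<beta>"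
    unfolding product_series_def subst_term_def
  proof (rule sum.mono_neutral_right)
    show "{j. Y u2 v (\<beta> - int j) \<noteq> 0} \<subseteq> {..<?m}"
    proof
      fix j assume "j \<in> {j. Y u2 v (\<beta> - int j) \<noteq> 0}"
      then have "\<not> \<beta> - int j < - int n" using n by blast
      then show "j \<in> {..<?m}" unfolding lessThan_iff by linarith
    qed
  qed auto
  finally show "esum (subst_term ?S \<alpha> \<beta>) (P u1 u2 v \<alpha> \<beta>)" .
qed

lemma trunc1_I: "trunc1 (I u1 u2 v)"
proof -
  obtain B :: nat where "Y u1 u2 a = 0" if "a < - int B" for a using Y_vanish by blast
  then show ?thesis unfolding trunc1_def iterate_series_def by (intro exI[of _ B]) simp
qed

text \<open>The commutator of \<open>a\<^sup>+(x\<^sub>0 + x\<^sub>2)\<close> with \<open>Y(u\<^sub>2, x\<^sub>2)\<close> is \<open>Y(a\<^sup>+(x\<^sub>0)u\<^sub>2, x\<^sub>2)\<close>.\<close>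

lemma esum_commutator_single:
  assumes J: "\<And>b c. b < \<beta> - int J + 1 \<Longrightarrow> S c b = 0"
  shows "esum (\<lambda>d. \<Sum>j<J. scaleT (of_int (\<alpha> + int j) gchoose j) (scaleT (cm m (i + d) * of_nat ((i + d) choose i))
      (S (\<alpha> + int j + int (i + d) + int (Suc m)) (\<beta> - int j - int d))))
    (scaleT (cm m i) (subst S (\<alpha> + int i + int (Suc m)) \<beta>))"
proof -
  define f where "f d j = scaleT (of_int (\<alpha> + int j) gchoose j) (scaleT (cm m (i + d) * of_nat ((i + d) choose i))
      (S (\<alpha> + int j + int (i + d) + int (Suc m)) (\<beta> - int j - int d)))" for d j
  have f0: "f d j = 0" if "d \<ge> J \<or> j \<ge> J" for d j
    unfolding f_def using that by (subst J) auto
  have E: "esum (f d) (\<Sum>j<J. f d j)" for d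
    by (rule esum_finite) (simp add: f0)
  have 1: "esum (\<lambda>K. \<Sum>d\<le>K. f d (K - d)) (\<Sum>d<J. \<Sum>j<J. f d j)"
    by (rule esum_antidiagonal[OF f0 E])
  have 2: "esum (\<lambda>d. \<Sum>j<J. f d j) (\<Sum>d<J. \<Sum>j<J. f d j)"
    by (rule esum_finite) (simp add: f0)
  \<comment> \<open>Here d is the power of x_2 in the commutator and K - d the power from the
    substitution. Along an antidiagonal S is evaluated at the same place for all d, so only the
    scalars add up, by \<open>gchoose_sum\<close>.\<close>
  have coeff: "(\<Sum>d\<le>K. (of_int (\<alpha> + int (K - d)) gchoose (K - d)) * (cm m (i + d) * of_nat ((i + d) choose i))) =
     cm m i * (of_int (\<alpha> + int i + int (Suc m) + int K) gchoose K)" for K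
  proof -
    have c: "cm m (i + d) * of_nat ((i + d) choose i) = cm m i * of_nat ((m + i + d) choose d)" for d
      using arg_cong[OF choose_choose[of m i d], of "of_nat :: nat \<Rightarrow> complex"] unfolding cm_def by simp
    have "(\<Sum>d\<le>K. (of_int (\<alpha> + int (K - d)) gchoose (K - d)) * (cm m (i + d) * of_nat ((i + d) choose i))) =
      cm m i * (\<Sum>d\<le>K. of_nat ((m + i + d) choose d) * (of_int (\<alpha> + int (K - d)) gchoose (K - d)))"
      unfolding c sum_distrib_left by (intro sum.cong) (auto simp: mult_ac)
    also have "\<dots> = cm m i * (of_int (\<alpha> + int (m + i) + 1 + int K) gchoose K)"
      by (simp only: gchoose_sum)
    finally show ?thesis by (simp add: algebra_simps)
  qed
  have "esum (\<lambda>K. scaleT (cm m i) (subst_term S (\<alpha> + int i + int (Suc m)) \<beta> K)) (scaleT (cm m i) (subst S (\<alpha> + int i + int (Suc m)) \<beta>))"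
  proof (intro esum_scaleT esum_subst)
    have "S c b = 0" if "b < - int (nat (int J - \<beta>))" for b c by (rule J) (use that in linarith)
    then show "trunc2 S" unfolding trunc2_def by blast
  qed
  then have "esum (\<lambda>K. \<Sum>d\<le>K. f d (K - d)) (scaleT (cm m i) (subst S (\<alpha> + int i + int (Suc m)) \<beta>))"
  proof (rule esum_cong)
    fix K
    have "(\<Sum>d\<le>K. f d (K - d)) = (\<Sum>d\<le>K. scaleT ((of_int (\<alpha> + int (K - d)) gchoose (K - d)) * (cm m (i + d) * of_nat ((i + d) choose i)))
       (S (\<alpha> + int i + int (Suc m) + int K) (\<beta> - int K)))"
    proof (rule sum.cong[OF refl])
      fix d assume "d \<in> {..K}"
      then have "\<alpha> + int (K - d) + int (i + d) + int (Suc m) = \<alpha> + int i + int (Suc m) + int K" "\<beta> - int (K - d) - int d = \<beta> - int K"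
        by auto
      then show "f d (K - d) = scaleT ((of_int (\<alpha> + int (K - d)) gchoose (K - d)) * (cm m (i + d) * of_nat ((i + d) choose i)))
       (S (\<alpha> + int i + int (Suc m) + int K) (\<beta> - int K))" unfolding f_def by (simp only: T.scale_scale)
    qed
    also have "\<dots> = scaleT (cm m i) (subst_term S (\<alpha> + int i + int (Suc m)) \<beta> K)"
      by (simp only: T.scale_sum_left[symmetric] coeff subst_term_def T.scale_scale)
    finally show "scaleT (cm m i) (subst_term S (\<alpha> + int i + int (Suc m)) \<beta> K) = (\<Sum>d\<le>K. f d (K - d))" by simp
  qed auto
  from 2[unfolded esum_unique[OF 1 this]] show ?thesis unfolding f_def .
qed

text \<open>The recursion for Y(a(-m-1)t, x_0+x_2) gives a^-(x_0+x_2), with its powers of x_0+x_2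
  written as \<open>X ^^ k\<close>, and a^+(x_0+x_2) in front of Y(u_2, x_2)v. Moving the latter
  past Y(u_2, x_2) by \<open>ann_Y\<close> yields a^+ on v, still expanded in x_2, and a commutator
  in which a^+(x_0) acts on u_2.\<close>

lemma P_lmul:
  assumes tens: "t \<in> tensor_alg" "u2 \<in> tensor_alg" "v \<in> tensor_alg"
  shows "esum (\<lambda>k. scaleT (cp m k) (lmul a (Suc m + k) ((X ^^ k) (P t u2 v) \<alpha> \<beta>)) +
     scaleT (cm m k) (subst (\<lambda>c b. Y t (Y u2 (ann a k v) b) (c + int (k + Suc m))) \<alpha> \<beta>) +
     scaleT (cm m k) (P t (ann a k u2) v (\<alpha> + int (k + Suc m)) \<beta>)) (P (lmul a (Suc m) t) u2 v \<alpha> \<beta>)"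
proof -
  obtain n where n: "ann a k v = 0" "ann a k u2 = 0" if "k \<ge> n" for k
    using ann_vanish[of a v] ann_vanish[of a u2] by (metis nat_le_linear order.trans)
  have "\<exists>B::nat. \<forall>k<n. \<forall>b< - int B. Y u2 (ann a k v) b = 0 \<and> Y (ann a k u2) v b = 0"
  proof (rule finite_uniform_bound)
    fix i
    obtain B C :: nat where "\<forall>N< - int B. Y u2 (ann a i v) N = 0" "\<forall>N< - int C. Y (ann a i u2) v N = 0"
      using Y_vanish by meson
    then show "\<exists>B::nat. \<forall>b< - int B. Y u2 (ann a i v) b = 0 \<and> Y (ann a i u2) v b = 0"
      by (intro exI[of _ "max B C"]) auto
  qed
  then obtain B1 :: nat where B1: "Y u2 (ann a k v) b = 0" "Y (ann a k u2) v b = 0" if "k < n" "b < - int B1" for k b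
    by blast
  obtain B2 :: nat where B2: "Y u2 v b = 0" if "b < - int B2" for b using Y_vanish by blast
  \<comment> \<open>From j = J on every series involved vanishes, for all k at once, so each
    substitution becomes a sum over the same finite range.\<close>
  define J where "J = nat (\<beta> + int B1 + int B2 + 2)"
  have z: "b < - int B1" "b < - int B2" if "b < \<beta> - int J + 1" for b
  proof -
    have "int J \<ge> \<beta> + int B1 + int B2 + 2" by (simp add: J_def)
    then show "b < - int B1" "b < - int B2" using that by linarith+
  qed
  have z1: "Y u2 v b = 0" "Y u2 (ann a k v) b = 0" "Y (ann a k u2) v b = 0" if "b < \<beta> - int J + 1" for b k
    using z[OF that] B1[of k b] B2[of b] n[of k] by (cases "k < n"; simp)+
  have sub: "subst S \<alpha>' \<beta> = (\<Sum>j<J. subst_term S \<alpha>' \<beta> j)" if "\<And>c b. b < \<beta> - int J + 1 \<Longrightarrow> S c b = 0" for S \<alpha>'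
    by (rule subst_eq, rule esum_finite) (simp add: subst_term_def that)
  let ?c = "\<lambda>j. of_int (\<alpha> + int j) gchoose j :: complex"
  let ?y = "\<lambda>j. Y u2 v (\<beta> - int j)"
  have "P (lmul a (Suc m) t) u2 v \<alpha> \<beta> = (\<Sum>j<J. scaleT (?c j) (Y (lmul a (Suc m) t) (?y j) (\<alpha> + int j)))"
    unfolding P_subst by (subst sub) (auto simp: z1 subst_term_def)
  moreover have "esum (\<lambda>k. \<Sum>j<J. scaleT (?c j) (cterm m a t (?y j) (\<alpha> + int j) k + aterm m a t (?y j) (\<alpha> + int j) k))
    (\<Sum>j<J. scaleT (?c j) (Y (lmul a (Suc m) t) (?y j) (\<alpha> + int j)))"
    by (intro esum_sum esum_scaleT Y_lmul) auto
  ultimately have L: "esum (\<lambda>k. \<Sum>j<J. scaleT (?c j) (cterm m a t (?y j) (\<alpha> + int j) k + aterm m a t (?y j) (\<alpha> + int j) k)) (P (lmul a (Suc m) t) u2 v \<alpha> \<beta>)" by simp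
  define comm where "comm k = (\<Sum>j<J. scaleT (?c j) (scaleT (cm m k) (\<Sum>i\<le>k. scaleT (of_nat (k choose i))
      (Y t (Y (ann a i u2) v (\<beta> - int j - int (k - i))) (\<alpha> + int j + int k + int (Suc m))))))" for k
  define target where "target k = scaleT (cm m k) (P t (ann a k u2) v (\<alpha> + int (k + Suc m)) \<beta>)" for k
  have termwise: "(\<Sum>j<J. scaleT (?c j) (cterm m a t (?y j) (\<alpha> + int j) k + aterm m a t (?y j) (\<alpha> + int j) k)) =
     scaleT (cp m k) (lmul a (Suc m + k) ((X ^^ k) (P t u2 v) \<alpha> \<beta>)) +
     scaleT (cm m k) (subst (\<lambda>c b. Y t (Y u2 (ann a k v) b) (c + int (k + Suc m))) \<alpha> \<beta>) + comm k" for k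
  proof -
    have "(X ^^ k) (subst (\<lambda>c b. Y t (Y u2 v b) c)) = subst (\<lambda>c b. Y t (Y u2 v b) (c - int k))"
      using subst_shift[OF trunc2_shift[OF trunc2_Y, of t u2 v "\<lambda>c. c - int k"], of k] by simp
    then have "(X ^^ k) (P t u2 v) \<alpha> \<beta> = subst (\<lambda>c b. Y t (Y u2 v b) (c - int k)) \<alpha> \<beta>"
      by (simp add: P_subst)
    also have "\<dots> = (\<Sum>j<J. scaleT (?c j) (Y t (?y j) (\<alpha> + int j - int k)))"
      by (subst sub) (auto simp: z1 subst_term_def)
    finally have 1: "(X ^^ k) (P t u2 v) \<alpha> \<beta> = \<dots>" .
    have 2: "subst (\<lambda>c b. Y t (Y u2 (ann a k v) b) (c + int (k + Suc m))) \<alpha> \<beta> =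
       (\<Sum>j<J. scaleT (?c j) (Y t (Y u2 (ann a k v) (\<beta> - int j)) (\<alpha> + int j + int k + int (Suc m))))"
      by (subst sub) (auto simp: z1 subst_term_def add_ac)
    have 3: "Y t (ann a k (?y j)) (\<alpha> + int j + int k + int (Suc m)) =
       Y t (Y u2 (ann a k v) (\<beta> - int j)) (\<alpha> + int j + int k + int (Suc m)) +
       (\<Sum>i\<le>k. scaleT (of_nat (k choose i)) (Y t (Y (ann a i u2) v (\<beta> - int j - int (k - i))) (\<alpha> + int j + int k + int (Suc m))))" for j
      by (simp only: ann_Y[OF tens(2,3)] Y_add_right Y_sum_right Y_scaleT_right)
    show ?thesis
      unfolding 1 2 3 comm_def
      by (simp only: T.scale_right_distrib lmul_sum lmul_scaleT T.scale_sum_right T.scale_scale sum.distrib mult.commute add.assoc)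
  qed
  \<comment> \<open>\<open>comm\<close> and \<open>target\<close> need not agree term by term: they
    collect one double family f along antidiagonals and along rows, and their totals agree.\<close>
  have comm_target: "\<exists>s. esum comm s \<and> esum target s"
  proof -
    define f where "f i d = (\<Sum>j<J. scaleT (?c j) (scaleT (cm m (i + d) * of_nat ((i + d) choose i))
      (Y t (Y (ann a i u2) v (\<beta> - int j - int d)) (\<alpha> + int j + int (i + d) + int (Suc m)))))" for i d
    have fE: "esum (f i) (target i)" for i
      unfolding f_def target_def P_subst
      using esum_commutator_single[where S="\<lambda>c b. Y t (Y (ann a i u2) v b) c" and \<beta>=\<beta> and J=J and \<alpha>=\<alpha> and m=m and i=i] z1(3)
      by (simp add: add_ac)
    have f0: "f i d = 0" if "i \<ge> n + J \<or> d \<ge> n + J" for i d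
    proof (cases "i \<ge> n")
      case False
      then have "\<beta> - int j - int d < \<beta> - int J + 1" for j using that by auto
      then show ?thesis unfolding f_def by (simp add: z1)
    qed (simp add: f_def n)
    have "esum (\<lambda>K. \<Sum>i\<le>K. f i (K - i)) (\<Sum>i<n + J. target i)"
      by (rule esum_antidiagonal[OF f0 fE])
    moreover have "(\<Sum>i\<le>K. f i (K - i)) = comm K" for K
    proof -
      have "comm K = (\<Sum>j<J. \<Sum>i\<le>K. scaleT (?c j) (scaleT (cm m K * of_nat (K choose i))
         (Y t (Y (ann a i u2) v (\<beta> - int j - int (K - i))) (\<alpha> + int j + int K + int (Suc m)))))"
        unfolding comm_def by (simp only: T.scale_sum_right T.scale_scale mult.assoc)
      also have "\<dots> = (\<Sum>i\<le>K. \<Sum>j<J. scaleT (?c j) (scaleT (cm m K * of_nat (K choose i))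
         (Y t (Y (ann a i u2) v (\<beta> - int j - int (K - i))) (\<alpha> + int j + int K + int (Suc m)))))"
        by (rule sum.swap)
      also have "\<dots> = (\<Sum>i\<le>K. f i (K - i))"
        unfolding f_def by (intro sum.cong refl) auto
      finally show ?thesis ..
    qed
    ultimately have "esum comm (\<Sum>i<n + J. target i)" by simp
    moreover have "esum target (\<Sum>i<n + J. target i)"
      by (rule esum_finite) (simp add: target_def n product_series_def)
    ultimately show ?thesis by blast
  qed
  then obtain s where s: "esum comm s" "esum target s" by blast
  show ?thesis
    by (rule esum_cong[OF esum_add[OF esum_diff[OF L s(1)] s(2)]]) (simp_all only: termwise target_def add_diff_cancel_right' diff_add_cancel)
qed

text \<open>Here and in \<open>cp_cm\<close>, d^(k) after d^(m) is C(m+k, k) d^(m+k), applied to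
  x^(m+k+i) and to x^(-i-1) respectively. These are the coefficients in Taylor's formula for a(x_2 +
  x_0).\<close>

lemma cp_cp: "cp m k * cp (m + k) i = cp m (k + i) * of_nat ((k + i) choose k)"
  using choose_choose[of m k i] unfolding cp_def of_nat_mult[symmetric] of_nat_eq_iff by simp

lemma cp_cm: "cp m k * cm (m + k) i = cm m i * ((- of_nat (i + Suc m)) gchoose k)"
proof -
  have "(of_nat ((m + i + k) choose k) :: complex) = (- 1) ^ k * ((- of_nat (i + Suc m)) gchoose k)"
  proof -
    have "of_nat k - of_nat (m + i + k) - 1 = (- of_nat (i + Suc m) :: complex)" by simp
    then show ?thesis
      using gbinomial_negated_upper[of "of_nat (m + i + k) :: complex" k] by (simp only: binomial_gbinomial)
  qed
  then have 1: "(- of_nat (i + Suc m)) gchoose k = (- 1) ^ k * (of_nat ((m + i + k) choose k) :: complex)"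
    by (simp flip: power_add mult.assoc)
  have "((m + k) choose k) * ((m + k + i) choose i) = ((m + i) choose i) * ((m + i + k) choose k)"
    using choose_choose[of m k i] choose_choose[of m i k] binomial_symmetric[of k "k + i"]
    by (simp add: add.commute)
  then have 2: "cp m k * cp (m + k) i = of_nat ((m + i) choose i) * of_nat ((m + i + k) choose k)"
    unfolding cp_def of_nat_mult[symmetric] of_nat_eq_iff .
  have "cp m k * cm (m + k) i = (- 1) ^ (m + k) * (cp m k * cp (m + k) i)"
    by (simp add: cm_cp)
  then show ?thesis unfolding 1 2 by (simp add: cm_def power_add)
qed

text \<open>Expanding Y(a(-m-1)t, x_0)u_2 first gives modes a(-m-1-k) in front of Y(t, x_0)u_2, to
  which the recursion applies a second time. Summation over k is Taylor's formula, so a^+(x_2+x_0)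
  on v arrives expanded in x_0. The positive half of the first expansion is the third term.\<close>

lemma I_lmul:
  "esum (\<lambda>k. scaleT (cp m k) (lmul a (Suc m + k) ((X ^^ k) (I t u2 v) \<alpha> \<beta>)) +
     scaleT (cm m k) (expand (k + Suc m) (I t u2 (ann a k v)) \<alpha> \<beta>) +
     scaleT (cm m k) (I t (ann a k u2) v (\<alpha> + int (k + Suc m)) \<beta>)) (I (lmul a (Suc m) t) u2 v \<alpha> \<beta>)"
proof -
  obtain s1 s2 where s: "esum (\<lambda>k. cterm m a t u2 \<alpha> k) s1"
    "esum (\<lambda>k. aterm m a t u2 \<alpha> k) s2"
    "Y (lmul a (Suc m) t) u2 \<alpha> = s1 + s2" by (rule Y_lmul_split)
  have I: "I (lmul a (Suc m) t) u2 v \<alpha> \<beta> = Y s1 v \<beta> + Y s2 v \<beta>"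
    by (simp add: iterate_series_def s(3) Y_add_left)
  have E3: "esum (\<lambda>k. scaleT (cm m k) (I t (ann a k u2) v (\<alpha> + int (k + Suc m)) \<beta>)) (Y s2 v \<beta>)"
    by (rule esum_cong[OF esum_map[OF s(2), of "\<lambda>x. Y x v \<beta>"]])
      (auto simp: Y_add_left Y_scaleT_left iterate_series_def add_ac)
  obtain n0 :: nat where n0: "Y t u2 b = 0" if "b < - int n0" for b using Y_vanish by blast
  define nK where "nK = nat (\<alpha> + int n0 + 1)"
  have nK: "Y t u2 (\<alpha> - int k) = 0" if "k \<ge> nK" for k
    by (rule n0) (use that in \<open>unfold nK_def, linarith\<close>)
  have "\<exists>B::nat. \<forall>k<nK. \<forall>b < - int B. Y (Y t u2 (\<alpha> - int k)) v b = 0"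
    by (rule finite_uniform_bound) (rule Y_vanish)
  then obtain n1 :: nat where n1: "Y (Y t u2 (\<alpha> - int k)) v b = 0" if "k < nK" "b < - int n1" for k b
    by blast
  \<comment> \<open>For k \<ge> nK the inner coefficient vanishes; for the remaining finitely many k
    the outer ones vanish from a common index on.\<close>
  define n where "n = nK + nat (\<beta> + int n1 + 1)"
  have n: "Y (Y t u2 (\<alpha> - int k)) v (\<beta> - int i) = 0" if "k \<ge> n \<or> i \<ge> n" for k i
  proof (cases "k < nK")
    case True
    then have "i \<ge> n" using that by (auto simp: n_def)
    then show ?thesis by (intro n1 True) (unfold n_def, linarith)
  qed (simp add: nK)
  have "\<forall>k. \<exists>r. esum (\<lambda>i. cterm (m + k) a (Y t u2 (\<alpha> - int k)) v \<beta> i) (fst r) \<and>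
    esum (\<lambda>i. aterm (m + k) a (Y t u2 (\<alpha> - int k)) v \<beta> i) (snd r) \<and>
    Y (lmul a (Suc (m + k)) (Y t u2 (\<alpha> - int k))) v \<beta> = fst r + snd r" (is "\<forall>k. \<exists>r. ?Q k r")
  proof
    fix k
    obtain r1 r2 where "esum (\<lambda>i. cterm (m + k) a (Y t u2 (\<alpha> - int k)) v \<beta> i) r1"
      "esum (\<lambda>i. aterm (m + k) a (Y t u2 (\<alpha> - int k)) v \<beta> i) r2"
      "Y (lmul a (Suc (m + k)) (Y t u2 (\<alpha> - int k))) v \<beta> = r1 + r2" by (rule Y_lmul_split)
    then show "\<exists>r. ?Q k r" by (intro exI[of _ "(r1, r2)"]) simp
  qed
  then obtain r where r:
    "\<And>k. esum (\<lambda>i. cterm (m + k) a (Y t u2 (\<alpha> - int k)) v \<beta> i) (fst (r k))"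
    "\<And>k. esum (\<lambda>i. aterm (m + k) a (Y t u2 (\<alpha> - int k)) v \<beta> i) (snd (r k))"
    "\<And>k. Y (lmul a (Suc (m + k)) (Y t u2 (\<alpha> - int k))) v \<beta> = fst (r k) + snd (r k)"
    by (drule_tac choice) blast
  have "Y s1 v \<beta> = (\<Sum>k<n. scaleT (cp m k) (fst (r k) + snd (r k)))"
  proof (rule esum_unique)
    show "esum (\<lambda>k. scaleT (cp m k) (fst (r k) + snd (r k))) (Y s1 v \<beta>)"
      by (rule esum_cong[OF esum_map[OF s(1), of "\<lambda>x. Y x v \<beta>"]]) (auto simp: Y_add_left Y_scaleT_left r(3)[symmetric])
    show "esum (\<lambda>k. scaleT (cp m k) (fst (r k) + snd (r k))) (\<Sum>k<n. scaleT (cp m k) (fst (r k) + snd (r k)))"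
      unfolding r(3)[symmetric] by (rule esum_finite) (auto simp: nK n_def)
  qed
  then have s1: "Y s1 v \<beta> = (\<Sum>k<n. scaleT (cp m k) (fst (r k))) + (\<Sum>k<n. scaleT (cp m k) (snd (r k)))"
    by (simp add: T.scale_right_distrib sum.distrib)
  have sc: "esum (\<lambda>i. scaleT (cp m k) (cterm (m + k) a (Y t u2 (\<alpha> - int k)) v \<beta> i))
      (scaleT (cp m k) (fst (r k)))" for k
    by (rule esum_scaleT[OF r(1)])
  have E1: "esum (\<lambda>K. scaleT (cp m K) (lmul a (Suc m + K) ((X ^^ K) (I t u2 v) \<alpha> \<beta>))) (\<Sum>k<n. scaleT (cp m k) (fst (r k)))"
  proof (rule esum_cong[OF esum_antidiagonal[OF _ sc, where n=n] _ refl])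
    fix K
    have "(\<Sum>k\<le>K. scaleT (cp m k) (scaleT (cp (m + k) (K - k)) (lmul a (Suc (m + k) + (K - k)) (Y (Y t u2 (\<alpha> - int k)) v (\<beta> - int (K - k)))))) =
      (\<Sum>k\<le>K. scaleT (cp m K) (lmul a (Suc m + K) (scaleT (of_nat (K choose k)) (I t u2 v (\<alpha> - int k) (\<beta> - int (K - k))))))"
    proof (rule sum.cong[OF refl])
      fix k assume "k \<in> {..K}"
      then have "cp m k * cp (m + k) (K - k) = cp m K * of_nat (K choose k)" "Suc (m + k) + (K - k) = Suc m + K"
        using cp_cp[of m k "K - k"] by auto
      then show "scaleT (cp m k) (scaleT (cp (m + k) (K - k)) (lmul a (Suc (m + k) + (K - k)) (Y (Y t u2 (\<alpha> - int k)) v (\<beta> - int (K - k))))) =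
        scaleT (cp m K) (lmul a (Suc m + K) (scaleT (of_nat (K choose k)) (I t u2 v (\<alpha> - int k) (\<beta> - int (K - k)))))"
        by (simp only: T.scale_scale lmul_scaleT iterate_series_def)
    qed
    then show "(\<Sum>k\<le>K. scaleT (cp m k) (scaleT (cp (m + k) (K - k)) (lmul a (Suc (m + k) + (K - k)) (Y (Y t u2 (\<alpha> - int k)) v (\<beta> - int (K - k)))))) =
      scaleT (cp m K) (lmul a (Suc m + K) ((X ^^ K) (I t u2 v) \<alpha> \<beta>))"
      by (simp add: X_pow_expand lmul_sum T.scale_sum_right)
  qed (use n in auto)
  \<comment> \<open>For fixed i the sum over k is the binomial series of (x_2 + x_0)^(-i-m-1) in
    x_0, by \<open>cp_cm\<close>.\<close>
  have E2: "esum (\<lambda>i. scaleT (cm m i) (expand (i + Suc m) (I t u2 (ann a i v)) \<alpha> \<beta>)) (\<Sum>k<n. scaleT (cp m k) (snd (r k)))"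
  proof (rule esum_cong[OF esum_sum[OF _ esum_scaleT[OF r(2)]] _ refl])
    fix i
    have "esum (expand_term (i + Suc m) (I t u2 (ann a i v)) \<alpha> \<beta>) (\<Sum>k<n. expand_term (i + Suc m) (I t u2 (ann a i v)) \<alpha> \<beta> k)"
      by (rule esum_finite) (simp add: expand_term_def iterate_series_def nK n_def)
    then have ex: "expand (i + Suc m) (I t u2 (ann a i v)) \<alpha> \<beta> = (\<Sum>k<n. expand_term (i + Suc m) (I t u2 (ann a i v)) \<alpha> \<beta> k)"
      by (rule expand_eq)
    show "(\<Sum>k<n. scaleT (cp m k) (aterm (m + k) a (Y t u2 (\<alpha> - int k)) v \<beta> i)) =
      scaleT (cm m i) (expand (i + Suc m) (I t u2 (ann a i v)) \<alpha> \<beta>)"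
      unfolding ex T.scale_sum_right expand_term_def iterate_series_def T.scale_scale cp_cm
      by (intro sum.cong refl) (simp add: add_ac)
  qed auto
  show ?thesis unfolding I s1
    by (rule esum_add[OF esum_add[OF E1 E2] E3])
qed

lemma subst_zero [simp]: "subst (\<lambda>c b. 0) = (\<lambda>_ _. 0)"
  by (intro ext subst_eq) (simp add: subst_term_def esum_def)

lemma expand_zero [simp]: "expand M (\<lambda>a b. 0) = (\<lambda>_ _. 0)"
  by (intro ext expand_eq) (simp add: expand_term_def esum_def)

lemma P_vac: "P vac u2 v = I vac u2 v"
  unfolding P_subst
proof (intro ext subst_eq)
  fix \<alpha> \<beta>
  have "esum (\<lambda>k. if k = 0 then I vac u2 v \<alpha> \<beta> else 0) (I vac u2 v \<alpha> \<beta>)" by (rule esum_single)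
  then show "esum (subst_term (\<lambda>c b. Y vac (Y u2 v b) c) \<alpha> \<beta>) (I vac u2 v \<alpha> \<beta>)"
  proof (rule esum_cong)
    fix k show "(if k = 0 then I vac u2 v \<alpha> \<beta> else 0) = subst_term (\<lambda>c b. Y vac (Y u2 v b) c) \<alpha> \<beta> k"
      by (cases "\<alpha> + int k = 0") (auto simp: subst_term_def iterate_series_def gbinomial_0_left)
  qed auto
qed

lemma P_add_left: "P (s + t) u2 v = (\<lambda>\<alpha> \<beta>. P s u2 v \<alpha> \<beta> + P t u2 v \<alpha> \<beta>)"
  by (simp add: fun_eq_iff product_series_def Y_add_left T.scale_right_distrib sum.distrib)

lemma P_scaleT_left: "P (scaleT z t) u2 v = (\<lambda>\<alpha> \<beta>. scaleT z (P t u2 v \<alpha> \<beta>))"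
  by (simp add: fun_eq_iff product_series_def Y_scaleT_left T.scale_sum_right mult.commute)

text \<open>The exponent may not depend on u_2. In the recursion a(k) acts on u_2 only in a term
  with arguments t and v, for which the induction provides one exponent good for all middle vectors;
  the other exponents concern the finitely many nonzero a(k)v.\<close>

lemma associativity:
  assumes "u1 \<in> tensor_alg" "v \<in> tensor_alg"
  shows "\<exists>q. \<forall>u2\<in>tensor_alg. (X ^^ q) (P u1 u2 v) = (X ^^ q) (I u1 u2 v)"
  using assms
proof (induction u1 arbitrary: v rule: tensor_alg_induct)
  case vac
  show ?case by (simp add: P_vac)
next
  case (add s t)
  obtain q r where q: "\<And>u2. u2 \<in> tensor_alg \<Longrightarrow> (X ^^ q) (P s u2 v) = (X ^^ q) (I s u2 v)"
    and r: "\<And>u2. u2 \<in> tensor_alg \<Longrightarrow> (X ^^ r) (P t u2 v) = (X ^^ r) (I t u2 v)"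
    using add by meson
  have "I (s + t) u2 v = (\<lambda>\<alpha> \<beta>. I s u2 v \<alpha> \<beta> + I t u2 v \<alpha> \<beta>)" for u2
    by (simp add: fun_eq_iff iterate_series_def Y_add_left)
  then have "(X ^^ max q r) (P (s + t) u2 v) = (X ^^ max q r) (I (s + t) u2 v)" if "u2 \<in> tensor_alg" for u2
    using X_pow_eq_mono[OF q[OF that], of "max q r"] X_pow_eq_mono[OF r[OF that], of "max q r"]
    by (simp add: X_pow_add P_add_left)
  then show ?case by blast
next
  case (scale z t)
  obtain q where q: "\<And>u2. u2 \<in> tensor_alg \<Longrightarrow> (X ^^ q) (P t u2 v) = (X ^^ q) (I t u2 v)"
    using scale by meson
  have "I (scaleT z t) u2 v = (\<lambda>\<alpha> \<beta>. scaleT z (I t u2 v \<alpha> \<beta>))" for u2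
    by (simp add: fun_eq_iff iterate_series_def Y_scaleT_left)
  then show ?case using q by (intro exI[of _ q]) (simp add: X_pow_scaleT P_scaleT_left)
next
  case (lmul a m t)
  obtain q0 where q0: "\<And>u2. u2 \<in> tensor_alg \<Longrightarrow> (X ^^ q0) (P t u2 v) = (X ^^ q0) (I t u2 v)"
    using lmul by meson
  have "\<forall>k. \<exists>q. \<forall>u2\<in>tensor_alg. (X ^^ q) (P t u2 (ann a k v)) = (X ^^ q) (I t u2 (ann a k v))"
    using lmul by blast
  then obtain qk where qk: "\<And>k u2. u2 \<in> tensor_alg \<Longrightarrow> (X ^^ qk k) (P t u2 (ann a k v)) = (X ^^ qk k) (I t u2 (ann a k v))"
    by metis
  obtain B where B: "ann a k v = 0" if "k \<ge> B" for k using ann_vanish by blast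
  \<comment> \<open>For each k < B, k + m + 1 factors clear the pole of the two expansions and
    \<open>qk k\<close> more are spent on associativity for t and a(k)v.\<close>
  define q where "q = q0 + (\<Sum>k<B. qk k + (k + Suc m))"
  have q_ge: "q \<ge> q0" "k < B \<Longrightarrow> q \<ge> qk k + (k + Suc m)" for k
  proof -
    assume "k < B"
    then have "qk k + (k + Suc m) \<le> (\<Sum>k<B. qk k + (k + Suc m))"
      by (intro member_le_sum[of k "{..<B}" "\<lambda>k. qk k + (k + Suc m)"]) auto
    then show "q \<ge> qk k + (k + Suc m)" unfolding q_def by linarith
  qed (simp add: q_def)
  have "(X ^^ q) (P (lmul a (Suc m) t) u2 v) = (X ^^ q) (I (lmul a (Suc m) t) u2 v)" if u2: "u2 \<in> tensor_alg" for u2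
  proof (intro ext)
    fix \<alpha> \<beta>
    have 1: "(X ^^ q) (P t u v) = (X ^^ q) (I t u v)" if "u \<in> tensor_alg" for u
      by (rule X_pow_eq_mono[OF q0[OF that] q_ge(1)])
    have 2: "(X ^^ q) (subst (\<lambda>c b. Y t (Y u2 (ann a k v) b) (c + int (k + Suc m)))) = (X ^^ q) (expand (k + Suc m) (I t u2 (ann a k v)))" for k
    proof (cases "k < B")
      case True
      define d where "d = q - (k + Suc m)"
      have d: "q = d + (k + Suc m)" "qk k \<le> d" using q_ge(2)[OF True] by (auto simp: d_def)
      have "(X ^^ (k + Suc m)) (subst (\<lambda>c b. Y t (Y u2 (ann a k v) b) (c + int (k + Suc m)))) = P t u2 (ann a k v)"
        unfolding P_subst by (rule subst_shift[OF trunc2_Y])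
      moreover have "(X ^^ (k + Suc m)) (expand (k + Suc m) (I t u2 (ann a k v))) = I t u2 (ann a k v)"
        by (rule X_pow_expand_inverse[OF trunc1_I])
      ultimately show ?thesis
        unfolding d(1) funpow_add[of d] comp_apply using X_pow_eq_mono[OF qk[OF u2] d(2)] by simp
    next
      case False
      then have "ann a k v = 0" by (simp add: B)
      moreover have "I t u2 0 = (\<lambda>_ _. 0)" by (simp add: fun_eq_iff iterate_series_def)
      ultimately show ?thesis by simp
    qed
    note X_pow_simps = X_pow_add X_pow_scaleT X_pow_lmul X_pow_shift
    have "esum (\<lambda>k. (X ^^ q) (\<lambda>\<alpha> \<beta>. scaleT (cp m k) (lmul a (Suc m + k) ((X ^^ k) (P t u2 v) \<alpha> \<beta>)) +
     scaleT (cm m k) (subst (\<lambda>c b. Y t (Y u2 (ann a k v) b) (c + int (k + Suc m))) \<alpha> \<beta>) +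
     scaleT (cm m k) (P t (ann a k u2) v (\<alpha> + int (k + Suc m)) \<beta>)) \<alpha> \<beta>) ((X ^^ q) (P (lmul a (Suc m) t) u2 v) \<alpha> \<beta>)"
      by (rule esum_X_pow) (rule P_lmul[OF lmul.hyps u2 lmul.prems])
    moreover have "esum (\<lambda>k. (X ^^ q) (\<lambda>\<alpha> \<beta>. scaleT (cp m k) (lmul a (Suc m + k) ((X ^^ k) (I t u2 v) \<alpha> \<beta>)) +
     scaleT (cm m k) (expand (k + Suc m) (I t u2 (ann a k v)) \<alpha> \<beta>) +
     scaleT (cm m k) (I t (ann a k u2) v (\<alpha> + int (k + Suc m)) \<beta>)) \<alpha> \<beta>) ((X ^^ q) (I (lmul a (Suc m) t) u2 v) \<alpha> \<beta>)"
      by (rule esum_X_pow) (rule I_lmul)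
    ultimately show "(X ^^ q) (P (lmul a (Suc m) t) u2 v) \<alpha> \<beta> = (X ^^ q) (I (lmul a (Suc m) t) u2 v) \<alpha> \<beta>"
      unfolding X_pow_simps X_pow_commute[of q] 1[OF u2] 1[OF ann_tensor_alg[OF u2]] 2
      by (rule esum_unique)
  qed
  then show ?case by blast
qed

text \<open>Positive modes kill the vacuum, so the term that is expanded in two ways is absent.
  Having no power of x_0 + x_2 in front permits the comparison of single coefficients.\<close>

lemma associativity_vac:
  assumes "u1 \<in> tensor_alg" "u2 \<in> tensor_alg"
  shows "P u1 u2 vac = I u1 u2 vac"
proof -
  have "P u1 u2 vac \<alpha> \<beta> = I u1 u2 vac \<alpha> \<beta>" for \<alpha> \<beta>
    using assms
  proof (induction u1 arbitrary: u2 \<alpha> \<beta> rule: tensor_alg_induct)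
    case vac
    show ?case by (simp add: P_vac)
  next
    case (lmul a m t)
    have t: "P t u vac = I t u vac" if "u \<in> tensor_alg" for u using lmul that by (simp add: fun_eq_iff)
    have "I t u2 0 = (\<lambda>_ _. 0)" by (simp add: fun_eq_iff iterate_series_def)
    then show ?case
      using P_lmul[OF lmul.hyps lmul.prems tensor_alg_vac, of m a \<alpha> \<beta>] I_lmul[of m a t u2 vac \<alpha> \<beta>]
      by (simp add: t[OF lmul.prems] t[OF ann_tensor_alg[OF lmul.prems]] esum_unique)
  qed (simp_all add: P_add_left P_scaleT_left iterate_series_def Y_add_left Y_scaleT_left)
  then show ?thesis by (simp add: fun_eq_iff)
qed

text \<open>The coefficients of \<open>x\<^sub>2\<close> in \<open>Y(u, x\<^sub>0 + x\<^sub>2)Y(v, x\<^sub>2)\<one> = Y(Y(u, x\<^sub>0)v, x\<^sub>2)\<one>\<close>.\<close>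

lemma Y_D_right:
  assumes "u \<in> tensor_alg" "v \<in> tensor_alg"
  shows "D (Y u v N) - Y u (D v) N = scaleT (of_int (N + 1)) (Y u v (N + 1))"
proof -
  let ?S = "\<lambda>c b. Y u (Y v vac b) c"
  have "subst_term ?S N 1 j = 0" if "j \<ge> 2" for j
    using Y_creation(1)[OF assms(2), of "1 - int j"] that by (simp add: subst_term_def)
  then have "subst ?S N 1 = (\<Sum>j<2. subst_term ?S N 1 j)"
    by (intro subst_eq esum_finite)
  also have "\<dots> = Y u (D v) N + scaleT (of_int (N + 1)) (Y u v (N + 1))"
    using Y_creation(2)[OF assms(2)] by (simp add: numeral_2_eq_2 subst_term_def D_def)
  finally show ?thesis
    using associativity_vac[OF assms] by (simp add: P_subst iterate_series_def D_def fun_eq_iff)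
qed

end

section \<open>Null frames and charge\<close>

lemma hom_tmap_word: "hom (wt w) (tmap_word L w)"
  by (induction w) (auto simp: vac_def intro!: hom_single elim!: hom_lmul)

lemma hom_tmap: "hom n t \<Longrightarrow> hom n (tmap L t)"
  unfolding tmap_def by (rule hom_lin_ext) (metis hom_def hom_tmap_word)

definition part :: "int \<Rightarrow> tens \<Rightarrow> tens" where
  "part n = lin_ext (\<lambda>w. if wt w = n then Poly_Mapping.single w 1 else 0)"

lemma part_add: "part n (s + t) = part n s + part n t"
  by (simp add: part_def lin_ext_add)

lemma lookup_part: "lk (part n t) w = (if wt w = n then lk t w else 0)"
proof (induction t rule: tens_induct)
  case (3 v z)
  show ?case by (auto simp: part_def lin_ext_single lookup_scaleT lookup_single when_def)
qed (auto simp: part_add lookup_add, simp add: part_def)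

lemma hom_part: "hom n (part n t)" by (auto simp: hom_def lookup_part)

lemma part_hom: "hom k t \<Longrightarrow> part n t = (if n = k then t else 0)"
  by (rule poly_mapping_eqI) (auto simp: lookup_part hom_def)

lemma part_tmap: "part n (tmap L t) = tmap L (part n t)"
proof (induction t rule: tens_induct)
  case (3 w z)
  have "part n (tmap L (Poly_Mapping.single w z)) = (if wt w = n then tmap L (Poly_Mapping.single w z) else 0)"
    using part_hom[OF hom_tmap[OF hom_single[OF refl]]] by auto
  moreover have "part n (Poly_Mapping.single w z) = (if wt w = n then Poly_Mapping.single w z else 0)"
    using part_hom[OF hom_single[OF refl]] by auto
  ultimately show ?case by simp
qed (auto simp: part_add tmap_add, simp add: part_def)

section \<open>Charge of words in h_+ and h_-\<close>

definition charge :: "(sign \<times> nat) list \<Rightarrow> int" where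
  "charge ws = int (count_list (map fst ws) Pos) - int (count_list (map fst ws) Neg)"

definition sg :: "sign \<Rightarrow> int" where "sg s = (case s of Pos \<Rightarrow> 1 | Neg \<Rightarrow> - 1)"

lemma charge_simps [simp]: "charge [] = 0" "charge ((s, m) # ws) = sg s + charge ws"
  by (simp add: charge_def, cases s) (simp_all add: charge_def sg_def)

lemma balanced_charge: "balanced = {ws \<in> positive. charge ws = 0}"
  by (auto simp: balanced_def positive_def charge_def)

lemma wt_wordof: "wt (wordof ws) = weight ws"
  by (simp add: wt_def wordof_def weight_def comp_def)

lemma linear_image_span:
  assumes add: "\<And>x y. f (x + y) = f x + f y" and scale: "\<And>z x. f (scaleT z x) = scaleT z (f x)"
    and B: "\<And>x. x \<in> B \<Longrightarrow> f x \<in> S" and S: "T.subspace S" and x: "x \<in> T.span B"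
  shows "f x \<in> S"
  using x
proof (rule T.span_induct)
  have "f 0 = 0" using scale[of 0 0] by simp
  then show "T.subspace {x. f x \<in> S}"
    by (intro T.subspaceI) (auto simp: add scale T.subspace_0[OF S] T.subspace_add[OF S] T.subspace_scale[OF S])
qed (use B in auto)

definition frame :: "(sign \<Rightarrow> complex^2) \<Rightarrow> complex^2^2" where
  "frame h = (\<chi> i j. h (if j = 1 then Pos else Neg) $ i)"

lemma column_frame [simp]: "column (sidx s) (frame h) = h s"
  by (cases s) (simp_all add: frame_def column_def vec_eq_iff)

locale null_frame = metric_modes g p l for g :: "'m metric" and p l +
  fixes h :: "sign \<Rightarrow> complex^2" and K :: "complex^2^2"
  assumes K_frame: "K ** frame h = mat 1" and null: "G (h s) (h s) = 0"
begin

abbreviation mv :: "(sign \<times> nat) list \<Rightarrow> tens" where "mv \<equiv> mode_vec G l h"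

lemma frame_K: "frame h ** K = mat 1"
  using K_frame by (simp add: matrix_left_right_inverse)

lemma mv_tmap: "ws \<in> positive \<Longrightarrow> mv ws = tmap (frame h) (Poly_Mapping.single (wordof ws) 1)"
  by (rule mode_vec_tmap) auto

lemma tmap_K_mv: "ws \<in> positive \<Longrightarrow> tmap K (mv ws) = Poly_Mapping.single (wordof ws) 1"
  by (simp add: mv_tmap K_frame flip: tmap_mult)

text \<open>K turns \<open>mv ws\<close> into the monomial \<open>wordof ws\<close>, so membership
  in the span is a condition on the support of \<open>tmap K t\<close>. Independence, the grading
  and the comparison with parallel sections are read off from this.\<close>

lemma mv_span:
  assumes "B \<subseteq> positive"
  shows "t \<in> T.span (mv ` B) \<longleftrightarrow> (\<forall>w. lk (tmap K t) w \<noteq> 0 \<longrightarrow> w \<in> wordof ` B)"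
proof
  let ?S = "{t. \<forall>w. lk (tmap K t) w \<noteq> 0 \<longrightarrow> w \<in> wordof ` B}"
  have "T.subspace ?S"
  proof (rule T.subspaceI)
    fix x y assume "x \<in> ?S" "y \<in> ?S"
    then show "x + y \<in> ?S" unfolding mem_Collect_eq tmap_add lookup_add by (metis add.right_neutral)
  qed (auto simp: tmap_scaleT lookup_scaleT)
  moreover have "mv ` B \<subseteq> ?S"
    using assms by (auto simp: tmap_K_mv subset_iff lookup_single when_def split: if_splits)
  ultimately have "T.span (mv ` B) \<subseteq> ?S" by (intro T.span_minimal)
  then show "t \<in> T.span (mv ` B) \<Longrightarrow> \<forall>w. lk (tmap K t) w \<noteq> 0 \<longrightarrow> w \<in> wordof ` B" by blast
next
  assume *: "\<forall>w. lk (tmap K t) w \<noteq> 0 \<longrightarrow> w \<in> wordof ` B"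
  have "tmap_word (frame h) w \<in> T.span (mv ` B)" if w: "lk (tmap K t) w \<noteq> 0" for w
  proof -
    obtain ws where "w = wordof ws" "ws \<in> B" using * w by blast
    moreover from this have "mv ws = tmap_word (frame h) w"
      using mv_tmap[of ws] assms by (auto simp: tmap_def lin_ext_single)
    ultimately show ?thesis by (metis T.span_base imageI)
  qed
  then have "tmap (frame h) (tmap K t) \<in> T.span (mv ` B)"
    unfolding tmap_def[of "frame h"] lin_ext_def by (intro T.span_sum T.span_scale) (simp add: in_keys_iff)
  then show "t \<in> T.span (mv ` B)" by (simp add: frame_K flip: tmap_mult)
qed

lemma mv_inj: "inj_on mv positive"
proof (rule inj_onI)
  fix ws ws' assume *: "ws \<in> positive" "ws' \<in> positive" "mv ws = mv ws'"
  then have "Poly_Mapping.single (wordof ws) (1::complex) = Poly_Mapping.single (wordof ws') 1"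
    by (metis tmap_K_mv)
  then have "lk (Poly_Mapping.single (wordof ws) 1) (wordof ws) = lk (Poly_Mapping.single (wordof ws') 1) (wordof ws)" by simp
  then have "wordof ws = wordof ws'" by (auto simp: lookup_single when_def split: if_splits)
  then show "ws = ws'" using inj_wordof by (simp add: inj_eq)
qed

lemma mv_independent:
  assumes "B \<subseteq> positive" shows "\<not> T.dependent (mv ` B)"
proof
  assume "T.dependent (mv ` B)"
  then obtain ws where ws: "ws \<in> B" "mv ws \<in> T.span (mv ` B - {mv ws})" by (auto simp: T.dependent_def)
  have "mv ` B - {mv ws} = mv ` (B - {ws})"
    using inj_on_image_set_diff[OF mv_inj, of B "{ws}"] assms ws(1) by auto
  then have "wordof ws \<in> wordof ` (B - {ws})"
    using ws assms mv_span[of "B - {ws}" "mv ws"] by (auto simp: tmap_K_mv subset_iff)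
  then show False using inj_wordof by (auto simp: inj_eq)
qed

lemma mv_tensor_alg [intro]: "ws \<in> positive \<Longrightarrow> mv ws \<in> tensor_alg"
  by (induction ws) auto

text \<open>All charges are considered although V has charge 0: the induction on a word strips off
  one letter at a time and leaves charge 0 on the way.\<close>

definition charged :: "int \<Rightarrow> tens set" where
  "charged c = T.span (mv ` {ws \<in> positive. charge ws = c})"

lemma subspace_charged [simp]: "T.subspace (charged c)" by (simp add: charged_def)

lemma mv_charged: "ws \<in> positive \<Longrightarrow> c = charge ws \<Longrightarrow> mv ws \<in> charged c"
  unfolding charged_def by (rule T.span_base) auto

lemma charged_tensor_alg: "t \<in> charged c \<Longrightarrow> t \<in> tensor_alg"
  unfolding charged_def using T.span_minimal[OF _ subspace_tensor_alg, of "mv ` {ws \<in> positive. charge ws = c}"] by blast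

lemma lmul_charged:
  assumes "t \<in> charged c" "m > 0" "d = sg i + c" shows "lmul (h i) m t \<in> charged d"
  using assms(1) unfolding charged_def[of c]
proof (rule linear_image_span[OF lmul_add lmul_scaleT _ subspace_charged, rotated])
  fix x assume "x \<in> mv ` {ws \<in> positive. charge ws = c}"
  then obtain ws where "x = mv ws" "ws \<in> positive" "charge ws = c" by blast
  then have "lmul (h i) m x = mv ((i, m) # ws)" "(i, m) # ws \<in> positive" "charge ((i, m) # ws) = d"
    using assms by auto
  then show "lmul (h i) m x \<in> charged d" by (metis mv_charged)
qed

text \<open>Since h_i is null, h_i(n) contracts only with letters of the opposite sign, and the
  removal of such a letter changes the charge by \<open>sg i\<close>.\<close>

lemma ann_charged:
  assumes "t \<in> charged c" "d = sg i + c" shows "ann (h i) n t \<in> charged d"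
  using assms(1) unfolding charged_def[of c]
proof (rule linear_image_span[OF ann_add ann_scaleT _ subspace_charged, rotated])
  fix x assume "x \<in> mv ` {ws \<in> positive. charge ws = c}"
  then obtain ws where ws: "x = mv ws" "ws \<in> positive" "charge ws = c" by blast
  have "ann (h i) n (mv ws) \<in> charged (sg i + charge ws)"
    using ws(2)
  proof (induction ws)
    case (Cons b ws)
    obtain j m where b: "b = (j, m)" by (cases b)
    have "G (h i) (h j) = 0 \<or> sg i + sg j = 0"
      using null[of i] by (cases i; cases j) (auto simp: sg_def)
    then have "scaleT (of_nat n * G (h i) (h j) * l) (mv ws) \<in> charged (sg i + charge ((j, m) # ws))"
    proof
      assume "sg i + sg j = 0"
      then show ?thesis using Cons.prems
        by (intro T.subspace_scale[OF subspace_charged] mv_charged) (auto simp: b)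
    qed (simp add: T.subspace_0[OF subspace_charged])
    moreover have "lmul (h j) m (ann (h i) n (mv ws)) \<in> charged (sg i + charge ((j, m) # ws))"
      using Cons by (intro lmul_charged) (auto simp: b)
    ultimately show ?case
      using Cons.prems by (auto simp: b ann_lmul intro!: T.subspace_add[OF subspace_charged])
  qed (simp add: T.subspace_0[OF subspace_charged])
  then show "ann (h i) n x \<in> charged d" using ws assms by simp
qed

lemma Y_charged_mv:
  "ws \<in> positive \<Longrightarrow> v \<in> charged c \<Longrightarrow> Y (mv ws) v N \<in> charged (charge ws + c)"
proof (induction ws arbitrary: v c N)
  case Nil
  then show ?case by (simp add: T.subspace_0[OF subspace_charged])
next
  case (Cons b ws)
  obtain j m where b: "b = (j, Suc m)" using Cons.prems by (cases b; cases "snd b") auto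
  have 1: "Y (mv ws) v M \<in> charged (charge ws + c)" for M using Cons by simp
  have 2: "Y (mv ws) (ann (h j) k v) M \<in> charged (charge ws + (sg j + c))" for k M
    using Cons.IH[OF _ ann_charged[OF Cons.prems(2) refl]] Cons.prems(1) by simp
  show ?case unfolding b mode_vec_Cons[OF zero_less_Suc]
    by (rule esum_subspace[OF Y_lmul subspace_charged], intro T.subspace_add[OF subspace_charged] T.subspace_scale[OF subspace_charged])
      (use 2 in \<open>auto intro: lmul_charged[OF 1] simp: algebra_simps\<close>)
qed

lemma Y_charged:
  assumes "u \<in> charged b" "v \<in> charged c" shows "Y u v N \<in> charged (b + c)"
  using assms(1) unfolding charged_def[of b]
  by (rule linear_image_span[OF Y_add_left Y_scaleT_left _ subspace_charged, rotated])
    (use assms(2) Y_charged_mv in auto)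

end

section \<open>Normally ordered products\<close>

lemma lin_foldr_mode:
  "foldr (\<lambda>(a, n). mode G l a n) ys 0 = 0"
  by (induction ys) (auto simp: mode_def)

context metric_modes
begin

lemma mode_nonneg: "n \<ge> 0 \<Longrightarrow> mode G l a n = ann a (nat n)"
  by (simp add: ann_def)

lemma foldr_nonneg:
  assumes "\<forall>(a, n)\<in>set ys. n \<ge> 0" "v \<in> tensor_alg"
  shows "foldr (\<lambda>(a, n). mode G l a n) ys v \<in> tensor_alg \<and>
    ann a k (foldr (\<lambda>(a, n). mode G l a n) ys v) = foldr (\<lambda>(a, n). mode G l a n) ys (ann a k v)"
  using assms(1)
proof (induction ys)
  case (Cons y ys)
  obtain b n where y: "y = (b, n)" "n \<ge> 0" using Cons.prems by (cases y) auto
  then show ?case using Cons ann_commute[of "foldr (\<lambda>(a, n). mode G l a n) ys v" a k b "nat n"]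
    by (auto simp: mode_nonneg)
qed (simp add: assms)

lemma normal_ordered_neg:
  "n < 0 \<Longrightarrow> normal_ordered G l ((a, n) # xs) v = lmul a (nat (- n)) (normal_ordered G l xs v)"
  by (simp add: normal_ordered_def mode_def)

text \<open>A positive mode in front stays in front of the remaining nonnegative ones; as these
  commute, it may act on v first. A zero mode makes both sides vanish.\<close>

lemma normal_ordered_nonneg:
  assumes "n \<ge> 0" "v \<in> tensor_alg"
  shows "normal_ordered G l ((a, n) # xs) v = normal_ordered G l xs (ann a (nat n) v)"
proof -
  let ?neg = "filter (\<lambda>(a, n). n < 0) xs" and ?pos = "filter (\<lambda>(a, n). n > 0) xs" and ?zero = "filter (\<lambda>(a, n). n = 0) xs"
  show ?thesis
  proof (cases "n = 0")
    case True
    then show ?thesis by (simp add: normal_ordered_def mode_nonneg lin_foldr_mode)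
  next
    case False
    have "ann a (nat n) (foldr (\<lambda>(a, n). mode G l a n) (?pos @ ?zero) v) = foldr (\<lambda>(a, n). mode G l a n) (?pos @ ?zero) (ann a (nat n) v)"
    proof -
      have "\<forall>(a, n)\<in>set (?pos @ ?zero). n \<ge> 0" by auto
      from foldr_nonneg[OF this assms(2)] show ?thesis by blast
    qed
    then show ?thesis using False assms(1) by (simp add: normal_ordered_def mode_nonneg)
  qed
qed

abbreviation vt :: "(sign \<Rightarrow> complex^2) \<Rightarrow> (sign \<times> nat) list \<Rightarrow> tens \<Rightarrow> int list \<Rightarrow> tens" where
  "vt h \<equiv> vertex_term G l h"

lemma vertex_term_Nil: "vt h [] v [] = v"
  by (simp add: vertex_term_def normal_ordered_def)

lemma vertex_term_neg:
  "n < 0 \<Longrightarrow> vt h ((i, m) # ws) v (n # ns) = scaleT (of_int (- n - 1) gchoose (m - 1)) (lmul (h i) (nat (- n)) (vt h ws v ns))"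
  by (simp add: vertex_term_def normal_ordered_neg lmul_scaleT)

lemma vertex_term_nonneg:
  "n \<ge> 0 \<Longrightarrow> v \<in> tensor_alg \<Longrightarrow> vt h ((i, m) # ws) v (n # ns) = scaleT (of_int (- n - 1) gchoose (m - 1)) (vt h ws (ann (h i) (nat n) v) ns)"
  by (simp add: vertex_term_def normal_ordered_nonneg)

lemma normal_ordered_zero [simp]: "normal_ordered G l xs 0 = 0"
  by (simp add: normal_ordered_def lin_foldr_mode)

lemma vertex_term_zero [simp]: "vt h ws 0 ns = 0"
  by (simp add: vertex_term_def)

lemma vertex_term_cp: "vt h ((i, Suc m) # ws) v (- int (Suc m + k) # ns) = scaleT (cp m k) (lmul (h i) (Suc m + k) (vt h ws v ns))"
proof -
  have "(of_int (- (- int (Suc m + k)) - 1) :: complex) = of_nat (m + k)" by simp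
  then have "of_int (- (- int (Suc m + k)) - 1) gchoose (Suc m - 1) = cp m k"
    using binomial_gbinomial[of "m + k" m, where 'a=complex] binomial_symmetric[of k "m + k"] by (simp add: cp_def)
  moreover have "nat (- (- int (Suc m + k))) = Suc m + k" by (simp only: minus_minus nat_int)
  moreover have "- int (Suc m + k) < 0" by simp
  ultimately show ?thesis by (simp only: vertex_term_neg)
qed

text \<open>The divided derivative of order m kills x^j for j < m, where j = -n - 1.\<close>

lemma vertex_term_below: "n < 0 \<Longrightarrow> n > - int (Suc m) \<Longrightarrow> vt h ((i, Suc m) # ws) v (n # ns) = 0"
proof -
  assume n: "n < 0" "n > - int (Suc m)"
  define j where "j = nat (- n - 1)"
  have j: "- n - 1 = int j" "j < m" using n by (auto simp: j_def)
  have "(of_int (- n - 1) :: complex) gchoose (Suc m - 1) = 0"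
    unfolding j(1) of_int_of_nat_eq diff_Suc_1 binomial_gbinomial[symmetric] using j(2) by (simp add: binomial_eq_0)
  then show ?thesis using n by (simp add: vertex_term_neg)
qed

lemma gchoose_cm: "(of_int (- int k - 1) gchoose m :: complex) = cm m k"
proof -
  have "of_nat m - of_int (- int k - 1) - 1 = (of_nat (m + k) :: complex)" by simp
  then show ?thesis
    using gbinomial_negated_upper[of "of_int (- int k - 1) :: complex" m] binomial_symmetric[of k "m + k"]
    by (simp only: cm_def binomial_gbinomial) (simp flip: binomial_gbinomial)
qed

lemma vertex_term_cm: "v \<in> tensor_alg \<Longrightarrow> vt h ((i, Suc m) # ws) v (int k # ns) = scaleT (cm m k) (vt h ws (ann (h i) k v) ns)"
  by (subst vertex_term_nonneg) (simp_all only: gchoose_cm diff_Suc_1 nat_int of_nat_0_le_iff)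

definition supp :: "(sign \<Rightarrow> complex^2) \<Rightarrow> (sign \<times> nat) list \<Rightarrow> tens \<Rightarrow> int \<Rightarrow> int list set" where
  "supp h ws v N = {ns. length ns = length ws \<and> sum_list (map2 (\<lambda>(i, m) n. - n - int m) ws ns) = N \<and> vt h ws v ns \<noteq> 0}"

lemma vertex_coeff_supp: "vertex_coeff G l h ws v N = (\<Sum>ns\<in>supp h ws v N. vt h ws v ns)"
  by (simp add: vertex_coeff_def supp_def)

lemma supp_zero [simp]: "supp h ws 0 N = {}"
  by (simp add: supp_def)

text \<open>The claims have to be proved together: a sum over an infinite support would be 0 by
  convention, and finiteness for \<open>b # ws\<close> uses that the supports for \<open>ws\<close>
  are empty at low powers of x, which bounds the first negative mode.\<close>

lemma vertex_coeff_Y_aux: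
  assumes "ws \<in> positive" "v \<in> tensor_alg"
  shows "(\<forall>N. finite (supp h ws v N)) \<and> (\<exists>B::nat. \<forall>N < - int B. supp h ws v N = {}) \<and>
    (\<forall>N. Y (mode_vec G l h ws) v N = vertex_coeff G l h ws v N)"
  using assms
proof (induction ws arbitrary: v)
  case Nil
  have "supp h [] v N = (if N = 0 \<and> v \<noteq> 0 then {[]} else {})" for N
    by (auto simp: supp_def vertex_term_Nil)
  then show ?case by (auto simp: vertex_coeff_supp vertex_term_Nil)
next
  case (Cons b ws)
  obtain i m where b: "b = (i, Suc m)" using Cons.prems by (cases b; cases "snd b") auto
  have ws: "ws \<in> positive" using Cons.prems by simp
  note v = Cons.prems(2)
  have fin: "finite (supp h ws u N)" and coeff: "Y (mode_vec G l h ws) u N = vertex_coeff G l h ws u N"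
    and low: "\<exists>B::nat. \<forall>N < - int B. supp h ws u N = {}" if "u \<in> tensor_alg" for u N
    using Cons.IH[OF ws that] by auto
  obtain B :: nat where B: "supp h ws v N = {}" if "N < - int B" for N using low[OF v] by blast
  obtain n where n: "ann (h i) k v = 0" if "k \<ge> n" for k using ann_vanish by blast
  let ?M = "\<lambda>N k. N + int k + int (Suc m)"
  define r where "r N = nat (N + int B + 1)" for N
  have r: "supp h ws v (N - int k) = {}" if "k \<ge> r N" for N k
    by (rule B) (use that in \<open>unfold r_def, linarith\<close>)
  \<comment> \<open>Mode lists sorted by their first entry, -m-1-k in \<open>U1\<close> and k in
    \<open>U2\<close>; entries from -m to -1 contribute nothing by
    \<open>vertex_term_below\<close>.\<close>
  define U1 where "U1 N k = Cons (- int (Suc m + k)) ` supp h ws v (N - int k)" for N k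
  define U2 where "U2 N k = Cons (int k) ` supp h ws (ann (h i) k v) (?M N k)" for N k
  have sub: "supp h (b # ws) v N \<subseteq> (\<Union>k<r N. U1 N k) \<union> (\<Union>k<n. U2 N k)" for N
  proof
    fix ns assume ns: "ns \<in> supp h (b # ws) v N"
    then obtain x ns' where x: "ns = x # ns'" "length ns' = length ws" by (cases ns) (auto simp: supp_def)
    have sum: "- x - int (Suc m) + sum_list (map2 (\<lambda>(i, m) n. - n - int m) ws ns') = N" and nz: "vt h (b # ws) v (x # ns') \<noteq> 0"
      using ns by (auto simp: supp_def x b)
    show "ns \<in> (\<Union>k<r N. U1 N k) \<union> (\<Union>k<n. U2 N k)"
    proof (cases "x < 0")
      case True
      then have "x \<le> - int (Suc m)" using nz vertex_term_below[of x m] by (force simp: b)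
      define k where "k = nat (- x - int (Suc m))"
      have k: "x = - int (Suc m + k)" using \<open>x \<le> - int (Suc m)\<close> by (simp add: k_def)
      have "ns' \<in> supp h ws v (N - int k)"
      proof -
        have "vt h ws v ns' \<noteq> 0" using nz unfolding b k vertex_term_cp by auto
        moreover have "sum_list (map2 (\<lambda>(i, m) n. - n - int m) ws ns') = N - int k" using sum k by simp
        ultimately show ?thesis using x(2) by (simp add: supp_def)
      qed
      moreover from this have "k < r N" using r[of N k] by (metis empty_iff not_less)
      ultimately show ?thesis by (auto simp: U1_def x k)
    next
      case False
      then obtain k where k: "x = int k" by (metis nonneg_int_cases not_less)
      have "ns' \<in> supp h ws (ann (h i) k v) (?M N k)"
        using nz sum x(2) by (auto simp: supp_def b k vertex_term_cm[OF v])
      moreover from this have "k < n" using n[of k] by (metis empty_iff not_less supp_zero)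
      ultimately show ?thesis by (auto simp: U2_def x k)
    qed
  qed
  have finU: "finite (U1 N k)" "finite (U2 N k)" for N k
    unfolding U1_def U2_def using fin[OF v] fin[OF ann_tensor_alg[OF v]] by simp_all
  have lowb: "\<exists>B::nat. \<forall>N < - int B. supp h (b # ws) v N = {}"
  proof -
    have "\<exists>C::nat. \<forall>k<n. \<forall>N < - int C. supp h ws (ann (h i) k v) N = {}"
      by (rule finite_uniform_bound) (use low v in blast)
    then obtain C :: nat where C: "supp h ws (ann (h i) k v) N = {}" if "k < n" "N < - int C" for k N by blast
    have "supp h (b # ws) v N = {}" if N: "N < - int (B + C + n + Suc m)" for N
    proof -
      have "r N = 0" using N by (simp add: r_def)
      moreover have "U2 N k = {}" if "k < n" for k
        unfolding U2_def using C[OF that, of "?M N k"] N that by simp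
      ultimately show ?thesis using sub[of N] by simp
    qed
    then show ?thesis by blast
  qed
  have Y: "Y (mode_vec G l h (b # ws)) v N = vertex_coeff G l h (b # ws) v N" for N
  proof -
    have "Y (mode_vec G l h (b # ws)) v N =
      (\<Sum>k<r N. scaleT (cp m k) (lmul (h i) (Suc m + k) (Y (mode_vec G l h ws) v (N - int k)))) +
      (\<Sum>k<n. scaleT (cm m k) (Y (mode_vec G l h ws) (ann (h i) k v) (?M N k)))"
      unfolding b mode_vec_Cons[OF zero_less_Suc]
      by (rule esum_unique[OF Y_lmul], rule esum_add; rule esum_finite)
        (auto simp: coeff[OF v] r n vertex_coeff_supp)
    also have "(\<Sum>k<r N. scaleT (cp m k) (lmul (h i) (Suc m + k) (Y (mode_vec G l h ws) v (N - int k)))) =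
      (\<Sum>ns\<in>(\<Union>k<r N. U1 N k). vt h (b # ws) v ns)"
    proof (subst sum.UNION_disjoint)
      show "(\<Sum>k<r N. scaleT (cp m k) (lmul (h i) (Suc m + k) (Y (mode_vec G l h ws) v (N - int k)))) =
        (\<Sum>k<r N. \<Sum>ns\<in>U1 N k. vt h (b # ws) v ns)"
        by (intro sum.cong refl)
          (simp add: U1_def sum.reindex coeff[OF v] vertex_coeff_supp lmul_sum T.scale_sum_right b vertex_term_cp[simplified])
    qed (use finU in \<open>auto simp: U1_def\<close>)
    also have "(\<Sum>k<n. scaleT (cm m k) (Y (mode_vec G l h ws) (ann (h i) k v) (?M N k))) =
      (\<Sum>ns\<in>(\<Union>k<n. U2 N k). vt h (b # ws) v ns)"
    proof (subst sum.UNION_disjoint)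
      show "(\<Sum>k<n. scaleT (cm m k) (Y (mode_vec G l h ws) (ann (h i) k v) (?M N k))) =
        (\<Sum>k<n. \<Sum>ns\<in>U2 N k. vt h (b # ws) v ns)"
        by (intro sum.cong refl)
          (simp add: U2_def sum.reindex coeff[OF ann_tensor_alg[OF v]] vertex_coeff_supp T.scale_sum_right b vertex_term_cm[OF v])
    qed (use finU in \<open>auto simp: U2_def\<close>)
    also have "(\<Sum>ns\<in>(\<Union>k<r N. U1 N k). vt h (b # ws) v ns) + (\<Sum>ns\<in>(\<Union>k<n. U2 N k). vt h (b # ws) v ns) =
      (\<Sum>ns\<in>(\<Union>k<r N. U1 N k) \<union> (\<Union>k<n. U2 N k). vt h (b # ws) v ns)"
      by (rule sum.union_disjoint[symmetric]) (use finU in \<open>auto simp: U1_def U2_def\<close>)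
    also have "\<dots> = (\<Sum>ns\<in>supp h (b # ws) v N. vt h (b # ws) v ns)"
    proof (rule sum.mono_neutral_right[OF _ sub])
      show "finite ((\<Union>k<r N. U1 N k) \<union> (\<Union>k<n. U2 N k))" using finU by auto
      show "\<forall>ns\<in>(\<Union>k<r N. U1 N k) \<union> (\<Union>k<n. U2 N k) - supp h (b # ws) v N. vt h (b # ws) v ns = 0"
        by (auto simp: U1_def U2_def supp_def b)
    qed
    finally show ?thesis by (simp add: vertex_coeff_supp)
  qed
  show ?case using finite_subset[OF sub] finU lowb Y by auto
qed

lemma vertex_coeff_Y:
  "ws \<in> positive \<Longrightarrow> v \<in> tensor_alg \<Longrightarrow> Y (mode_vec G l h ws) v N = vertex_coeff G l h ws v N"
  using vertex_coeff_Y_aux by blast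

end

section \<open>The algebra structure\<close>

definition wt_op :: "tens \<Rightarrow> tens" where
  "wt_op = lin_ext (\<lambda>w. Poly_Mapping.single w (of_int (wt w)))"

lemma wt_op_add: "wt_op (s + t) = wt_op s + wt_op t"
  and wt_op_scaleT: "wt_op (scaleT z t) = scaleT z (wt_op t)"
  by (simp_all add: wt_op_def lin_ext_add lin_ext_scaleT)

lemma lookup_wt_op: "lk (wt_op t) w = of_int (wt w) * lk t w"
proof (induction t rule: tens_induct)
  case (3 v z)
  show ?case by (auto simp: wt_op_def lin_ext_single lookup_scaleT lookup_single when_def)
qed (auto simp: wt_op_add lookup_add algebra_simps, simp add: wt_op_def)

lemma wt_op_hom: "hom n t \<Longrightarrow> wt_op t = scaleT (of_int n) t"
  by (rule poly_mapping_eqI) (auto simp: lookup_wt_op lookup_scaleT hom_def)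

context metric_modes
begin

lemma hom_Y: assumes u: "hom b u" and v: "hom c v" shows "hom (b + c + N) (Y u v N)"
  unfolding Y_def
proof (intro hom_lin_ext)
  fix w z assume "lk u w \<noteq> 0" "lk v z \<noteq> 0"
  then have "b + c + N = wt w + wt z + N" using u v by (auto simp: hom_def)
  then show "hom (b + c + N) (Yw w z N)" using hom_Yw by simp
qed

lemma wt_op_Y: "wt_op (Y u v N) - Y u (wt_op v) N = scaleT (of_int N) (Y u v N) + Y (wt_op u) v N"
proof (induction u rule: tens_induct)
  case 1
  then show ?case by (simp add: wt_op_def)
next
  case (2 s t)
  then show ?case by (simp add: Y_add_left wt_op_add T.scale_right_distrib algebra_simps)
next
  case (3 w x)
  show ?case
  proof (induction v rule: tens_induct)
    case 1
    then show ?case by (simp add: wt_op_def)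
  next
    case (2 s t)
    then show ?case by (simp add: Y_add_right wt_op_add T.scale_right_distrib algebra_simps)
  next
    case (3 z y)
    have 1: "hom (wt w) (Poly_Mapping.single w x)" "hom (wt z) (Poly_Mapping.single z y)"
      by (auto intro: hom_single)
    show ?case
      by (simp add: wt_op_hom[OF hom_Y[OF 1]] wt_op_hom[OF 1(1)] wt_op_hom[OF 1(2)] Y_scaleT_left Y_scaleT_right T.scale_left_distrib)
  qed
qed

end

context null_frame
begin

definition W :: "tens set" where "W = T.span (mv ` balanced)"

definition Wn :: "int \<Rightarrow> tens set" where "Wn n = T.span (mv ` {ws \<in> balanced. weight ws = n})"

lemma W_charged: "W = charged 0"
  by (simp add: W_def charged_def balanced_charge)

lemma balanced_positive: "balanced \<subseteq> positive" by (auto simp: balanced_charge)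

text \<open>Algebra maps induced by matrices keep weights, so homogeneity can be tested on
  \<open>tmap K t\<close>, where the span is a support condition.\<close>

lemma Wn_iff: "t \<in> Wn n \<longleftrightarrow> t \<in> W \<and> hom n t"
proof -
  have B: "{ws \<in> balanced. weight ws = n} \<subseteq> positive" using balanced_positive by auto
  have "hom n t \<longleftrightarrow> hom n (tmap K t)"
    using hom_tmap[of n t K] hom_tmap[of n "tmap K t" "frame h"] by (auto simp: frame_K simp flip: tmap_mult)
  moreover have "w \<in> wordof ` {ws \<in> balanced. weight ws = n} \<longleftrightarrow> w \<in> wordof ` balanced \<and> wt w = n" for w
    by (auto simp: wt_wordof)
  ultimately show ?thesis
    unfolding Wn_def W_def mv_span[OF B] mv_span[OF balanced_positive] hom_def by blast
qed

lemma W_tensor_alg: "v \<in> W \<Longrightarrow> v \<in> tensor_alg"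
  by (simp add: W_charged charged_tensor_alg)

lemma part_W: "v \<in> W \<Longrightarrow> part n v \<in> Wn n"
  unfolding Wn_iff using hom_part
  by (auto simp: W_def mv_span[OF balanced_positive] lookup_part simp flip: part_tmap split: if_splits)

lemma vac_W: "vac \<in> W"
proof -
  have "mv [] \<in> mv ` balanced" by (rule imageI) (simp add: balanced_def)
  then show ?thesis unfolding W_def by (metis T.span_base mode_vec_Nil)
qed

lemma subspace_W: "T.subspace W" by (simp add: W_def)

lemma graded_W: "graded_by scaleT W Wn"
  unfolding graded_by_def
proof (intro conjI allI ballI)
  fix n show "T.subspace (Wn n)" by (simp add: Wn_def)
  show "Wn n \<subseteq> W" by (auto simp: Wn_iff)
next
  fix v assume v: "v \<in> W"
  have fin: "finite {n. part n v \<noteq> 0}"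
  proof (rule finite_subset)
    show "{n. part n v \<noteq> 0} \<subseteq> wt ` Poly_Mapping.keys v"
    proof
      fix n assume "n \<in> {n. part n v \<noteq> 0}"
      then obtain w where "lk (part n v) w \<noteq> 0" by (metis mem_Collect_eq lookup_zero poly_mapping_eqI)
      then show "n \<in> wt ` Poly_Mapping.keys v" by (auto simp: lookup_part in_keys_iff split: if_splits)
    qed
  qed simp
  have sum: "v = (\<Sum>n | part n v \<noteq> 0. part n v)"
  proof (rule poly_mapping_eqI)
    fix w
    have "lk (\<Sum>n | part n v \<noteq> 0. part n v) w = (\<Sum>n | part n v \<noteq> 0. if n = wt w then lk v w else 0)"
      unfolding lookup_sum by (intro sum.cong) (auto simp: lookup_part)
    also have "\<dots> = (if part (wt w) v \<noteq> 0 then lk v w else 0)" by (simp add: fin)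
    also have "\<dots> = lk v w" using lookup_part[of "wt w" v w] by auto
    finally show "lk v w = lk (\<Sum>n | part n v \<noteq> 0. part n v) w" ..
  qed
  show "\<exists>!f. (\<forall>n. f n \<in> Wn n) \<and> finite {n. f n \<noteq> 0} \<and> v = (\<Sum>n | f n \<noteq> 0. f n)"
  proof (rule ex1I)
    show "(\<forall>n. part n v \<in> Wn n) \<and> finite {n. part n v \<noteq> 0} \<and> v = (\<Sum>n | part n v \<noteq> 0. part n v)"
      using part_W[OF v] fin sum by simp
  next
    fix f assume f: "(\<forall>n. f n \<in> Wn n) \<and> finite {n. f n \<noteq> 0} \<and> v = (\<Sum>n | f n \<noteq> 0. f n)"
    have "part k v = f k" for k
    proof -
      have "part k (\<Sum>n\<in>S. f n) = (\<Sum>n\<in>S. part k (f n))" for S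
        by (induction S rule: infinite_finite_induct) (auto simp: part_add, auto simp: part_def)
      then have "part k v = (\<Sum>n | f n \<noteq> 0. part k (f n))" using f by metis
      also have "\<dots> = (\<Sum>n | f n \<noteq> 0. if n = k then f n else 0)"
      proof (intro sum.cong refl)
        fix n have "hom n (f n)" using f by (simp add: Wn_iff)
        then show "part k (f n) = (if n = k then f n else 0)" by (simp add: part_hom)
      qed
      also have "\<dots> = f k" using f by simp
      finally show ?thesis .
    qed
    then show "f = (\<lambda>n. part n v)" by auto
  qed
qed

lemma MOSVA: "is_MOSVA scaleT W Wn Y vac"
  unfolding is_MOSVA_def Let_def
proof (intro conjI)
  show "vector_space scaleT" by (rule vector_space_scaleT)
  show "T.subspace W" "graded_by scaleT W Wn" "vac \<in> W" by (rule subspace_W graded_W vac_W)+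
  show YW: "\<forall>u\<in>W. \<forall>v\<in>W. \<forall>n. Y u v n \<in> W"
    using Y_charged[of _ 0 _ 0] by (simp add: W_charged)
  show "\<forall>u\<in>W. \<forall>n. linear_on_subspace scaleT W (\<lambda>v. Y u v n)"
    by (simp add: linear_on_subspace_def Y_add_right Y_scaleT_right)
  show "\<forall>v\<in>W. \<forall>n. linear_on_subspace scaleT W (\<lambda>u. Y u v n)"
    by (simp add: linear_on_subspace_def Y_add_left Y_scaleT_left)
  have "Wn n = {0}" if "n < 0" for n
    using hom_neg[OF _ that] T.subspace_0[OF subspace_W] by (auto simp: Wn_iff)
  then show "\<exists>n0. \<forall>n<n0. Wn n = {0}" by blast
  show "\<exists>d. linear_on_subspace scaleT W d \<and> (\<forall>n. \<forall>v\<in>Wn n. d v = scaleT (of_int n) v) \<and>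
        (\<forall>u\<in>W. \<forall>v\<in>W. \<forall>n. d (Y u v n) - Y u (d v) n = scaleT (of_int n) (Y u v n) + Y (d u) v n)"
    by (intro exI[of _ wt_op])
      (auto simp: linear_on_subspace_def wt_op_add wt_op_scaleT wt_op_hom Wn_iff wt_op_Y)
  show "\<forall>v\<in>W. \<forall>n. Y vac v n = (if n = 0 then v else 0)" by simp
  show "\<forall>u\<in>W. (\<forall>n<0. Y u vac n = 0) \<and> Y u vac 0 = u"
    using Y_creation[OF W_tensor_alg] by blast
  have D: "fdx scaleT (Y v vac) 0 = D v" for v by (simp add: fdx_def D_def)
  show "\<forall>u\<in>W. \<forall>v\<in>W. \<forall>n. fdx scaleT (Y u v) n = Y (fdx scaleT (Y u vac) 0) v n \<and>
          fdx scaleT (Y u v) n = fdx scaleT (Y (Y u v n) vac) 0 - Y u (fdx scaleT (Y v vac) 0) n"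
    unfolding D by (auto simp: fdx_def Y_D_left[OF W_tensor_alg] Y_D_right[OF W_tensor_alg W_tensor_alg])
  show "\<forall>u1\<in>W. \<forall>v\<in>W. \<exists>q. \<forall>u2\<in>W.
        binomial_mult scaleT q (product_series scaleT Y u1 u2 v) = binomial_mult scaleT q (iterate_series Y u1 u2 v)"
    unfolding binomial_mult_X using associativity W_tensor_alg by meson
qed

end

section \<open>Smooth functions\<close>

lemma has_derivative_cong_open:
  assumes "open S" "x \<in> S" "\<And>y. y \<in> S \<Longrightarrow> f y = g y"
  shows "(f has_derivative D) (at x) \<longleftrightarrow> (g has_derivative D) (at x)"
  using has_derivative_transform_within_open[of f D x UNIV S g] has_derivative_transform_within_open[of g D x UNIV S f] assms
  by auto

lemma frechet_derivative_cong_open: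
  assumes "open S" "x \<in> S" "\<And>y. y \<in> S \<Longrightarrow> f y = g y"
  shows "frechet_derivative f (at x) = frechet_derivative g (at x)" "f differentiable at x \<longleftrightarrow> g differentiable at x"
  using has_derivative_cong_open[OF assms] by (simp_all add: frechet_derivative_def differentiable_def)

lemma C_diff_cong:
  assumes "open S" "\<And>y. y \<in> S \<Longrightarrow> f y = g y" "C_diff k S f"
  shows "C_diff k S g"
  using assms(2,3)
proof (induction k arbitrary: f g)
  case 0
  then show ?case using continuous_on_cong[of S S f g] by simp
next
  case (Suc k)
  have "C_diff k S (\<lambda>x. frechet_derivative g (at x) v)" for v
    by (rule Suc.IH[of "\<lambda>x. frechet_derivative f (at x) v"])
      (use Suc.prems frechet_derivative_cong_open(1)[OF assms(1), of _ f g] in auto)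
  then show ?case using Suc.prems frechet_derivative_cong_open(2)[OF assms(1), of _ f g] by auto
qed

text \<open>\<open>C_diff\<close> speaks of \<open>frechet_derivative\<close>; this rule accepts any
  formula for the derivative and lets the calculus rules pass from class k to k + 1.\<close>

lemma C_diff_derivI:
  assumes "open S" "\<And>x. x \<in> S \<Longrightarrow> (f has_derivative D x) (at x)" "\<And>v. C_diff k S (\<lambda>x. D x v)"
  shows "C_diff (Suc k) S f"
  using assms frechet_derivative_at[OF assms(2)]
  by (auto simp: differentiable_def intro!: C_diff_cong[OF assms(1) _ assms(3)])

lemma C_diff_derivD:
  assumes "C_diff (Suc k) S f" "x \<in> S"
  shows "(f has_derivative frechet_derivative f (at x)) (at x)"
  using assms by (simp add: frechet_derivative_works)

lemma C_diff_SucD: "C_diff (Suc k) S f \<Longrightarrow> C_diff k S f"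
proof (induction k arbitrary: f)
  case 0
  then show ?case
    by (auto intro!: continuous_at_imp_continuous_on differentiable_imp_continuous_within)
qed auto

lemma C_diff_const: "C_diff k S (\<lambda>x. c)"
  by (induction k arbitrary: c) auto

lemma C_diff_add:
  assumes "open S" shows "C_diff k S f \<Longrightarrow> C_diff k S g \<Longrightarrow> C_diff k S (\<lambda>x. f x + g x)"
proof (induction k arbitrary: f g)
  case (Suc k)
  show ?case
    by (rule C_diff_derivI[OF assms has_derivative_add[OF C_diff_derivD[OF Suc.prems(1)] C_diff_derivD[OF Suc.prems(2)]]])
      (use Suc in auto)
qed (auto intro: continuous_intros)

lemma C_diff_bounded_linear:
  assumes "open S" "bounded_linear L" shows "C_diff k S f \<Longrightarrow> C_diff k S (\<lambda>x. L (f x))"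
proof (induction k arbitrary: f)
  case 0
  then show ?case using bounded_linear.continuous_on[OF assms(2)] by simp
next
  case (Suc k)
  show ?case
    by (rule C_diff_derivI[OF assms(1) bounded_linear.has_derivative[OF assms(2) C_diff_derivD[OF Suc.prems]]])
      (use Suc in auto)
qed

lemma C_diff_mult:
  fixes f g :: "'a::real_normed_vector \<Rightarrow> 'b::real_normed_algebra"
  assumes "open S" shows "C_diff k S f \<Longrightarrow> C_diff k S g \<Longrightarrow> C_diff k S (\<lambda>x. f x * g x)"
proof (induction k arbitrary: f g)
  case (Suc k)
  note f = Suc.prems(1) and g = Suc.prems(2)
  show ?case
    by (rule C_diff_derivI[OF assms has_derivative_mult[OF C_diff_derivD[OF f] C_diff_derivD[OF g]]])
      (use f g C_diff_SucD[OF f] C_diff_SucD[OF g] in \<open>auto intro!: C_diff_add[OF assms] Suc.IH\<close>)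
qed (auto intro: continuous_intros)

lemma C_diff_inverse:
  fixes f :: "'a::real_normed_vector \<Rightarrow> real"
  assumes "open S" "\<And>x. x \<in> S \<Longrightarrow> f x \<noteq> 0" shows "C_diff k S f \<Longrightarrow> C_diff k S (\<lambda>x. inverse (f x))"
proof (induction k)
  case (Suc k)
  have "C_diff k S (\<lambda>x. (- 1) * (inverse (f x) * frechet_derivative f (at x) v * inverse (f x)))" for v
    using Suc C_diff_SucD[OF Suc.prems] by (intro C_diff_mult[OF assms(1)] C_diff_const) auto
  then show ?case
    by (intro C_diff_derivI[OF assms(1) Deriv.has_derivative_inverse[OF assms(2) C_diff_derivD[OF Suc.prems]]]) auto
qed (use assms in \<open>auto intro: continuous_intros\<close>)

lemma C_diff_sqrt:
  fixes f :: "'a::real_normed_vector \<Rightarrow> real"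
  assumes "open S" "\<And>x. x \<in> S \<Longrightarrow> f x > 0" shows "C_diff k S f \<Longrightarrow> C_diff k S (\<lambda>x. sqrt (f x))"
proof (induction k)
  case (Suc k)
  have "sqrt (f x) \<noteq> 0" if "x \<in> S" for x using assms(2)[OF that] by simp
  then have "C_diff k S (\<lambda>x. inverse (sqrt (f x)))"
    using Suc C_diff_SucD[OF Suc.prems] by (intro C_diff_inverse[OF assms(1)]) auto
  then have "C_diff k S (\<lambda>x. (inverse (sqrt (f x)) * (1 / 2)) * frechet_derivative f (at x) v)" for v
    using Suc by (intro C_diff_mult[OF assms(1)] C_diff_const) auto
  then have D: "C_diff k S (\<lambda>x. frechet_derivative f (at x) v * (inverse (sqrt (f x)) / 2))" for v
    by (simp add: mult.commute)
  have "((\<lambda>x. sqrt (f x)) has_derivative (\<lambda>v. frechet_derivative f (at x) v * (inverse (sqrt (f x)) / 2))) (at x)" if "x \<in> S" for x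
    using DERIV_compose_FDERIV[OF DERIV_real_sqrt[OF assms(2)[OF that]] C_diff_derivD[OF Suc.prems that]] .
  then show ?case by (rule C_diff_derivI[OF assms(1) _ D])
qed (use assms in \<open>auto intro: continuous_intros\<close>)

lemma smooth_on_const [simp]: "smooth_on S (\<lambda>x. c)"
  by (simp add: smooth_on_def C_diff_const)

lemma smooth_on_add: "open S \<Longrightarrow> smooth_on S f \<Longrightarrow> smooth_on S g \<Longrightarrow> smooth_on S (\<lambda>x. f x + g x)"
  by (simp add: smooth_on_def C_diff_add)

lemma smooth_on_mult:
  fixes f g :: "'a::real_normed_vector \<Rightarrow> 'b::real_normed_algebra"
  shows "open S \<Longrightarrow> smooth_on S f \<Longrightarrow> smooth_on S g \<Longrightarrow> smooth_on S (\<lambda>x. f x * g x)"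
  by (simp add: smooth_on_def C_diff_mult)

lemma smooth_on_bounded_linear:
  "open S \<Longrightarrow> bounded_linear L \<Longrightarrow> smooth_on S f \<Longrightarrow> smooth_on S (\<lambda>x. L (f x))"
  by (simp add: smooth_on_def C_diff_bounded_linear)

lemma smooth_on_of_real: "open S \<Longrightarrow> smooth_on S f \<Longrightarrow> smooth_on S (\<lambda>x. complex_of_real (f x))"
  by (rule smooth_on_bounded_linear[OF _ bounded_linear_of_real])

lemma smooth_on_minus: "open S \<Longrightarrow> smooth_on S f \<Longrightarrow> smooth_on S (\<lambda>x. - f x)"
  by (rule smooth_on_bounded_linear[OF _ bounded_linear_minus[OF bounded_linear_ident]])

lemma smooth_on_diff: "open S \<Longrightarrow> smooth_on S f \<Longrightarrow> smooth_on S g \<Longrightarrow> smooth_on S (\<lambda>x. f x - g x)"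
  using smooth_on_add[OF _ _ smooth_on_minus, of S f g] by simp

lemma smooth_on_sum: "open S \<Longrightarrow> (\<And>i. i \<in> I \<Longrightarrow> smooth_on S (f i)) \<Longrightarrow> smooth_on S (\<lambda>x. \<Sum>i\<in>I. f i x)"
  by (induction I rule: infinite_finite_induct) (auto intro: smooth_on_add)

lemma smooth_on_inverse:
  fixes f :: "'a::real_normed_vector \<Rightarrow> real"
  shows "open S \<Longrightarrow> (\<And>x. x \<in> S \<Longrightarrow> f x \<noteq> 0) \<Longrightarrow> smooth_on S f \<Longrightarrow> smooth_on S (\<lambda>x. inverse (f x))"
  by (simp add: smooth_on_def C_diff_inverse)

lemma smooth_on_sqrt:
  fixes f :: "'a::real_normed_vector \<Rightarrow> real"
  shows "open S \<Longrightarrow> (\<And>x. x \<in> S \<Longrightarrow> f x > 0) \<Longrightarrow> smooth_on S f \<Longrightarrow> smooth_on S (\<lambda>x. sqrt (f x))"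
  by (simp add: smooth_on_def C_diff_sqrt)

lemma smooth_on_cong: "open S \<Longrightarrow> smooth_on S f \<Longrightarrow> (\<And>y. y \<in> S \<Longrightarrow> f y = g y) \<Longrightarrow> smooth_on S g"
  unfolding smooth_on_def using C_diff_cong by blast

lemma smooth_on_locally_const:
  assumes "open S" "\<And>x. x \<in> S \<Longrightarrow> (f has_derivative (\<lambda>_. 0)) (at x)" shows "smooth_on S f"
  unfolding smooth_on_def
proof
  fix k show "C_diff k S f"
    using C_diff_SucD[OF C_diff_derivI[OF assms C_diff_const]] .
qed

lemma smooth_on_frechet: "smooth_on S f \<Longrightarrow> smooth_on S (\<lambda>x. frechet_derivative f (at x) v)"
  unfolding smooth_on_def by (metis C_diff.simps(2))

lemma smooth_on_pd: "smooth_on S f \<Longrightarrow> smooth_on S (pd i f)"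
  using smooth_on_frechet[of S f "axis i 1"] by (simp add: pd_def[abs_def])

lemma smooth_on_differentiable: "smooth_on S f \<Longrightarrow> x \<in> S \<Longrightarrow> f differentiable at x"
  unfolding smooth_on_def by (metis C_diff.simps(2))

lemma smooth_on_continuous: "smooth_on S f \<Longrightarrow> continuous_on S f"
  unfolding smooth_on_def by (metis C_diff.simps(1))

section \<open>Partial derivatives and their symmetry\<close>

lemma pd_has_derivative: "(f has_derivative D) (at x) \<Longrightarrow> pd i f x = D (axis i 1)"
  unfolding pd_def by (metis frechet_derivative_at)

lemma pd_const [simp]: "pd i (\<lambda>y. c) x = 0"
  by (rule pd_has_derivative) (rule has_derivative_const)

lemma pd_cong: "open S \<Longrightarrow> x \<in> S \<Longrightarrow> (\<And>y. y \<in> S \<Longrightarrow> f y = g y) \<Longrightarrow> pd i f x = pd i g x"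
  unfolding pd_def by (metis frechet_derivative_cong_open(1))

lemma pd_add:
  assumes "f differentiable at x" "g differentiable at x"
  shows "pd i (\<lambda>y. f y + g y) x = pd i f x + pd i g x"
  unfolding pd_def[of i f] pd_def[of i g]
  by (rule pd_has_derivative) (use assms in \<open>auto simp: frechet_derivative_works intro!: derivative_eq_intros\<close>)

lemma pd_sum:
  assumes "finite I" "\<And>k. k \<in> I \<Longrightarrow> f k differentiable at x"
  shows "pd i (\<lambda>y. \<Sum>k\<in>I. f k y) x = (\<Sum>k\<in>I. pd i (f k) x)"
  using assms by (induction I rule: finite_induct) (auto simp: pd_add differentiable_sum)

lemma pd_mult:
  fixes f g :: "real^2 \<Rightarrow> 'b::real_normed_algebra"
  assumes "f differentiable at x" "g differentiable at x"
  shows "pd i (\<lambda>y. f y * g y) x = pd i f x * g x + f x * pd i g x"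
proof -
  have "((\<lambda>y. f y * g y) has_derivative (\<lambda>v. f x * frechet_derivative g (at x) v + frechet_derivative f (at x) v * g x)) (at x)"
    using assms by (intro has_derivative_mult) (simp_all add: frechet_derivative_works)
  from pd_has_derivative[OF this] show ?thesis by (simp add: pd_def add.commute)
qed

lemma pd_bounded_linear:
  assumes "bounded_linear L" "f differentiable at x"
  shows "pd i (\<lambda>y. L (f y)) x = L (pd i f x)"
  unfolding pd_def[of i f]
  by (rule pd_has_derivative) (use assms bounded_linear.has_derivative in \<open>auto simp: frechet_derivative_works\<close>)

lemma pd_of_real: "f differentiable at x \<Longrightarrow> pd i (\<lambda>y. complex_of_real (f y)) x = complex_of_real (pd i f x)"
  by (rule pd_bounded_linear[OF bounded_linear_of_real])

lemma pd_minus: "f differentiable at x \<Longrightarrow> pd i (\<lambda>y. - f y) x = - pd i f x"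
  by (rule pd_bounded_linear[OF bounded_linear_minus[OF bounded_linear_ident]])

text \<open>The second difference of \<open>f\<close> along \<open>u\<close> and \<open>v\<close>, evaluated by the mean value theorem in each variable.\<close>

lemma second_difference:
  fixes f :: "'a::real_normed_vector \<Rightarrow> real"
  assumes t: "t > 0" and S: "\<And>r s. 0 \<le> r \<Longrightarrow> r \<le> t \<Longrightarrow> 0 \<le> s \<Longrightarrow> s \<le> t \<Longrightarrow> x + s *\<^sub>R u + r *\<^sub>R v \<in> S"
    and f: "C_diff 2 S f"
  obtains r s where "0 < r" "r < t" "0 < s" "s < t"
    "f (x + t *\<^sub>R u + t *\<^sub>R v) - f (x + t *\<^sub>R u) - f (x + t *\<^sub>R v) + f x =
      t * t * frechet_derivative (\<lambda>y. frechet_derivative f (at y) u) (at (x + s *\<^sub>R u + r *\<^sub>R v)) v"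
proof -
  define fu where "fu y = frechet_derivative f (at y) u" for y
  have f1: "(f has_derivative frechet_derivative f (at y)) (at y)" if "y \<in> S" for y
    using f that by (simp add: numeral_2_eq_2 frechet_derivative_works)
  have f2: "(fu has_derivative frechet_derivative fu (at y)) (at y)" if "y \<in> S" for y
    using f that by (simp add: numeral_2_eq_2 frechet_derivative_works fu_def[abs_def])
  have D1: "((\<lambda>s. f (x + s *\<^sub>R u + r *\<^sub>R v)) has_real_derivative fu (x + s *\<^sub>R u + r *\<^sub>R v)) (at s)"
    if "0 \<le> r" "r \<le> t" "0 \<le> s" "s \<le> t" for r s
  proof -
    have "((\<lambda>s. f (x + s *\<^sub>R u + r *\<^sub>R v)) has_derivative (\<lambda>h. frechet_derivative f (at (x + s *\<^sub>R u + r *\<^sub>R v)) (h *\<^sub>R u))) (at s)"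
      by (rule has_derivative_compose[where f="\<lambda>s. x + s *\<^sub>R u + r *\<^sub>R v" and g=f, OF _ f1[OF S[OF that]]]) (auto intro!: derivative_eq_intros)
    then show ?thesis
      unfolding has_field_derivative_def fu_def
      by (rule has_derivative_eq_rhs)
        (simp add: fun_eq_iff linear_scale[OF has_derivative_linear[OF f1[OF S[OF that]]]] mult.commute)
  qed
  have D2: "((\<lambda>r. fu (x + s *\<^sub>R u + r *\<^sub>R v)) has_real_derivative frechet_derivative fu (at (x + s *\<^sub>R u + r *\<^sub>R v)) v) (at r)"
    if "0 \<le> r" "r \<le> t" "0 \<le> s" "s \<le> t" for r s
  proof -
    have "((\<lambda>r. fu (x + s *\<^sub>R u + r *\<^sub>R v)) has_derivative (\<lambda>h. frechet_derivative fu (at (x + s *\<^sub>R u + r *\<^sub>R v)) (h *\<^sub>R v))) (at r)"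
      by (rule has_derivative_compose[where f="\<lambda>r. x + s *\<^sub>R u + r *\<^sub>R v" and g=fu, OF _ f2[OF S[OF that]]]) (auto intro!: derivative_eq_intros)
    then show ?thesis
      unfolding has_field_derivative_def
      by (rule has_derivative_eq_rhs)
        (simp add: fun_eq_iff linear_scale[OF has_derivative_linear[OF f2[OF S[OF that]]]] mult.commute)
  qed
  have "\<exists>s>0. s < t \<and> (f (x + t *\<^sub>R u + t *\<^sub>R v) - f (x + t *\<^sub>R u + 0 *\<^sub>R v)) - (f (x + 0 *\<^sub>R u + t *\<^sub>R v) - f (x + 0 *\<^sub>R u + 0 *\<^sub>R v)) =
      (t - 0) * (fu (x + s *\<^sub>R u + t *\<^sub>R v) - fu (x + s *\<^sub>R u + 0 *\<^sub>R v))"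
    by (rule MVT2[OF t], rule DERIV_diff; rule D1) (use t in auto)
  then obtain s where s: "0 < s" "s < t" "(f (x + t *\<^sub>R u + t *\<^sub>R v) - f (x + t *\<^sub>R u + 0 *\<^sub>R v)) - (f (x + 0 *\<^sub>R u + t *\<^sub>R v) - f (x + 0 *\<^sub>R u + 0 *\<^sub>R v)) =
      (t - 0) * (fu (x + s *\<^sub>R u + t *\<^sub>R v) - fu (x + s *\<^sub>R u + 0 *\<^sub>R v))" by blast
  have "\<exists>r>0. r < t \<and> fu (x + s *\<^sub>R u + t *\<^sub>R v) - fu (x + s *\<^sub>R u + 0 *\<^sub>R v) =
      (t - 0) * frechet_derivative fu (at (x + s *\<^sub>R u + r *\<^sub>R v)) v"
    by (rule MVT2[OF t], rule D2) (use s in auto)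
  then obtain r where "0 < r" "r < t" "fu (x + s *\<^sub>R u + t *\<^sub>R v) - fu (x + s *\<^sub>R u + 0 *\<^sub>R v) =
      (t - 0) * frechet_derivative fu (at (x + s *\<^sub>R u + r *\<^sub>R v)) v" by blast
  with s that[of r s] show thesis by (simp add: fu_def[abs_def] algebra_simps)
qed

text \<open>The second difference is symmetric in u and v, so the two mixed derivatives take a
  common value at two points near x. Continuity at x gives the claim.\<close>

lemma frechet_derivative_commute_real:
  fixes f :: "'a::real_normed_vector \<Rightarrow> real"
  assumes "open S" "x \<in> S" and f: "C_diff 2 S f"
  shows "frechet_derivative (\<lambda>y. frechet_derivative f (at y) u) (at x) v =
    frechet_derivative (\<lambda>y. frechet_derivative f (at y) v) (at x) u"
proof (rule ccontr)
  define F where "F u v y = frechet_derivative (\<lambda>y. frechet_derivative f (at y) u) (at y) v" for u v y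
  assume "\<not> ?thesis"
  then have e: "\<bar>F u v x - F v u x\<bar> / 2 > 0" (is "?e > 0") by (simp add: F_def)
  have cont: "continuous_on S (F u v)" for u v using f by (simp add: numeral_2_eq_2 F_def[abs_def])
  obtain d1 where d1: "d1 > 0" "\<And>y. y \<in> S \<Longrightarrow> dist y x < d1 \<Longrightarrow> dist (F u v y) (F u v x) < ?e"
    using cont[unfolded continuous_on_iff] assms(2) e by meson
  obtain d2 where d2: "d2 > 0" "\<And>y. y \<in> S \<Longrightarrow> dist y x < d2 \<Longrightarrow> dist (F v u y) (F v u x) < ?e"
    using cont[unfolded continuous_on_iff] assms(2) e by meson
  obtain d3 where d3: "d3 > 0" "\<And>y. dist y x < d3 \<Longrightarrow> y \<in> S"
    using assms by (auto simp: open_dist)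
  define d where "d = min d1 (min d2 d3)"
  have d: "d > 0" using d1 d2 d3 by (simp add: d_def)
  \<comment> \<open>Keeps x + su + rv within d/2 of x for r and s between 0 and t; the added 1 makes
    the denominator positive also for u = v = 0.\<close>
  define t where "t = d / (2 * (norm u + norm v + 1))"
  have pos: "norm u + norm v + 1 > 0" by (meson add_nonneg_pos add_nonneg_nonneg norm_ge_zero zero_less_one)
  have t: "t > 0" using d pos by (simp add: t_def)
  have near: "dist (x + s *\<^sub>R u + r *\<^sub>R v) x < d" if "0 \<le> r" "r \<le> t" "0 \<le> s" "s \<le> t" for r s
  proof -
    have "dist (x + s *\<^sub>R u + r *\<^sub>R v) x \<le> s * norm u + r * norm v"
      using norm_triangle_ineq[of "s *\<^sub>R u" "r *\<^sub>R v"] that by (simp add: dist_norm)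
    also have "\<dots> \<le> t * norm u + t * norm v" using that by (intro add_mono mult_right_mono) auto
    also have "\<dots> \<le> t * (norm u + norm v + 1)" using t by (simp add: algebra_simps)
    also have "\<dots> = d / 2" using pos by (simp add: t_def field_simps)
    finally show ?thesis using d by simp
  qed
  have inS: "x + s *\<^sub>R u + r *\<^sub>R v \<in> S" if "0 \<le> r" "r \<le> t" "0 \<le> s" "s \<le> t" for r s
    using near[OF that] d3(2) by (simp add: d_def)
  obtain r s where rs: "0 < r" "r < t" "0 < s" "s < t"
    "f (x + t *\<^sub>R u + t *\<^sub>R v) - f (x + t *\<^sub>R u) - f (x + t *\<^sub>R v) + f x = t * t * F u v (x + s *\<^sub>R u + r *\<^sub>R v)"
    unfolding F_def by (rule second_difference[OF t inS f])
  have inS': "x + s *\<^sub>R v + r *\<^sub>R u \<in> S" if "0 \<le> r" "r \<le> t" "0 \<le> s" "s \<le> t" for r s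
    using inS[of s r] that by (simp add: algebra_simps)
  obtain r' s' where rs': "0 < r'" "r' < t" "0 < s'" "s' < t"
    "f (x + t *\<^sub>R v + t *\<^sub>R u) - f (x + t *\<^sub>R v) - f (x + t *\<^sub>R u) + f x = t * t * F v u (x + s' *\<^sub>R v + r' *\<^sub>R u)"
    unfolding F_def by (rule second_difference[OF t inS' f])
  have swap: "x + s' *\<^sub>R v + r' *\<^sub>R u = x + r' *\<^sub>R u + s' *\<^sub>R v" "x + t *\<^sub>R v + t *\<^sub>R u = x + t *\<^sub>R u + t *\<^sub>R v"
    by (simp_all add: algebra_simps)
  have "t * t * F u v (x + s *\<^sub>R u + r *\<^sub>R v) = t * t * F v u (x + r' *\<^sub>R u + s' *\<^sub>R v)"
    using rs(5) rs'(5) unfolding swap by linarith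
  then have eq: "F u v (x + s *\<^sub>R u + r *\<^sub>R v) = F v u (x + r' *\<^sub>R u + s' *\<^sub>R v)" using t by simp
  have "\<bar>F u v (x + s *\<^sub>R u + r *\<^sub>R v) - F u v x\<bar> < ?e"
    using d1(2)[OF inS[of r s]] near[of r s] rs by (simp add: dist_real_def d_def)
  moreover have "\<bar>F v u (x + r' *\<^sub>R u + s' *\<^sub>R v) - F v u x\<bar> < ?e"
    using d2(2)[OF inS[of s' r']] near[of s' r'] rs' by (simp add: dist_real_def d_def)
  ultimately show False unfolding eq by (simp add: abs_if split: if_splits)
qed

lemma pd_commute_real:
  fixes f :: "real^2 \<Rightarrow> real"
  assumes "open S" "x \<in> S" "smooth_on S f"
  shows "pd i (pd j f) x = pd j (pd i f) x"
proof -
  have "C_diff 2 S f" using assms(3) by (simp add: smooth_on_def)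
  from frechet_derivative_commute_real[OF assms(1,2) this] show ?thesis by (simp add: pd_def[abs_def])
qed

lemma pd_commute:
  fixes f :: "real^2 \<Rightarrow> complex"
  assumes S: "open S" "x \<in> S" and f: "smooth_on S f"
  shows "pd i (pd j f) x = pd j (pd i f) x"
proof -
  have L: "L (pd i (pd j f) x) = L (pd j (pd i f) x)" if L: "bounded_linear (L :: complex \<Rightarrow> real)" for L
  proof -
    have 1: "pd b (\<lambda>y. L (f y)) y = L (pd b f y)" if "y \<in> S" for b y
      by (rule pd_bounded_linear[OF L smooth_on_differentiable[OF f that]])
    have 2: "pd a (pd b (\<lambda>y. L (f y))) x = L (pd a (pd b f) x)" for a b
    proof -
      have "pd a (pd b (\<lambda>y. L (f y))) x = pd a (\<lambda>y. L (pd b f y)) x"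
        by (rule pd_cong[OF S 1])
      also have "\<dots> = L (pd a (pd b f) x)"
        by (rule pd_bounded_linear[OF L smooth_on_differentiable[OF smooth_on_pd[OF f] S(2)]])
      finally show ?thesis .
    qed
    show ?thesis
      using pd_commute_real[OF S smooth_on_bounded_linear[OF S(1) L f], of i j] by (simp only: 2)
  qed
  show ?thesis using L[OF bounded_linear_Re] L[OF bounded_linear_Im] by (simp add: complex_eq_iff)
qed

section \<open>Matrix-valued functions\<close>

definition msmooth :: "(real^2) set \<Rightarrow> (real^2 \<Rightarrow> complex^2^2) \<Rightarrow> bool" where
  "msmooth S M \<longleftrightarrow> (\<forall>i j. smooth_on S (\<lambda>x. M x $ i $ j))"

definition pdm :: "2 \<Rightarrow> (real^2 \<Rightarrow> complex^2^2) \<Rightarrow> real^2 \<Rightarrow> complex^2^2" where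
  "pdm a M x = (\<chi> i j. pd a (\<lambda>y. M y $ i $ j) x)"

lemma pdm_cong: "open S \<Longrightarrow> x \<in> S \<Longrightarrow> (\<And>y. y \<in> S \<Longrightarrow> M y = N y) \<Longrightarrow> pdm i M x = pdm i N x"
  unfolding pdm_def by (auto simp: vec_eq_iff intro!: pd_cong[of S])

lemma msmooth_mult: "open S \<Longrightarrow> msmooth S M \<Longrightarrow> msmooth S N \<Longrightarrow> msmooth S (\<lambda>x. M x ** N x)"
  unfolding msmooth_def matrix_matrix_mult_def by (auto intro!: smooth_on_sum smooth_on_mult)

lemma msmooth_add: "open S \<Longrightarrow> msmooth S M \<Longrightarrow> msmooth S N \<Longrightarrow> msmooth S (\<lambda>x. M x + N x)"
  unfolding msmooth_def by (auto intro!: smooth_on_add)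

lemma msmooth_pdm: "msmooth S M \<Longrightarrow> msmooth S (pdm a M)"
  unfolding msmooth_def pdm_def by (auto intro!: smooth_on_pd)

lemma msmooth_const [simp]: "msmooth S (\<lambda>x. M)"
  unfolding msmooth_def by simp

lemma msmooth_transpose: "msmooth S M \<Longrightarrow> msmooth S (\<lambda>x. transpose (M x))"
  unfolding msmooth_def transpose_def by simp

lemma pdm_const [simp]: "pdm a (\<lambda>y. M) x = 0"
  by (simp add: pdm_def vec_eq_iff)

lemma pdm_transpose: "pdm a (\<lambda>y. transpose (M y)) x = transpose (pdm a M x)"
  by (simp add: pdm_def transpose_def)

lemma msmooth_differentiable: "msmooth S M \<Longrightarrow> x \<in> S \<Longrightarrow> (\<lambda>y. M y $ i $ j) differentiable at x"
  unfolding msmooth_def using smooth_on_differentiable by blast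

lemma pdm_mult:
  assumes "msmooth S M" "msmooth S N" "x \<in> S"
  shows "pdm a (\<lambda>y. M y ** N y) x = pdm a M x ** N x + M x ** pdm a N x"
proof -
  have d: "(\<lambda>y. M y $ i $ j) differentiable at x" "(\<lambda>y. N y $ i $ j) differentiable at x" for i j
    by (rule msmooth_differentiable[OF assms(1,3)], rule msmooth_differentiable[OF assms(2,3)])
  have "pd a (\<lambda>y. \<Sum>k\<in>UNIV. M y $ i $ k * N y $ k $ j) x = (\<Sum>k\<in>UNIV. pd a (\<lambda>y. M y $ i $ k * N y $ k $ j) x)" for i j
    by (rule pd_sum) (auto intro!: differentiable_mult d)
  then show ?thesis
    by (simp add: pdm_def matrix_matrix_mult_def vec_eq_iff pd_mult[OF d] sum.distrib)
qed

lemma pdm_diff: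
  assumes "msmooth S M" "msmooth S N" "x \<in> S"
  shows "pdm a (\<lambda>y. M y - N y) x = pdm a M x - pdm a N x"
proof -
  have d: "(\<lambda>y. M y $ i $ j) differentiable at x" "(\<lambda>y. N y $ i $ j) differentiable at x" for i j
    by (rule msmooth_differentiable[OF assms(1,3)], rule msmooth_differentiable[OF assms(2,3)])
  have "pd a (\<lambda>y. M y $ i $ j - N y $ i $ j) x = pd a (\<lambda>y. M y $ i $ j) x - pd a (\<lambda>y. N y $ i $ j) x" for i j
    using pd_add[OF d(1)[of i j] differentiable_minus[OF d(2)[of i j]], of a] pd_minus[OF d(2)[of i j], of a] by simp
  then show ?thesis by (simp add: pdm_def vec_eq_iff)
qed

lemma pdm_commute:
  assumes "open S" "x \<in> S" "msmooth S M" shows "pdm a (pdm b M) x = pdm b (pdm a M) x"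
  using pd_commute[OF assms(1,2), of "\<lambda>y. M y $ _ $ _" a b] assms(3)
  by (simp add: pdm_def vec_eq_iff msmooth_def pd_def[abs_def])

section \<open>Matrices and derivations\<close>

lemma mat2_eq_iff: "(A :: 'a^2^2) = B \<longleftrightarrow> A $ 1 $ 1 = B $ 1 $ 1 \<and> A $ 1 $ 2 = B $ 1 $ 2 \<and> A $ 2 $ 1 = B $ 2 $ 1 \<and> A $ 2 $ 2 = B $ 2 $ 2"
  by (auto simp: vec_eq_iff forall_2)

lemma mult2_nth: "((A :: 'a::semiring_1^2^2) ** B) $ i $ j = A $ i $ 1 * B $ 1 $ j + A $ i $ 2 * B $ 2 $ j"
  by (simp add: matrix_matrix_mult_def sum_2)

lemma transpose_nth [simp]: "transpose A $ i $ j = A $ j $ i" by (simp add: transpose_def)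

definition mk2 :: "'a \<Rightarrow> 'a \<Rightarrow> 'a \<Rightarrow> 'a \<Rightarrow> 'a^2^2" where
  "mk2 a b c d = (\<chi> i j. if i = 1 then if j = 1 then a else b else if j = 1 then c else d)"

lemma mk2_nth [simp]: "mk2 a b c d $ 1 $ 1 = a" "mk2 a b c d $ 1 $ 2 = b" "mk2 a b c d $ 2 $ 1 = c" "mk2 a b c d $ 2 $ 2 = d"
  by (simp_all add: mk2_def)

text \<open>The Gram matrix of h_+, h_- with (h_+, h_+) = (h_-, h_-) = 0 and (h_+, h_-) = 2.\<close>

definition null_gram :: "complex^2^2" where "null_gram = mk2 0 2 2 0"
definition null_gram_inv :: "complex^2^2" where "null_gram_inv = mk2 0 (1/2) (1/2) 0"

lemma null_gram_inv_mult: "null_gram_inv ** null_gram = mat 1"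
  by (simp add: mat2_eq_iff mult2_nth null_gram_inv_def null_gram_def mat_def)

text \<open>The inverse of a null frame H for the form Q, solved from its Gram matrix without
  division, so that smoothness is inherited from H and Q.\<close>

definition dualframe :: "complex^2^2 \<Rightarrow> complex^2^2 \<Rightarrow> complex^2^2" where
  "dualframe Q H = null_gram_inv ** (transpose H ** Q)"

lemma dualframe_left: "transpose H ** Q ** H = null_gram \<Longrightarrow> dualframe Q H ** H = mat 1"
  unfolding dualframe_def by (metis null_gram_inv_mult matrix_mul_assoc)

lemma dualframe_right: "transpose H ** Q ** H = null_gram \<Longrightarrow> H ** dualframe Q H = mat 1"
  using dualframe_left by (simp add: matrix_left_right_inverse)

text \<open>An isometry permutes the two null lines, and one that exchanges them has determinant -1.
  What remains is diagonal with mutually inverse entries.\<close>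

lemma isometry_diagonal:
  fixes D :: "complex^2^2"
  assumes "transpose D ** null_gram ** D = null_gram" "det D = 1"
  obtains z where "z \<noteq> 0" "D = mk2 z 0 0 (inverse z)"
proof -
  have 1: "D $ 1 $ 1 * D $ 2 $ 1 = 0" "D $ 1 $ 2 * D $ 2 $ 2 = 0"
    "D $ 2 $ 1 * D $ 1 $ 2 + D $ 1 $ 1 * D $ 2 $ 2 = 1" "D $ 1 $ 1 * D $ 2 $ 2 - D $ 1 $ 2 * D $ 2 $ 1 = 1"
    using assms by (auto simp: mat2_eq_iff mult2_nth null_gram_def det_2 algebra_simps)
  have "2 * (D $ 2 $ 1 * D $ 1 $ 2) = 0" using 1(3,4) by (simp add: algebra_simps)
  then have "D $ 1 $ 1 * D $ 2 $ 2 = 1" using 1(4) by auto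
  then have "D $ 1 $ 1 \<noteq> 0" "D $ 2 $ 2 = inverse (D $ 1 $ 1)" "D $ 2 $ 2 \<noteq> 0"
    by (auto simp: inverse_unique)
  with 1 that[of "D $ 1 $ 1"] show ?thesis by (auto simp: mat2_eq_iff)
qed

lemma null_frame_unique:
  assumes "transpose H ** Q ** H = null_gram" "transpose H' ** Q ** H' = null_gram" "det H = det H'" "det H \<noteq> 0"
  obtains z where "z \<noteq> 0" "H' = H ** mk2 z 0 0 (inverse z)"
proof -
  let ?D = "dualframe Q H ** H'"
  have H': "H' = H ** ?D" by (simp add: matrix_mul_assoc dualframe_right[OF assms(1)])
  have "transpose ?D ** null_gram ** ?D = transpose ?D ** (transpose H ** Q ** H) ** ?D" by (simp only: assms(1))
  also have "\<dots> = transpose (H ** ?D) ** Q ** (H ** ?D)"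
    by (simp add: matrix_transpose_mul matrix_mul_assoc)
  also have "\<dots> = null_gram" by (simp add: H'[symmetric] assms(2))
  finally have 1: "transpose ?D ** null_gram ** ?D = null_gram" .
  have "det H * det ?D = det H" using arg_cong[OF H', of det] assms(3) by (simp add: det_mul)
  then have "det ?D = 1" using assms(4) by simp
  then show ?thesis using isometry_diagonal[OF 1] that H' by metis
qed

text \<open>Since f^2 - ek = 1/q^2, the null directions of e x^2 + 2f xy + k y^2 are rational in e,
  f and q. The columns are scaled so that they pair to 2 without a square root of e.\<close>

lemma null_frame_explicit:
  fixes e f k q :: complex
  assumes "e \<noteq> 0" and q: "q * q * (e * k - f * f) = - 1"
  defines "H \<equiv> mk2 (1 + q * f) ((1 - q * f) / e) (- (q * e)) q"
  shows "transpose H ** mk2 e f f k ** H = null_gram" "det H = 2 * q"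
proof -
  have k: "q * q * (e * k) = q * q * (f * f) - 1" using q by (simp add: algebra_simps)
  define a where "a = (1 - q * f) / e"
  have ae: "a * e = 1 - q * f" using assms(1) by (simp add: a_def)
  show "transpose H ** mk2 e f f k ** H = null_gram"
    unfolding mat2_eq_iff mult2_nth transpose_nth H_def mk2_nth null_gram_def a_def[symmetric]
  proof (intro conjI)
    have "((1 + q * f) * e + - (q * e) * f) * (1 + q * f) + ((1 + q * f) * f + - (q * e) * k) * - (q * e) =
      e * (1 + (q * q * (e * k) - q * q * (f * f)))"
      by (simp add: algebra_simps)
    then show "((1 + q * f) * e + - (q * e) * f) * (1 + q * f) + ((1 + q * f) * f + - (q * e) * k) * - (q * e) = 0"
      unfolding k by simp
    have "((a * e + q * f) * a + (a * f + q * k) * q) * e = (a * e + q * f) * (a * e) + ((a * e) * f) * q + q * q * (e * k)"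
      by (simp add: algebra_simps)
    also have "\<dots> = 0" unfolding k ae by (simp add: algebra_simps)
    finally show "(a * e + q * f) * a + (a * f + q * k) * q = 0" using assms(1) by simp
    have "((1 + q * f) * e + - (q * e) * f) * a + ((1 + q * f) * f + - (q * e) * k) * q =
      a * e + f * q + q * q * (f * f) - q * q * (e * k)"
      by (simp add: algebra_simps)
    then show "((1 + q * f) * e + - (q * e) * f) * a + ((1 + q * f) * f + - (q * e) * k) * q = 2"
      unfolding k ae by simp
    have "(a * e + q * f) * (1 + q * f) + (a * f + q * k) * - (q * e) =
      (a * e + q * f) * (1 + q * f) - (a * e) * f * q - q * q * (e * k)"
      by (simp add: algebra_simps)
    then show "(a * e + q * f) * (1 + q * f) + (a * f + q * k) * - (q * e) = 2"
      unfolding k ae by (simp add: algebra_simps)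
  qed
  have "det H = (1 + q * f) * q + (a * e) * q" by (simp add: det_2 H_def a_def)
  then show "det H = 2 * q" unfolding ae by (simp add: algebra_simps)
qed

text \<open>The derivation of the tensor algebra induced by M, on component functions: the
  infinitesimal form of \<open>tmc\<close>. With the Christoffel matrix for M it is the term of
  order zero in \<open>cov_deriv\<close>.\<close>

definition rho :: "complex^2^2 \<Rightarrow> (word \<Rightarrow> complex) \<Rightarrow> word \<Rightarrow> complex" where
  "rho M T w = (\<Sum>r<length w. \<Sum>k\<in>UNIV. M $ fst (w ! r) $ k * T (w[r := (k, snd (w ! r))]))"

lemma rho_Nil [simp]: "rho M T [] = 0" by (simp add: rho_def)

lemma rho_Cons [simp]: "rho M T (b # w) = (\<Sum>k\<in>UNIV. M $ fst b $ k * T ((k, snd b) # w)) + rho M (\<lambda>v. T (b # v)) w"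
  by (simp add: rho_def sum.lessThan_Suc_shift del: sum.lessThan_Suc)

text \<open>\<open>tmd K M\<close> is the derivative of \<open>tmc\<close> at \<open>K\<close> in direction \<open>M\<close>.\<close>

fun tmd :: "complex^2^2 \<Rightarrow> complex^2^2 \<Rightarrow> (word \<Rightarrow> complex) \<Rightarrow> word \<Rightarrow> complex" where
  "tmd K M T [] = 0"
| "tmd K M T (b # w) = (\<Sum>j\<in>UNIV. M $ fst b $ j * tmc K (\<lambda>v. T ((j, snd b) # v)) w) +
     (\<Sum>j\<in>UNIV. K $ fst b $ j * tmd K M (\<lambda>v. T ((j, snd b) # v)) w)"

text \<open>With \<open>tmd_rho\<close>, the chain rule for the tensor representation: a derivation
  before the map moves K in direction KM, a derivation after it in direction MK.\<close>

lemma tmc_rho: "tmc K (rho M T) w = tmd K (K ** M) T w"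
proof (induction w arbitrary: T)
  case (Cons b w)
  have "tmc K (rho M T) (b # w) = (\<Sum>j\<in>UNIV. K $ fst b $ j * (\<Sum>k\<in>UNIV. M $ j $ k * tmc K (\<lambda>v. T ((k, snd b) # v)) w)) +
     (\<Sum>j\<in>UNIV. K $ fst b $ j * tmd K (K ** M) (\<lambda>v. T ((j, snd b) # v)) w)"
    by (simp add: tmc_add tmc_sum tmc_scale Cons sum.distrib distrib_left)
  also have "(\<Sum>j\<in>UNIV. K $ fst b $ j * (\<Sum>k\<in>UNIV. M $ j $ k * tmc K (\<lambda>v. T ((k, snd b) # v)) w)) =
     (\<Sum>k\<in>UNIV. (K ** M) $ fst b $ k * tmc K (\<lambda>v. T ((k, snd b) # v)) w)"
    by (simp add: sum_2 mult2_nth algebra_simps)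
  finally show ?case by simp
qed simp

lemma tmd_rho: "tmd K (M ** K) T w = rho M (tmc K T) w"
proof (induction w arbitrary: T)
  case (Cons b w)
  have r: "rho M (\<lambda>v. \<Sum>j\<in>UNIV. K $ i $ j * S j v) w = (\<Sum>j\<in>UNIV. K $ i $ j * rho M (S j) w)" for i S
    unfolding rho_def sum_2 by (simp add: sum_distrib_left sum.distrib algebra_simps)
  show ?case by (simp add: Cons r) (simp add: sum_2 mult2_nth algebra_simps)
qed simp

lemma tmd_diff: "tmd K (M - M') T w = tmd K M T w - tmd K M' T w"
proof (induction w arbitrary: T)
  case (Cons b w)
  show ?case unfolding tmd.simps Cons.IH by (simp add: sum_2 algebra_simps)
qed simp

definition wcharge :: "word \<Rightarrow> complex" where
  "wcharge w = (\<Sum>b\<leftarrow>w. if fst b = 1 then 1 else - 1)"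

lemma rho_diagonal: "rho (mk2 z 0 0 (- z)) T w = wcharge w * z * T w"
proof (induction w arbitrary: T)
  case (Cons b w)
  then show ?case
    using exhaust_2[of "fst b"] by (cases b) (auto simp: sum_2 wcharge_def algebra_simps)
qed (simp add: wcharge_def)

text \<open>The factor y is z to the power of the charge of w.\<close>

lemma tmc_diagonal: "z \<noteq> 0 \<Longrightarrow> \<exists>y. y \<noteq> 0 \<and> (\<forall>T. tmc (mk2 z 0 0 (inverse z)) T w = y * T w) \<and> (wcharge w = 0 \<longrightarrow> y = 1)"
proof -
  assume z: "z \<noteq> 0"
  define u :: "2 \<times> nat \<Rightarrow> complex" where "u b = (if fst b = 1 then z else inverse z)" for b
  have 1: "tmc (mk2 z 0 0 (inverse z)) T w = prod_list (map u w) * T w" for T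
  proof (induction w arbitrary: T)
    case (Cons b w)
    then show ?case using exhaust_2[of "fst b"] by (cases b) (auto simp: sum_2 u_def)
  qed simp
  have 2: "\<exists>n. wcharge w = of_int n \<and> prod_list (map u w) = z powi n"
  proof (induction w)
    case Nil then show ?case by (intro exI[of _ 0]) (simp add: wcharge_def)
  next
    case (Cons b w)
    then obtain n where "wcharge w = of_int n" "prod_list (map u w) = z powi n" by blast
    note n = this
    show ?case
    proof (cases "fst b = 1")
      case True
      then have "wcharge (b # w) = of_int (n + 1)" "prod_list (map u (b # w)) = z powi (n + 1)"
        using n z by (simp_all add: wcharge_def power_int_add) (simp_all add: u_def)
      then show ?thesis by blast
    next
      case False
      then have "wcharge (b # w) = of_int (n - 1)" "prod_list (map u (b # w)) = z powi (n - 1)"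
        using n z by (simp_all add: wcharge_def power_int_diff) (simp_all add: u_def field_simps)
      then show ?thesis by blast
    qed
  qed
  have "prod_list (map u w) \<noteq> 0" using 2 z by auto
  moreover have "wcharge w = 0 \<Longrightarrow> prod_list (map u w) = 1" using 2 by auto
  ultimately show ?thesis using 1 by blast
qed

lemma tmc_smooth:
  assumes "open S" "msmooth S K" "\<And>v. smooth_on S (\<lambda>x. T x v)"
  shows "smooth_on S (\<lambda>x. tmc (K x) (T x) w)"
  using assms(3)
proof (induction w arbitrary: T)
  case (Cons b w)
  then show ?case using assms(1,2)
    by (auto simp: msmooth_def intro!: smooth_on_sum smooth_on_mult)
qed simp

lemma pd_tmc:
  assumes S: "open S" "x \<in> S" and K: "msmooth S K" and T: "\<And>v. smooth_on S (\<lambda>x. T x v)"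
  shows "pd a (\<lambda>x. tmc (K x) (T x) w) x = tmd (K x) (pdm a K x) (T x) w + tmc (K x) (\<lambda>v. pd a (\<lambda>y. T y v) x) w"
  using T
proof (induction w arbitrary: T)
  case (Cons b w)
  have d: "(\<lambda>y. K y $ i $ j) differentiable at x" "(\<lambda>y. tmc (K y) (\<lambda>v. T y ((j, n) # v)) w) differentiable at x" for i j n
    using msmooth_differentiable[OF K S(2)]
      smooth_on_differentiable[OF tmc_smooth[OF S(1) K] S(2), of "\<lambda>y v. T y ((j, n) # v)" w] Cons.prems by auto
  have "pd a (\<lambda>x. tmc (K x) (T x) (b # w)) x =
    (\<Sum>j\<in>UNIV. pd a (\<lambda>y. K y $ fst b $ j * tmc (K y) (\<lambda>v. T y ((j, snd b) # v)) w) x)"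
    unfolding tmc.simps by (rule pd_sum) (auto intro!: differentiable_mult d)
  also have "\<dots> = (\<Sum>j\<in>UNIV. pdm a K x $ fst b $ j * tmc (K x) (\<lambda>v. T x ((j, snd b) # v)) w +
      K x $ fst b $ j * (tmd (K x) (pdm a K x) (\<lambda>v. T x ((j, snd b) # v)) w + tmc (K x) (\<lambda>v. pd a (\<lambda>y. T y ((j, snd b) # v)) x) w))"
    by (simp add: pd_mult[OF d] Cons.IH[OF Cons.prems] pdm_def)
  finally show ?case by (simp add: sum.distrib distrib_left)
qed simp

section \<open>Geometry in a chart\<close>

text \<open>\<open>matrix_inv\<close> is defined by choice; the adjugate formula is what shows that
  the Christoffel symbols are smooth.\<close>

lemma matrix_inv_2:
  fixes M :: "real^2^2"
  assumes "det M \<noteq> 0"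
  shows "M ** matrix_inv M = mat 1" "matrix_inv M = mk2 (M $ 2 $ 2 * inverse (det M)) (- M $ 1 $ 2 * inverse (det M)) (- M $ 2 $ 1 * inverse (det M)) (M $ 1 $ 1 * inverse (det M))"
proof -
  have "invertible M" using assms by (simp add: invertible_det_nz)
  then obtain M' where "M ** M' = mat 1 \<and> M' ** M = mat 1" by (auto simp: invertible_def)
  then have *: "M ** matrix_inv M = mat 1 \<and> matrix_inv M ** M = mat 1"
    unfolding matrix_inv_def by (rule someI)
  then show "M ** matrix_inv M = mat 1" ..
  let ?N = "mk2 (M $ 2 $ 2 * inverse (det M)) (- M $ 1 $ 2 * inverse (det M)) (- M $ 2 $ 1 * inverse (det M)) (M $ 1 $ 1 * inverse (det M))"
  have "M ** ?N = mat 1"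
  proof -
    have "det M * inverse (det M) = 1" using assms by simp
    then have "(M $ 1 $ 1 * M $ 2 $ 2 - M $ 1 $ 2 * M $ 2 $ 1) * inverse (det M) = 1" by (simp only: det_2)
    then show ?thesis by (simp add: mat2_eq_iff mult2_nth mat_def algebra_simps)
  qed
  then have "matrix_inv M ** (M ** ?N) = matrix_inv M" by simp
  then show "matrix_inv M = ?N" using * by (simp add: matrix_mul_assoc)
qed

lemma matrix_zero_mult: "0 ** (M :: complex^2^2) = 0"
  by (simp add: mat2_eq_iff mult2_nth)

locale chart_geometry =
  fixes A :: "'m chart set" and g :: "'m metric" and c :: "'m chart" and \<sigma> :: "real^2 \<Rightarrow> real"
  assumes S_open: "open (cimg c)"
    and gm_smooth: "\<And>i j. smooth_on (cimg c) (\<lambda>x. gmat A g c x $ i $ j)"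
    and gm_sym: "\<And>x i j. x \<in> cimg c \<Longrightarrow> gmat A g c x $ i $ j = gmat A g c x $ j $ i"
    and gm_pos: "\<And>x. x \<in> cimg c \<Longrightarrow> gmat A g c x $ 1 $ 1 > 0" "\<And>x. x \<in> cimg c \<Longrightarrow> det (gmat A g c x) > 0"
    and sigma: "\<And>x. x \<in> cimg c \<Longrightarrow> \<sigma> x * \<sigma> x = 1" and sigma_smooth: "smooth_on (cimg c) \<sigma>"
begin

abbreviation S :: "(real^2) set" where "S \<equiv> cimg c"
abbreviation gm :: "real^2 \<Rightarrow> real^2^2" where "gm \<equiv> gmat A g c"

text \<open>The columns of \<open>H\<close> are \<open>h\<^sub>\<plusminus> = e\<^sub>1 \<minusplus> \<i>e\<^sub>2\<close>, where \<open>e\<^sub>1, e\<^sub>2\<close> come from \<open>\<partial>\<^sub>1, \<partial>\<^sub>2\<close> by orthonormalization, up to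
  the factors \<open>\<surd>g\<^sub>1\<^sub>1\<close> and \<open>1/\<surd>g\<^sub>1\<^sub>1\<close>, which make the entries rational in the metric and \<open>vol\<close>. The
  sign \<open>\<sigma>\<close> is the orientation of the chart, \<open>Th\<close> the matrix of connection forms of the frame.\<close>

definition vol :: "real^2 \<Rightarrow> real" where "vol x = sqrt (det (gm x))"
definition q :: "real^2 \<Rightarrow> complex" where "q x = \<i> * of_real (\<sigma> x * inverse (vol x))"
definition gC :: "real^2 \<Rightarrow> complex^2^2" where "gC x = (\<chi> i j. of_real (gm x $ i $ j))"
definition H :: "real^2 \<Rightarrow> complex^2^2" where
  "H x = mk2 (1 + q x * of_real (gm x $ 1 $ 2)) ((1 - q x * of_real (gm x $ 1 $ 2)) * of_real (inverse (gm x $ 1 $ 1)))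
     (- (q x * of_real (gm x $ 1 $ 1))) (q x)"
definition KK :: "real^2 \<Rightarrow> complex^2^2" where "KK x = dualframe (gC x) (H x)"
definition Gam :: "2 \<Rightarrow> real^2 \<Rightarrow> complex^2^2" where "Gam a x = (\<chi> m k. of_real (christoffel A g c m a k x))"
definition Th :: "2 \<Rightarrow> real^2 \<Rightarrow> complex^2^2" where "Th a x = KK x ** (pdm a H x + Gam a x ** H x)"
definition th :: "2 \<Rightarrow> real^2 \<Rightarrow> complex" where "th a x = Th a x $ 1 $ 1"

lemma vol_pos: "x \<in> S \<Longrightarrow> vol x > 0" using gm_pos by (simp add: vol_def)

lemma det_gm: "x \<in> S \<Longrightarrow> det (gm x) = gm x $ 1 $ 1 * gm x $ 2 $ 2 - gm x $ 1 $ 2 * gm x $ 1 $ 2"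
  using gm_sym[of x 2 1] by (simp add: det_2)

lemma q_sq: "x \<in> S \<Longrightarrow> q x * q x * of_real (det (gm x)) = - 1"
proof -
  assume x: "x \<in> S"
  have "vol x * vol x = det (gm x)" using gm_pos(2)[OF x] by (simp add: vol_def)
  then have "(\<sigma> x * inverse (vol x)) * (\<sigma> x * inverse (vol x)) * det (gm x) = 1"
    using vol_pos[OF x] sigma[OF x] gm_pos(2)[OF x] by (subst \<open>vol x * vol x = det (gm x)\<close>[symmetric]) (simp add: field_simps)
  then have "of_real ((\<sigma> x * inverse (vol x)) * (\<sigma> x * inverse (vol x)) * det (gm x)) = (1 :: complex)" by simp
  then show ?thesis unfolding q_def of_real_mult by (simp add: algebra_simps)
qed

lemma H_null: "x \<in> S \<Longrightarrow> transpose (H x) ** gC x ** H x = null_gram" and H_det: "x \<in> S \<Longrightarrow> det (H x) = 2 * q x"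
proof -
  assume x: "x \<in> S"
  let ?e = "of_real (gm x $ 1 $ 1) :: complex" and ?f = "of_real (gm x $ 1 $ 2) :: complex" and ?k = "of_real (gm x $ 2 $ 2) :: complex"
  have e: "?e \<noteq> 0" using gm_pos(1)[OF x] by simp
  have "q x * q x * (?e * ?k - ?f * ?f) = - 1"
    using q_sq[OF x] by (simp add: det_gm[OF x])
  note * = null_frame_explicit[OF e this]
  have gC: "gC x = mk2 ?e ?f ?f ?k" using gm_sym[OF x, of 2 1] by (simp add: gC_def mat2_eq_iff)
  have H: "H x = mk2 (1 + q x * ?f) ((1 - q x * ?f) / ?e) (- (q x * ?e)) (q x)"
    by (simp add: H_def divide_inverse)
  show "transpose (H x) ** gC x ** H x = null_gram" "det (H x) = 2 * q x" unfolding gC H by (fact *)+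
qed

lemma KK_H: "x \<in> S \<Longrightarrow> KK x ** H x = mat 1" and H_KK: "x \<in> S \<Longrightarrow> H x ** KK x = mat 1"
  unfolding KK_def by (auto intro: dualframe_left dualframe_right H_null)

lemma smooth_gC: "msmooth S gC"
  unfolding msmooth_def gC_def using gm_smooth by (auto intro!: smooth_on_of_real[OF S_open])

lemma smooth_det: "smooth_on S (\<lambda>x. det (gm x))"
  unfolding det_2 by (intro smooth_on_diff smooth_on_mult S_open gm_smooth)

lemma smooth_H: "msmooth S H"
proof -
  have "smooth_on S (\<lambda>x. inverse (vol x))"
    unfolding vol_def using gm_pos(2)
    by (intro smooth_on_inverse smooth_on_sqrt S_open smooth_det) (auto simp: less_imp_neq[symmetric])
  then have q: "smooth_on S q"
    unfolding q_def[abs_def] by (intro smooth_on_mult smooth_on_of_real S_open sigma_smooth smooth_on_const)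
  have e: "smooth_on S (\<lambda>x. inverse (gm x $ 1 $ 1))"
    using gm_pos(1) by (intro smooth_on_inverse S_open gm_smooth) (auto simp: less_imp_neq[symmetric])
  have "smooth_on S (\<lambda>x. H x $ i $ j)" for i j
    using exhaust_2[of i] exhaust_2[of j]
    by (auto simp: H_def intro!: smooth_on_add smooth_on_diff smooth_on_minus smooth_on_mult smooth_on_of_real S_open gm_smooth q smooth_on_of_real[OF S_open e, simplified])
  then show ?thesis by (simp add: msmooth_def)
qed

lemma smooth_KK: "msmooth S KK"
  unfolding KK_def[abs_def] dualframe_def
  by (intro msmooth_mult msmooth_const msmooth_transpose S_open smooth_H smooth_gC)

lemma christoffel_smooth: "smooth_on S (christoffel A g c k i j)"
proof -
  have inv: "smooth_on S (\<lambda>x. matrix_inv (gm x) $ k $ m)" for k m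
  proof -
    have d: "smooth_on S (\<lambda>x. inverse (det (gm x)))"
      using gm_pos(2) by (intro smooth_on_inverse S_open smooth_det) (auto simp: less_imp_neq[symmetric])
    have "smooth_on S (\<lambda>x. mk2 (gm x $ 2 $ 2 * inverse (det (gm x))) (- gm x $ 1 $ 2 * inverse (det (gm x)))
        (- gm x $ 2 $ 1 * inverse (det (gm x))) (gm x $ 1 $ 1 * inverse (det (gm x))) $ k $ m)"
      using exhaust_2[of k] exhaust_2[of m]
      by (auto intro!: smooth_on_mult smooth_on_minus S_open gm_smooth d)
    then show ?thesis
    proof (rule smooth_on_cong[OF S_open])
      fix y assume "y \<in> S"
      then have "det (gm y) \<noteq> 0" using gm_pos(2)[of y] by simp
      then show "mk2 (gm y $ 2 $ 2 * inverse (det (gm y))) (- gm y $ 1 $ 2 * inverse (det (gm y)))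
        (- gm y $ 2 $ 1 * inverse (det (gm y))) (gm y $ 1 $ 1 * inverse (det (gm y))) $ k $ m = matrix_inv (gm y) $ k $ m"
        by (intro arg_cong[where f="\<lambda>M. M $ k $ m"] matrix_inv_2(2)[symmetric])
    qed
  qed
  have "smooth_on S (\<lambda>x. 1/2 * (\<Sum>m\<in>UNIV. matrix_inv (gm x) $ k $ m *
     (pd i (\<lambda>y. gm y $ j $ m) x + pd j (\<lambda>y. gm y $ i $ m) x - pd m (\<lambda>y. gm y $ i $ j) x)))"
    by (intro smooth_on_mult smooth_on_sum smooth_on_diff smooth_on_add smooth_on_const S_open inv smooth_on_pd gm_smooth)
  then show ?thesis by (simp add: christoffel_def[abs_def])
qed

lemma smooth_Gam: "msmooth S (Gam a)"
  unfolding msmooth_def Gam_def using christoffel_smooth by (auto intro!: smooth_on_of_real[OF S_open])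

lemma smooth_Th: "msmooth S (Th a)"
  unfolding Th_def[abs_def]
  by (intro msmooth_mult msmooth_add S_open smooth_KK smooth_H smooth_Gam msmooth_pdm)

lemma smooth_th: "smooth_on S (th a)"
  using smooth_Th unfolding th_def[abs_def] msmooth_def by blast

text \<open>Multiplying by the metric cancels \<open>matrix_inv\<close> and leaves the Christoffel
  symbols of the first kind; adding two of them with n and j exchanged leaves the derivative of the
  metric.\<close>

lemma metric_compatible:
  assumes x: "x \<in> S" shows "pdm a gC x = transpose (Gam a x) ** gC x + gC x ** Gam a x"
proof -
  let ?L = "\<lambda>n i j. 1/2 * (pd i (\<lambda>y. gm y $ j $ n) x + pd j (\<lambda>y. gm y $ i $ n) x - pd n (\<lambda>y. gm y $ i $ j) x)"
  have sym: "pd i (\<lambda>y. gm y $ j $ n) x = pd i (\<lambda>y. gm y $ n $ j) x" for i j n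
    by (rule pd_cong[OF S_open x]) (rule gm_sym)
  have low: "(\<Sum>k\<in>UNIV. gm x $ n $ k * christoffel A g c k i j x) = ?L n i j" for n i j
  proof -
    have "det (gm x) \<noteq> 0" using gm_pos(2)[OF x] by simp
    note inv = matrix_inv_2(1)[OF this]
    let ?X = "\<lambda>m. pd i (\<lambda>y. gm y $ j $ m) x + pd j (\<lambda>y. gm y $ i $ m) x - pd m (\<lambda>y. gm y $ i $ j) x"
    have "(\<Sum>k\<in>UNIV. gm x $ n $ k * christoffel A g c k i j x) = 1/2 * (\<Sum>m\<in>UNIV. (gm x ** matrix_inv (gm x)) $ n $ m * ?X m)"
      unfolding christoffel_def sum_2 mult2_nth by (simp add: algebra_simps)
    also have "\<dots> = 1/2 * ?X n" unfolding inv by (simp add: mat_def if_distrib[where f="\<lambda>x. x * _"] cong: if_cong)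
    finally show ?thesis .
  qed
  have "pd a (\<lambda>y. gm y $ n $ j) x = (\<Sum>k\<in>UNIV. gm x $ j $ k * christoffel A g c k a n x) + (\<Sum>k\<in>UNIV. gm x $ n $ k * christoffel A g c k a j x)" for n j
    unfolding low using sym[of a n j] sym[of n a j] sym[of j a n] by (simp add: field_simps)
  then have "complex_of_real (pd a (\<lambda>y. gm y $ n $ j) x) = (\<Sum>k\<in>UNIV. of_real (christoffel A g c k a n x) * of_real (gm x $ k $ j)) + (\<Sum>k\<in>UNIV. of_real (gm x $ n $ k) * of_real (christoffel A g c k a j x))" for n j
    using gm_sym[OF x] by (simp add: sum_2 mult.commute)
  moreover have "pd a (\<lambda>y. complex_of_real (gm y $ n $ j)) x = of_real (pd a (\<lambda>y. gm y $ n $ j) x)" for n j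
    by (rule pd_of_real[OF smooth_on_differentiable[OF gm_smooth x]])
  ultimately show ?thesis
    by (simp add: pdm_def gC_def Gam_def vec_eq_iff matrix_matrix_mult_def)
qed

lemma pdm_H: "x \<in> S \<Longrightarrow> pdm a H x = H x ** Th a x - Gam a x ** H x"
  by (simp add: Th_def matrix_mul_assoc H_KK)

text \<open>Differentiating the constant Gram matrix of H, with metric compatibility, shows that
  \<open>Th a x\<close> is skew for the form \<open>null_gram\<close>. In a null frame the
  infinitesimal rotations are the matrices diag(z, -z).\<close>

lemma Th_diagonal:
  assumes x: "x \<in> S" shows "Th a x = mk2 (th a x) 0 0 (- th a x)"
proof -
  have "pdm a (\<lambda>y. transpose (H y) ** gC y ** H y) x = pdm a (\<lambda>y. null_gram) x"
    by (rule pdm_cong[OF S_open x]) (rule H_null)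
  then have "0 = (transpose (pdm a H x) ** gC x + transpose (H x) ** pdm a gC x) ** H x + transpose (H x) ** gC x ** pdm a H x"
    by (simp add: pdm_mult[OF msmooth_mult[OF S_open msmooth_transpose[OF smooth_H] smooth_gC] smooth_H x]
      pdm_mult[OF msmooth_transpose[OF smooth_H] smooth_gC x] pdm_transpose)
  also have "\<dots> = transpose (Th a x) ** (transpose (H x) ** gC x ** H x) + (transpose (H x) ** gC x ** H x) ** Th a x"
    unfolding pdm_H[OF x] metric_compatible[OF x]
    by (simp add: mat2_eq_iff mult2_nth algebra_simps)
  finally have "0 = transpose (Th a x) ** null_gram + null_gram ** Th a x" by (simp only: H_null[OF x])
  then have 0: "Th a x $ 2 $ 1 = 0" "Th a x $ 1 $ 2 = 0" "2 * (Th a x $ 2 $ 2 + Th a x $ 1 $ 1) = 0"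
    by (simp_all add: mat2_eq_iff mult2_nth null_gram_def algebra_simps)
  have "Th a x $ 2 $ 2 + Th a x $ 1 $ 1 = 0" using 0(3) by (simp only: mult_eq_0_iff) simp
  with 0 show ?thesis by (simp add: mat2_eq_iff th_def eq_neg_iff_add_eq_0)
qed

lemma pdm_KK:
  assumes x: "x \<in> S" shows "pdm a KK x = KK x ** Gam a x - Th a x ** KK x"
proof -
  have "pdm a (\<lambda>y. KK y ** H y) x = pdm a (\<lambda>y. mat 1) x"
    by (rule pdm_cong[OF S_open x]) (rule KK_H)
  then have "pdm a KK x ** H x + KK x ** pdm a H x = 0"
    by (simp add: pdm_mult[OF smooth_KK smooth_H x])
  then have "(pdm a KK x ** H x + KK x ** (H x ** Th a x - Gam a x ** H x)) ** KK x = 0 ** KK x"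
    by (simp only: pdm_H[OF x])
  moreover have "(P ** M + K' ** (M ** T' - Q ** M)) ** K' = P ** (M ** K') + (K' ** M) ** T' ** K' - K' ** Q ** (M ** K')"
    for P M K' T' Q :: "complex^2^2"
    by (simp add: mat2_eq_iff mult2_nth algebra_simps)
  ultimately have "pdm a KK x + Th a x ** KK x - KK x ** Gam a x = 0"
    using KK_H[OF x] H_KK[OF x] by (simp add: matrix_zero_mult)
  then show ?thesis by (simp add: algebra_simps)
qed

lemma cov_deriv_rho:
  "cov_deriv A g s c a w x = pd a (tensor_comp A s c w) x + rho (Gam a x) (\<lambda>v. tensor_comp A s c v x) w"
  by (simp add: cov_deriv_def rho_def Gam_def)

lemma frame_section_parallel:
  assumes x: "x \<in> S" and T: "\<And>v. T v \<noteq> 0 \<Longrightarrow> wcharge v = 0"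
  shows "pd a (\<lambda>y. tmc (H y) T w) x + rho (Gam a x) (tmc (H x) T) w = 0"
proof -
  have "pd a (\<lambda>y. tmc (H y) T w) x = tmd (H x) (pdm a H x) T w"
    using pd_tmc[OF S_open x smooth_H, of "\<lambda>_. T" a w] by simp
  also have "\<dots> = tmc (H x) (rho (Th a x) T) w - rho (Gam a x) (tmc (H x) T) w"
    by (simp only: pdm_H[OF x] tmd_diff tmc_rho tmd_rho)
  also have "rho (Th a x) T = (\<lambda>v. 0)"
    unfolding Th_diagonal[OF x] rho_diagonal using T by (auto simp: fun_eq_iff)
  finally show ?thesis by simp
qed

text \<open>The Christoffel part in the derivative of \<open>KK\<close> cancels the one in the
  equation for T. What is left is the diagonal connection matrix, which acts on a coefficient
  through its charge.\<close>

lemma parallel_coeff: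
  assumes x: "x \<in> S" and T: "\<And>v. smooth_on S (\<lambda>x. T x v)"
    and par: "\<And>v. pd a (\<lambda>y. T y v) x + rho (Gam a x) (T x) v = 0"
  shows "pd a (\<lambda>y. tmc (KK y) (T y) w) x = - wcharge w * th a x * tmc (KK x) (T x) w"
proof -
  have "(\<lambda>v. pd a (\<lambda>y. T y v) x) = (\<lambda>v. (- 1) * rho (Gam a x) (T x) v)"
    using par by (simp add: fun_eq_iff add_eq_0_iff2)
  then have "tmc (KK x) (\<lambda>v. pd a (\<lambda>y. T y v) x) w = - tmc (KK x) (rho (Gam a x) (T x)) w"
    by (simp only: tmc_scale) simp
  then have "pd a (\<lambda>y. tmc (KK y) (T y) w) x = - tmd (KK x) (Th a x ** KK x) (T x) w"
    unfolding pd_tmc[where T=T, OF S_open x smooth_KK T] pdm_KK[OF x] tmd_diff tmc_rho by simp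
  then show ?thesis unfolding Th_diagonal[OF x] tmd_rho rho_diagonal by simp
qed

text \<open>Symmetry of the second derivatives of H gives R H = H d\<Theta> for the curvature matrix
  R, since diagonal connection matrices commute. If d\<theta> vanished at x, then so would R, and
  the coordinate plane would have sectional curvature 0.\<close>

lemma curvature_nonzero:
  assumes x: "x \<in> S" and c: "c \<in> A" and curv: "constant_curvature A g K" "K \<noteq> 0"
  shows "pd 1 (th 2) x \<noteq> pd 2 (th 1) x"
proof
  assume eq: "pd 1 (th 2) x = pd 2 (th 1) x"
  have second: "pdm b (pdm a H) x = pdm b H x ** Th a x + H x ** pdm b (Th a) x - (pdm b (Gam a) x ** H x + Gam a x ** pdm b H x)" for a b
  proof -
    have "pdm b (pdm a H) x = pdm b (\<lambda>y. H y ** Th a y - Gam a y ** H y) x"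
      by (rule pdm_cong[OF S_open x]) (rule pdm_H)
    then show ?thesis
      by (simp add: pdm_diff[OF msmooth_mult[OF S_open smooth_H smooth_Th] msmooth_mult[OF S_open smooth_Gam smooth_H] x]
        pdm_mult[OF smooth_H smooth_Th x] pdm_mult[OF smooth_Gam smooth_H x])
  qed
  have dTh: "pdm b (Th a) x = mk2 (pd b (th a) x) 0 0 (- pd b (th a) x)" for a b
  proof -
    have "pdm b (Th a) x = pdm b (\<lambda>y. mk2 (th a y) 0 0 (- th a y)) x"
      by (rule pdm_cong[OF S_open x]) (rule Th_diagonal)
    then show ?thesis
      using pd_minus[OF smooth_on_differentiable[OF smooth_th x], of b a] by (simp add: pdm_def mat2_eq_iff)
  qed
  define R where "R = pdm 1 (Gam 2) x - pdm 2 (Gam 1) x + Gam 1 x ** Gam 2 x - Gam 2 x ** Gam 1 x"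
  have "R ** H x = 0"
    using pdm_commute[OF S_open x smooth_H, of 1 2]
    unfolding second pdm_H[OF x] dTh eq Th_diagonal[OF x] R_def
    by (simp add: mat2_eq_iff mult2_nth algebra_simps)
  then have "R ** H x ** KK x = 0" by (simp add: matrix_zero_mult)
  then have R0: "R = 0" by (simp add: H_KK[OF x] flip: matrix_mul_assoc)
  have G: "pdm a (Gam b) x $ m $ k = of_real (pd a (christoffel A g c m b k) x)" for a b m k
    unfolding pdm_def Gam_def using pd_of_real[OF smooth_on_differentiable[OF christoffel_smooth x]] by simp
  have R: "R $ m $ k = of_real (curvature A g c m k 1 2 x)" for m k
    unfolding R_def curvature_def by (simp add: G mult2_nth sum_2 Gam_def)
  have c12: "curvature A g c m k 1 2 x = 0" for m k using R[of m k] by (simp add: R0)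
  have c21: "curvature A g c m k 2 1 x = - curvature A g c m k 1 2 x" and c0: "curvature A g c m k i i x = 0" for m k i
    by (simp_all add: curvature_def sum_2)
  have "curvature A g c m k i j x = 0" for m k i j
    using c12 c21 c0 exhaust_2[of i] exhaust_2[of j] by auto
  then have "sectional_curvature A g c x (axis 1 1) (axis 2 1) = 0"
    by (simp add: sectional_curvature_def curv_op_def Let_def zero_vec_def[symmetric] matrix_vector_mult_0_right)
  moreover have "(axis 1 1 :: real^2) \<noteq> axis 2 1" by (simp add: axis_eq_axis)
  moreover have "independent {axis 1 1 :: real^2, axis 2 1}"
    by (rule independent_mono[OF independent_Basis]) (auto simp: axis_in_Basis_iff)
  ultimately show False using curv c x unfolding constant_curvature_def by metis
qed

lemma parallel_unbalanced:
  assumes T: "\<And>v. smooth_on S (\<lambda>x. T x v)"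
    and par: "\<And>a v x. x \<in> S \<Longrightarrow> pd a (\<lambda>y. T y v) x + rho (Gam a x) (T x) v = 0"
    and x: "x \<in> S" and c: "c \<in> A" and curv: "constant_curvature A g K" "K \<noteq> 0" and w: "wcharge w \<noteq> 0"
  shows "tmc (KK x) (T x) w = 0"
proof -
  let ?f = "\<lambda>y. tmc (KK y) (T y) w"
  have f: "smooth_on S ?f" by (rule tmc_smooth[OF S_open smooth_KK T])
  have d1: "pd a ?f y = - wcharge w * th a y * ?f y" if "y \<in> S" for a y
    by (rule parallel_coeff[OF that T par[OF that]])
  have d2: "pd b (pd a ?f) x = - wcharge w * (pd b (th a) x * ?f x + th a x * pd b ?f x)" for a b
  proof -
    have "pd b (pd a ?f) x = pd b (\<lambda>y. - wcharge w * (th a y * ?f y)) x"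
      by (rule pd_cong[OF S_open x]) (simp add: d1)
    also have "\<dots> = - wcharge w * pd b (\<lambda>y. th a y * ?f y) x"
      using pd_mult[of "\<lambda>_. - wcharge w" x "\<lambda>y. th a y * ?f y" b]
        smooth_on_differentiable[OF smooth_on_mult[OF S_open smooth_th f] x] by simp
    finally show ?thesis
      using pd_mult[OF smooth_on_differentiable[OF smooth_th x] smooth_on_differentiable[OF f x]] by simp
  qed
  have "pd 1 (pd 2 ?f) x = pd 2 (pd 1 ?f) x" by (rule pd_commute[OF S_open x f])
  \<comment> \<open>The terms containing both \<open>th 1 x\<close> and \<open>th 2 x\<close> are
    symmetric and cancel.\<close>
  then have "wcharge w * (pd 1 (th 2) x - pd 2 (th 1) x) * ?f x = 0"
    unfolding d2 d1[OF x] by (auto simp: algebra_simps)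
  then show ?thesis using w curvature_nonzero[OF x c curv] by auto
qed

end

section \<open>Oriented surfaces\<close>

lemma is_chartD:
  assumes "is_chart c"
  shows "open (cdom c)" "open (cimg c)" "\<And>q. q \<in> cdom c \<Longrightarrow> cinv c (snd c q) = q"
    "\<And>x. x \<in> cimg c \<Longrightarrow> snd c (cinv c x) = x" "\<And>x. x \<in> cimg c \<Longrightarrow> cinv c x \<in> cdom c"
    "homeomorphism (cdom c) (cimg c) (snd c) (cinv c)"
  using assms unfolding is_chart_def homeomorphism_def by auto

lemma chart_open_image:
  assumes "is_chart c" "open W" "W \<subseteq> cdom c" shows "open (snd c ` W)"
proof -
  have "openin (top_of_set (cimg c)) (snd c ` W)"
    by (rule homeomorphism_imp_open_map[OF is_chartD(6)[OF assms(1)]]) (use assms in \<open>auto simp: openin_open_eq is_chartD\<close>)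
  then show ?thesis using is_chartD(2)[OF assms(1)] by (simp add: openin_open_eq)
qed

lemma smooth_atlas_chart: "smooth_atlas A \<Longrightarrow> c \<in> A \<Longrightarrow> is_chart c"
  by (simp add: smooth_atlas_def)

lemma chart_at_in: "smooth_atlas A \<Longrightarrow> chart_at A q \<in> A" and chart_at_dom: "smooth_atlas A \<Longrightarrow> q \<in> cdom (chart_at A q)"
proof -
  assume "smooth_atlas A"
  then have "\<exists>c. c \<in> A \<and> q \<in> cdom c" unfolding smooth_atlas_def by blast
  then have "chart_at A q \<in> A \<and> q \<in> cdom (chart_at A q)" unfolding chart_at_def by (rule someI_ex)
  then show "chart_at A q \<in> A" "q \<in> cdom (chart_at A q)" by auto
qed

lemma overlap_open:
  assumes "smooth_atlas A" "c \<in> A" "d \<in> A" shows "open (snd c ` (cdom c \<inter> cdom d))"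
proof -
  note ch = smooth_atlas_chart[OF assms(1)]
  show ?thesis
    using chart_open_image[OF ch[OF assms(2)], of "cdom c \<inter> cdom d"]
      is_chartD(1)[OF ch[OF assms(2)]] is_chartD(1)[OF ch[OF assms(3)]] by auto
qed

lemma transition_has_derivative:
  assumes "smooth_atlas A" "c \<in> A" "d \<in> A" "q \<in> cdom c" "q \<in> cdom d"
  shows "(snd d \<circ> cinv c has_derivative (\<lambda>v. jac c d q *v v)) (at (snd c q))"
proof -
  have "smooth_on (snd c ` (cdom c \<inter> cdom d)) (snd d \<circ> cinv c)" using assms by (simp add: smooth_atlas_def)
  then have D: "(snd d \<circ> cinv c has_derivative frechet_derivative (snd d \<circ> cinv c) (at (snd c q))) (at (snd c q))"
    using smooth_on_differentiable[of _ "snd d \<circ> cinv c" "snd c q"] assms frechet_derivative_works by blast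
  then show ?thesis
    unfolding jac_def using matrix_vector_mul(2)[OF has_derivative_linear[OF D]] D by simp
qed

lemma has_derivative_matrix_unique:
  fixes M N :: "real^2^2"
  assumes "(f has_derivative (\<lambda>v. M *v v)) (at x)" "(f has_derivative (\<lambda>v. N *v v)) (at x)"
  shows "M = N"
  using has_derivative_unique[OF assms] by (simp add: matrix_eq fun_eq_iff)

lemma jac_chain:
  assumes A: "smooth_atlas A" and c: "c \<in> A" "d \<in> A" "e \<in> A" and q: "q \<in> cdom c" "q \<in> cdom d" "q \<in> cdom e"
  shows "jac c e q = jac d e q ** jac c d q"
proof -
  note ch = smooth_atlas_chart[OF A]
  have inv: "cinv c (snd c q) = q" using is_chartD(3)[OF ch] c q by auto
  have 1: "(snd d \<circ> cinv c has_derivative (\<lambda>v. jac c d q *v v)) (at (snd c q))"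
    by (rule transition_has_derivative[OF A]) fact+
  have "(snd e \<circ> cinv d has_derivative (\<lambda>v. jac d e q *v v)) (at ((snd d \<circ> cinv c) (snd c q)))"
    using transition_has_derivative[OF A c(2,3) q(2,3)] by (simp add: inv)
  from diff_chain_at[OF 1 this]
  have "(snd e \<circ> cinv d \<circ> (snd d \<circ> cinv c) has_derivative (\<lambda>v. (jac d e q ** jac c d q) *v v)) (at (snd c q))"
    by (simp add: comp_def matrix_vector_mul_assoc)
  then have "(snd e \<circ> cinv c has_derivative (\<lambda>v. (jac d e q ** jac c d q) *v v)) (at (snd c q))"
  proof (rule has_derivative_transform_within_open[OF _ overlap_open[OF A c(1,2)]])
    fix x assume "x \<in> snd c ` (cdom c \<inter> cdom d)"
    then show "(snd e \<circ> cinv d \<circ> (snd d \<circ> cinv c)) x = (snd e \<circ> cinv c) x"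
      using is_chartD(3)[OF ch[OF c(1)]] is_chartD(3)[OF ch[OF c(2)]] by auto
  qed (use q in auto)
  then show ?thesis
    using has_derivative_matrix_unique[OF transition_has_derivative[OF A c(1,3) q(1,3)]] by blast
qed

lemma jac_self:
  assumes A: "smooth_atlas A" and c: "c \<in> A" "q \<in> cdom c" shows "jac c c q = mat 1"
proof -
  note ch = smooth_atlas_chart[OF A c(1)]
  have "(snd c \<circ> cinv c has_derivative (\<lambda>v. mat 1 *v v)) (at (snd c q))"
  proof (rule has_derivative_transform_within_open[OF _ is_chartD(2)[OF ch]])
    show "((\<lambda>x. x) has_derivative (\<lambda>v. mat 1 *v v)) (at (snd c q))" by simp
  qed (use c is_chartD(4)[OF ch] in auto)
  then show ?thesis
    using has_derivative_matrix_unique[OF transition_has_derivative[OF A c(1) c(1) c(2) c(2)]] by blast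
qed

lemma jac_inverse:
  assumes "smooth_atlas A" "c \<in> A" "d \<in> A" "q \<in> cdom c" "q \<in> cdom d"
  shows "jac d c q ** jac c d q = mat 1"
  using jac_chain[OF assms(1,2,3,2,4,5,4)] jac_self[OF assms(1,2,4)] by simp

lemma det_jac_nonzero:
  assumes "smooth_atlas A" "c \<in> A" "d \<in> A" "q \<in> cdom c" "q \<in> cdom d"
  shows "det (jac c d q) \<noteq> 0"
  using arg_cong[OF jac_inverse[OF assms], of det] by (auto simp: det_mul)

lemma det_jac_continuous:
  assumes A: "smooth_atlas A" and c: "c \<in> A" "d \<in> A"
  shows "continuous_on (snd c ` (cdom c \<inter> cdom d)) (\<lambda>x. det (jac c d (cinv c x)))"
proof -
  let ?W = "snd c ` (cdom c \<inter> cdom d)"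
  have "smooth_on ?W (snd d \<circ> cinv c)" using A c by (simp add: smooth_atlas_def)
  then have 1: "continuous_on ?W (\<lambda>x. frechet_derivative (snd d \<circ> cinv c) (at x) v $ i)" for v i
    by (intro continuous_on_component smooth_on_continuous smooth_on_frechet)
  have "continuous_on ?W (\<lambda>x. jac c d (cinv c x) $ i $ j)" for i j
  proof (rule continuous_on_cong[THEN iffD1, OF refl _ 1])
    fix x assume "x \<in> ?W"
    then have "snd c (cinv c x) = x" using is_chartD(4)[OF smooth_atlas_chart[OF A c(1)]] by auto
    then show "frechet_derivative (snd d \<circ> cinv c) (at x) (axis j 1) $ i = jac c d (cinv c x) $ i $ j"
      by (simp add: jac_def matrix_def)
  qed
  then show ?thesis unfolding det_2 by (intro continuous_on_diff continuous_on_mult)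
qed

lemma gram_transform:
  fixes b :: "real^2 \<Rightarrow> real^2 \<Rightarrow> real" and M J :: "real^2^2"
  assumes "bilinear b"
  shows "(\<chi> i j. b (column i (M ** J)) (column j (M ** J))) = transpose J ** (\<chi> i j. b (column i M) (column j M)) ** J"
proof -
  have col: "column i (M ** J) = J $ 1 $ i *\<^sub>R column 1 M + J $ 2 $ i *\<^sub>R column 2 M" for i
    by (simp add: vec_eq_iff column_def mult2_nth)
  show ?thesis
    unfolding col by (simp add: mat2_eq_iff mult2_nth bilinear_ladd[OF assms] bilinear_radd[OF assms]
        bilinear_lmul[OF assms] bilinear_rmul[OF assms] algebra_simps)
qed

abbreviation cmat :: "real^2^2 \<Rightarrow> complex^2^2" where "cmat \<equiv> map_matrix of_real"

lemma cmat_mult: "cmat (M ** N) = cmat M ** cmat N"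
  by (simp add: mat2_eq_iff mult2_nth)

lemma cmat_transpose: "cmat (transpose M) = transpose (cmat M)"
  by (simp add: mat2_eq_iff)

lemma cmat_one [simp]: "cmat (mat 1) = mat 1"
  by (simp add: mat2_eq_iff mat_def)

lemma det_cmat: "det (cmat M) = of_real (det M)"
  by (simp add: det_2)

text \<open>B fixes an orientation that the charts of A need not respect. The sign \<tau> allows its
  reversal, so that the given basis (e_1, e_2) at p can be made positive.\<close>

locale oriented_surface =
  fixes A B :: "'m::topological_space chart set" and g :: "'m metric" and \<tau> :: real
  assumes A: "smooth_atlas A" and B: "smooth_atlas B" and AB: "smooth_atlas (A \<union> B)"
    and g: "riemannian_metric A g"
    and oriented: "\<And>c d q. c \<in> B \<Longrightarrow> d \<in> B \<Longrightarrow> q \<in> cdom c \<Longrightarrow> q \<in> cdom d \<Longrightarrow> det (jac c d q) > 0"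
    and tau: "\<tau> * \<tau> = 1"
begin

definition orient :: "'m chart \<Rightarrow> 'm \<Rightarrow> real" where
  "orient c q = \<tau> * sgn (det (jac c (chart_at B q) q))"

lemma orient_eq:
  assumes c: "c \<in> A" "q \<in> cdom c" and d: "d \<in> B" "q \<in> cdom d"
  shows "orient c q = \<tau> * sgn (det (jac c d q))"
proof -
  note b = chart_at_in[OF B, of q] chart_at_dom[OF B, of q]
  have "jac c (chart_at B q) q = jac d (chart_at B q) q ** jac c d q"
    by (rule jac_chain[OF AB]) (use c d b in auto)
  then have "sgn (det (jac c (chart_at B q) q)) = sgn (det (jac c d q))"
    using oriented[OF d(1) b(1) d(2) b(2)] by (simp add: det_mul sgn_mult)
  then show ?thesis by (simp add: orient_def)
qed

lemma orient_sq: "c \<in> A \<Longrightarrow> q \<in> cdom c \<Longrightarrow> orient c q * orient c q = 1"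
proof -
  assume c: "c \<in> A" "q \<in> cdom c"
  note b = chart_at_in[OF B, of q] chart_at_dom[OF B, of q]
  have "det (jac c (chart_at B q) q) \<noteq> 0" by (rule det_jac_nonzero[OF AB]) (use c b in auto)
  then show ?thesis using tau by (auto simp: orient_def sgn_if)
qed

lemma orient_transform:
  assumes "c \<in> A" "q \<in> cdom c" "d \<in> A" "q \<in> cdom d"
  shows "orient c q = orient d q * sgn (det (jac c d q))"
proof -
  note b = chart_at_in[OF B, of q] chart_at_dom[OF B, of q]
  have "jac c (chart_at B q) q = jac d (chart_at B q) q ** jac c d q"
    by (rule jac_chain[OF AB]) (use assms b in auto)
  then show ?thesis by (simp add: orient_def det_mul sgn_mult)
qed

text \<open>Near x a single chart of B serves, by \<open>orient_eq\<close>, and the determinant of a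
  transition map keeps its sign by continuity. A chart domain may be disconnected, so constancy on
  all of it cannot be expected.\<close>

lemma orient_locally_constant:
  assumes c: "c \<in> A" and x: "x \<in> cimg c"
  shows "((\<lambda>x. orient c (cinv c x)) has_derivative (\<lambda>_. 0)) (at x)"
proof -
  note ch = smooth_atlas_chart[OF A c]
  define d where "d = chart_at B (cinv c x)"
  have d: "d \<in> B" "cinv c x \<in> cdom d" using chart_at_in[OF B] chart_at_dom[OF B] by (auto simp: d_def)
  let ?W = "snd c ` (cdom c \<inter> cdom d)" and ?D = "\<lambda>x. det (jac c d (cinv c x))"
  have W: "open ?W" by (rule overlap_open[OF AB]) (use c d in auto)
  have cont: "continuous_on ?W ?D" by (rule det_jac_continuous[OF AB]) (use c d in auto)
  have xW: "x \<in> ?W" using d(2) x is_chartD(4,5)[OF ch] by (metis IntI image_eqI)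
  have yW: "cinv c y \<in> cdom c" "cinv c y \<in> cdom d" if "y \<in> ?W" for y
    using that is_chartD(3)[OF ch] by auto
  define P where "P = (if ?D x > 0 then {0<..} else {..<0::real})"
  have "?D x \<noteq> 0" by (rule det_jac_nonzero[OF AB]) (use yW[OF xW] c d in auto)
  then have "?D x \<in> P" by (auto simp: P_def)
  have "open (?W \<inter> ?D -` P)"
    by (rule continuous_open_preimage[OF cont W]) (simp add: P_def)
  then show ?thesis
  proof (rule has_derivative_transform_within_open[rotated])
    show "x \<in> ?W \<inter> ?D -` P" using xW \<open>?D x \<in> P\<close> by simp
    show "((\<lambda>_. orient c (cinv c x)) has_derivative (\<lambda>_. 0)) (at x)" by simp
    fix y assume y: "y \<in> ?W \<inter> ?D -` P"
    have "orient c (cinv c y) = \<tau> * sgn (?D y)" "orient c (cinv c x) = \<tau> * sgn (?D x)"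
      using orient_eq[OF c _ d(1)] yW[of y] yW[OF xW] y by auto
    then show "orient c (cinv c x) = orient c (cinv c y)"
      using y \<open>?D x \<in> P\<close> by (auto simp: P_def split: if_splits)
  qed
qed

lemma g_pointwise: "bilinear (g q)" "g q u v = g q v u" "u \<noteq> 0 \<Longrightarrow> g q u u > 0"
  using g unfolding riemannian_metric_def by auto

definition gram :: "'m \<Rightarrow> real^2^2" where "gram q = (\<chi> i j. g q (axis i 1) (axis j 1))"

lemma gmat_gram:
  assumes "c \<in> A" "q \<in> cdom c"
  shows "gmat A g c (snd c q) = transpose (jac c (chart_at A q) q) ** gram q ** jac c (chart_at A q) q"
proof -
  have "cinv c (snd c q) = q" using is_chartD(3)[OF smooth_atlas_chart[OF A assms(1)] assms(2)] .
  moreover have "column i (mat 1 :: real^2^2) = axis i 1" for i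
    by (simp add: vec_eq_iff column_def mat_def axis_def)
  ultimately show ?thesis
    using gram_transform[OF g_pointwise(1)[of q], of "mat 1" "jac c (chart_at A q) q"]
    by (simp add: gmat_def coord_vec_def gram_def)
qed

lemma gmat_transform:
  assumes c: "c \<in> A" "q \<in> cdom c" and d: "d \<in> A" "q \<in> cdom d"
  shows "gmat A g c (snd c q) = transpose (jac c d q) ** gmat A g d (snd d q) ** jac c d q"
proof -
  have "jac c (chart_at A q) q = jac d (chart_at A q) q ** jac c d q"
    by (rule jac_chain[OF A]) (use c d chart_at_in[OF A] chart_at_dom[OF A] in auto)
  then show ?thesis
    unfolding gmat_gram[OF c] gmat_gram[OF d] by (simp add: matrix_transpose_mul matrix_mul_assoc)
qed

lemma gram_pos: "gram q $ 1 $ 1 > 0" "det (gram q) > 0" "gram q $ i $ j = gram q $ j $ i"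
proof -
  show sym: "gram q $ i $ j = gram q $ j $ i" for i j by (simp add: gram_def g_pointwise(2))
  show 1: "gram q $ 1 $ 1 > 0" by (simp add: gram_def g_pointwise(3))
  let ?E = "gram q $ 1 $ 1" and ?F = "gram q $ 1 $ 2" and ?G = "gram q $ 2 $ 2"
  \<comment> \<open>E times the component of the second basis vector orthogonal to the first; its
    squared length is E(EG - F^2).\<close>
  let ?u = "?E *\<^sub>R axis 2 1 - ?F *\<^sub>R axis 1 1 :: real^2"
  have "g q ?u ?u = ?E * (?E * ?G - ?F * ?F)"
    by (simp add: bilinear_lsub[OF g_pointwise(1)] bilinear_rsub[OF g_pointwise(1)]
        bilinear_lmul[OF g_pointwise(1)] bilinear_rmul[OF g_pointwise(1)] gram_def g_pointwise(2)[of q "axis 2 1" "axis 1 1"] algebra_simps)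
  moreover have "?u $ 2 \<noteq> 0" using 1 by (simp add: axis_def)
  then have "?u \<noteq> 0" by (metis zero_index)
  then have "g q ?u ?u > 0" by (rule g_pointwise(3))
  ultimately show "det (gram q) > 0" using 1 sym[of 2 1] by (simp add: det_2 zero_less_mult_iff)
qed

lemma chart_geometry: assumes c: "c \<in> A" shows "chart_geometry A g c (\<lambda>x. orient c (cinv c x))"
proof
  note ch = smooth_atlas_chart[OF A c]
  show "open (cimg c)" by (rule is_chartD(2)[OF ch])
  show "smooth_on (cimg c) (\<lambda>x. gmat A g c x $ i $ j)" for i j
    using g c unfolding riemannian_metric_def by blast
  show "smooth_on (cimg c) (\<lambda>x. orient c (cinv c x))"
    by (rule smooth_on_locally_const[OF is_chartD(2)[OF ch] orient_locally_constant[OF c]])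
  fix x assume "x \<in> cimg c"
  then have q: "cinv c x \<in> cdom c" "snd c (cinv c x) = x" using is_chartD(4,5)[OF ch] by auto
  show "orient c (cinv c x) * orient c (cinv c x) = 1" by (rule orient_sq[OF c q(1)])
  show "gmat A g c x $ i $ j = gmat A g c x $ j $ i" for i j by (simp add: gmat_def g_pointwise(2))
  let ?J = "jac c (chart_at A (cinv c x)) (cinv c x)"
  have J: "det ?J \<noteq> 0"
    by (rule det_jac_nonzero[OF A c _ q(1)]) (use chart_at_in[OF A] chart_at_dom[OF A] in auto)
  have "det (gmat A g c x) = det ?J * det ?J * det (gram (cinv c x))"
    using gmat_gram[OF c q(1)] by (simp add: q(2) det_mul det_transpose)
  moreover have "det ?J * det ?J > 0" using J by (simp add: zero_less_mult_iff) linarith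
  ultimately show "det (gmat A g c x) > 0" using gram_pos(2) by simp
  have "column 1 ?J \<noteq> 0"
  proof
    assume "column 1 ?J = 0"
    then have "?J $ 1 $ 1 = 0" "?J $ 2 $ 1 = 0" by (auto simp: column_def vec_eq_iff)
    then show False using J by (simp add: det_2)
  qed
  then show "gmat A g c x $ 1 $ 1 > 0" by (simp add: gmat_def coord_vec_def g_pointwise(3))
qed

text \<open>Positive null frames. The Gram condition leaves diag(z, 1/z) and an exchange of the
  columns; the determinant excludes the exchange. Its value is 2i det(e_1, e_2) for a positive
  orthonormal basis, where det(e_1, e_2) = \<plusminus>1/sqrt(det g).\<close>

definition oframe :: "'m chart \<Rightarrow> 'm \<Rightarrow> complex^2^2 \<Rightarrow> bool" where
  "oframe c q M \<longleftrightarrow> transpose M ** cmat (gmat A g c (snd c q)) ** M = null_gram \<and>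
     det M = 2 * (\<i> * of_real (orient c q * inverse (sqrt (det (gmat A g c (snd c q))))))"

text \<open>The Jacobian determinant enters the volume factor by its absolute value and
  \<open>orient\<close> by its sign.\<close>

lemma oframe_transform:
  assumes c: "c \<in> A" "q \<in> cdom c" and d: "d \<in> A" "q \<in> cdom d" and M: "oframe c q M"
  shows "oframe d q (cmat (jac c d q) ** M)"
proof -
  let ?J = "jac c d q"
  let ?gc = "gmat A g c (snd c q)" and ?gd = "gmat A g d (snd d q)"
  have gc: "?gc = transpose ?J ** ?gd ** ?J" by (rule gmat_transform[OF c d])
  have "transpose (cmat ?J ** M) ** cmat ?gd ** (cmat ?J ** M) = transpose M ** cmat ?gc ** M"
    unfolding gc cmat_mult cmat_transpose by (simp add: matrix_transpose_mul matrix_mul_assoc)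
  then have 1: "transpose (cmat ?J ** M) ** cmat ?gd ** (cmat ?J ** M) = null_gram" using M by (simp add: oframe_def)
  have J: "det ?J \<noteq> 0" by (rule det_jac_nonzero[OF A]) (use c d in auto)
  have "sqrt (det ?gc) = \<bar>det ?J\<bar> * sqrt (det ?gd)"
    unfolding gc by (simp add: det_mul det_transpose real_sqrt_mult mult.commute mult.left_commute)
  then have "det ?J * (orient c q * inverse (sqrt (det ?gc))) = (det ?J * sgn (det ?J) / \<bar>det ?J\<bar>) * (orient d q * inverse (sqrt (det ?gd)))"
    unfolding orient_transform[OF c d] by (simp add: divide_inverse)
  also have "det ?J * sgn (det ?J) / \<bar>det ?J\<bar> = 1" using J by (simp add: sgn_if)
  finally have "complex_of_real (det ?J * (orient c q * inverse (sqrt (det ?gc)))) = of_real (orient d q * inverse (sqrt (det ?gd)))" by simp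
  then have "det (cmat ?J ** M) = 2 * (\<i> * of_real (orient d q * inverse (sqrt (det ?gd))))"
    using M by (simp add: oframe_def det_mul det_cmat mult.left_commute)
  with 1 show ?thesis by (simp add: oframe_def)
qed

abbreviation Hc :: "'m chart \<Rightarrow> real^2 \<Rightarrow> complex^2^2" where
  "Hc c \<equiv> chart_geometry.H A g c (\<lambda>x. orient c (cinv c x))"
abbreviation Kc :: "'m chart \<Rightarrow> real^2 \<Rightarrow> complex^2^2" where
  "Kc c \<equiv> chart_geometry.KK A g c (\<lambda>x. orient c (cinv c x))"

lemma oframe_Hc:
  assumes c: "c \<in> A" "q \<in> cdom c" shows "oframe c q (Hc c (snd c q))"
proof -
  interpret chart_geometry A g c "\<lambda>x. orient c (cinv c x)" by (rule chart_geometry[OF c(1)])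
  have x: "snd c q \<in> cimg c" and inv: "cinv c (snd c q) = q"
    using c is_chartD(3)[OF smooth_atlas_chart[OF A c(1)]] by auto
  have "gC (snd c q) = cmat (gmat A g c (snd c q))" by (simp add: gC_def mat2_eq_iff)
  then show ?thesis
    using H_null[OF x] H_det[OF x] by (simp add: oframe_def q_def vol_def inv)
qed

lemma oframe_det_nonzero: "c \<in> A \<Longrightarrow> q \<in> cdom c \<Longrightarrow> oframe c q M \<Longrightarrow> det M \<noteq> 0"
proof -
  assume c: "c \<in> A" "q \<in> cdom c" and M: "oframe c q M"
  interpret chart_geometry A g c "\<lambda>x. orient c (cinv c x)" by (rule chart_geometry[OF c(1)])
  have "det (gmat A g c (snd c q)) > 0" using gm_pos(2) c by auto
  moreover have "orient c q \<noteq> 0" using orient_sq[OF c] by auto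
  ultimately show ?thesis using M by (simp add: oframe_def)
qed

lemma oframe_unique:
  assumes "c \<in> A" "q \<in> cdom c" "oframe c q M"
  obtains z where "z \<noteq> 0" "M = Hc c (snd c q) ** mk2 z 0 0 (inverse z)"
  using null_frame_unique[of "Hc c (snd c q)" "cmat (gmat A g c (snd c q))" M]
    oframe_Hc[OF assms(1,2)] oframe_det_nonzero[OF assms(1,2) oframe_Hc[OF assms(1,2)]] assms(3)
  unfolding oframe_def by metis

end

section \<open>Parallel sections\<close>

lemma tmap_tensor_alg: "t \<in> tensor_alg \<Longrightarrow> tmap L t \<in> tensor_alg"
  by (induction t rule: tensor_alg_induct)
    (auto simp: tmap_add tmap_scaleT tmap_lmul intro!: T.subspace_add[OF subspace_tensor_alg] T.subspace_scale[OF subspace_tensor_alg])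

lemma wcharge_wordof: "wcharge (wordof ws) = of_int (charge ws)"
proof (induction ws)
  case (Cons b ws)
  obtain s m where "b = (s, m)" by (cases b)
  then show ?case using Cons by (cases s) (simp_all add: wcharge_def sg_def)
qed (simp add: wcharge_def)

lemma wordof_balanced: "w \<in> wordof ` balanced \<longleftrightarrow> w \<in> positive \<and> wcharge w = 0"
  using surj_wordof[of w] by (auto simp: balanced_charge wcharge_wordof inj_image_mem_iff[OF inj_wordof])

lemma zero_derivative_locally_constant:
  fixes f :: "real^2 \<Rightarrow> complex"
  assumes S: "open S" "x \<in> S" and f: "smooth_on S f" and pd: "\<And>i y. y \<in> S \<Longrightarrow> pd i f y = 0"
  obtains e where "e > 0" "ball x e \<subseteq> S" "\<And>y. y \<in> ball x e \<Longrightarrow> f y = f x"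
proof -
  obtain e where e: "e > 0" "ball x e \<subseteq> S" using S by (metis open_contains_ball)
  have "(f has_derivative (\<lambda>_. 0)) (at y)" if "y \<in> S" for y
  proof -
    have D: "(f has_derivative frechet_derivative f (at y)) (at y)"
      using smooth_on_differentiable[OF f that] by (simp add: frechet_derivative_works)
    have "frechet_derivative f (at y) v = 0" for v
    proof -
      have "v = (v $ 1) *\<^sub>R axis 1 1 + (v $ 2) *\<^sub>R axis 2 1"
        by (simp add: vec_eq_iff forall_2 axis_def)
      then have "frechet_derivative f (at y) v = (v $ 1) *\<^sub>R pd 1 f y + (v $ 2) *\<^sub>R pd 2 f y"
        unfolding pd_def
        by (metis linear_add[OF has_derivative_linear[OF D]] linear_scale[OF has_derivative_linear[OF D]])
      then show ?thesis by (simp add: pd[OF that])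
    qed
    then have "frechet_derivative f (at y) = (\<lambda>_. 0)" by auto
    then show ?thesis using D by simp
  qed
  then have "(f has_derivative (\<lambda>_. 0)) (at y within ball x e)" if "y \<in> ball x e" for y
    using that e by (meson has_derivative_at_withinI subsetD)
  then have "\<exists>c. \<forall>y\<in>ball x e. f y = c"
    by (rule has_derivative_zero_constant[OF convex_ball])
  then show ?thesis using that e by (metis centre_in_ball)
qed

text \<open>The frame is chosen point by point and may jump. This is harmless because diag(z, 1/z)
  acts trivially in charge 0, and it permits prescribing h_+, h_- at p.\<close>

locale framed_surface = oriented_surface A B g \<tau> for A B :: "'m::topological_space chart set" and g \<tau> +
  fixes fr :: "'m \<Rightarrow> complex^2^2" and K :: real
  assumes fr: "\<And>q. oframe (chart_at A q) q (fr q)"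
    and conn: "connected (UNIV :: 'm set)"
    and curv: "constant_curvature A g K" "K \<noteq> 0"
begin

definition ifr :: "'m \<Rightarrow> complex^2^2" where
  "ifr q = dualframe (cmat (gmat A g (chart_at A q) (snd (chart_at A q) q))) (fr q)"

lemma ifr_fr: "ifr q ** fr q = mat 1" and fr_ifr: "fr q ** ifr q = mat 1"
  using fr[of q] unfolding oframe_def ifr_def by (auto intro: dualframe_left dualframe_right)

abbreviation Jc :: "'m chart \<Rightarrow> 'm \<Rightarrow> complex^2^2" where
  "Jc c q \<equiv> cmat (jac (chart_at A q) c q)"

lemma frame_in_chart:
  assumes c: "c \<in> A" "q \<in> cdom c"
  obtains z where "z \<noteq> 0" "Jc c q ** fr q = Hc c (snd c q) ** mk2 z 0 0 (inverse z)"
    "Kc c (snd c q) ** Jc c q = mk2 z 0 0 (inverse z) ** ifr q"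
proof -
  interpret chart_geometry A g c "\<lambda>x. orient c (cinv c x)" by (rule chart_geometry[OF c(1)])
  have x: "snd c q \<in> cimg c" using c by auto
  have "oframe c q (Jc c q ** fr q)"
    by (rule oframe_transform[OF chart_at_in[OF A] chart_at_dom[OF A] c fr])
  then obtain z where z: "z \<noteq> 0" "Jc c q ** fr q = Hc c (snd c q) ** mk2 z 0 0 (inverse z)"
    using oframe_unique[OF c] by blast
  have "Kc c (snd c q) ** (Jc c q ** fr q) ** ifr q = Kc c (snd c q) ** Hc c (snd c q) ** mk2 z 0 0 (inverse z) ** ifr q"
    by (simp add: z(2) matrix_mul_assoc)
  then have "Kc c (snd c q) ** Jc c q = mk2 z 0 0 (inverse z) ** ifr q"
    by (simp add: KK_H[OF x]) (simp add: fr_ifr flip: matrix_mul_assoc)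
  with z that show ?thesis by blast
qed

lemma tensor_comp_chart:
  assumes c: "c \<in> A" "q \<in> cdom c"
  shows "tensor_comp A s c w (snd c q) = lk (tmap (Jc c q) (s q)) w"
  using is_chartD(3)[OF smooth_atlas_chart[OF A c(1)] c(2)] by (simp add: tensor_comp_def Let_def)

lemma frame_section:
  assumes u: "\<And>w. lk u w \<noteq> 0 \<Longrightarrow> w \<in> positive \<and> wcharge w = 0"
  shows "(\<lambda>q. tmap (fr q) u) \<in> parallel_sections A g"
proof -
  let ?s = "\<lambda>q. tmap (fr q) u"
  \<comment> \<open>The factor diag(z, 1/z) between \<open>fr\<close> and the chart frame disappears
    in charge 0, so the components are those of the smooth chart frame.\<close>
  have comp: "tensor_comp A ?s c w x = tmc (Hc c x) (lk u) w" if c: "c \<in> A" and x: "x \<in> cimg c" for c w x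
  proof -
    obtain q where q: "q \<in> cdom c" "x = snd c q" using x by auto
    obtain z where z: "z \<noteq> 0" "Jc c q ** fr q = Hc c (snd c q) ** mk2 z 0 0 (inverse z)"
      using frame_in_chart[OF c q(1)] by blast
    have "tmc (mk2 z 0 0 (inverse z)) (lk u) v = lk u v" for v
      using tmc_diagonal[OF z(1), of v] u[of v] by (metis mult_1 mult_zero_right)
    then have "tmc (Hc c x ** mk2 z 0 0 (inverse z)) (lk u) w = tmc (Hc c x) (lk u) w"
      unfolding tmc_mult by presburger
    then show ?thesis
      unfolding q(2) tensor_comp_chart[OF c q(1)]
      by (simp add: z(2) lookup_tmap flip: tmap_mult)
  qed
  have "?s q \<in> tensor_alg" for q
    by (rule tmap_tensor_alg) (use u in \<open>auto simp: tensor_alg_iff\<close>)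
  moreover have "smooth_on (cimg c) (tensor_comp A ?s c w)" if c: "c \<in> A" for c w
  proof -
    interpret chart_geometry A g c "\<lambda>x. orient c (cinv c x)" by (rule chart_geometry[OF c])
    show ?thesis
      by (rule smooth_on_cong[OF S_open tmc_smooth[OF S_open smooth_H, of "\<lambda>_. lk u" w]]) (simp_all add: comp[OF c])
  qed
  moreover have "cov_deriv A g ?s c i w x = 0" if c: "c \<in> A" and x: "x \<in> cimg c" for c i w x
  proof -
    interpret chart_geometry A g c "\<lambda>x. orient c (cinv c x)" by (rule chart_geometry[OF c])
    have "pd i (tensor_comp A ?s c w) x = pd i (\<lambda>y. tmc (Hc c y) (lk u) w) x"
      by (rule pd_cong[OF S_open x]) (simp add: comp[OF c])
    then show ?thesis
      unfolding cov_deriv_rho comp[OF c x]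
      using frame_section_parallel[OF x, of "lk u" i w] u by simp
  qed
  ultimately show ?thesis unfolding parallel_sections_def by blast
qed

lemma parallel_section_constant:
  assumes s: "s \<in> parallel_sections A g"
  shows "tmap (ifr q) (s q) = tmap (ifr q') (s q')"
    and "lk (tmap (ifr q) (s q)) w \<noteq> 0 \<Longrightarrow> w \<in> positive \<and> wcharge w = 0"
proof -
  define F where "F q = tmap (ifr q) (s q)" for q
  have smooth: "smooth_on (cimg c) (\<lambda>x. tensor_comp A s c w x)" if "c \<in> A" for c w
    using s that unfolding parallel_sections_def by blast
  \<comment> \<open>The coefficients in the chart frame and in \<open>fr\<close> differ by a nonzero
    factor, so vanishing carries over for every charge; in charge 0 they are equal, so local
    constancy carries over too.\<close>
  have coeff: "\<exists>y. y \<noteq> 0 \<and> tmc (Kc c (snd c q)) (\<lambda>v. tensor_comp A s c v (snd c q)) w = y * lk (F q) w \<and> (wcharge w = 0 \<longrightarrow> y = 1)"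
    if c: "c \<in> A" "q \<in> cdom c" for c q w
  proof -
    obtain z where z: "z \<noteq> 0" "Kc c (snd c q) ** Jc c q = mk2 z 0 0 (inverse z) ** ifr q"
      using frame_in_chart[OF c] by metis
    have "tmc (Kc c (snd c q)) (\<lambda>v. tensor_comp A s c v (snd c q)) w = lk (tmap (Kc c (snd c q)) (tmap (Jc c q) (s q))) w"
      unfolding lookup_tmap[of "Kc c (snd c q)"] tensor_comp_chart[OF c] ..
    also have "\<dots> = lk (tmap (mk2 z 0 0 (inverse z)) (F q)) w"
      by (simp add: F_def z(2) flip: tmap_mult)
    also have "\<dots> = tmc (mk2 z 0 0 (inverse z)) (lk (F q)) w" by (rule lookup_tmap)
    finally show ?thesis using tmc_diagonal[OF z(1), of w] by metis
  qed
  have par: "pd a (\<lambda>y. tensor_comp A s c v y) x + rho (chart_geometry.Gam A g c a x) (\<lambda>v. tensor_comp A s c v x) v = 0"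
    if c: "c \<in> A" and x: "x \<in> cimg c" for c a v x
  proof -
    interpret chart_geometry A g c "\<lambda>x. orient c (cinv c x)" by (rule chart_geometry[OF c])
    have "cov_deriv A g s c a v x = 0" using s x c unfolding parallel_sections_def by blast
    then show ?thesis unfolding cov_deriv_rho .
  qed
  have unbalanced: "lk (F q) w = 0" if w: "wcharge w \<noteq> 0" for q w
  proof -
    define c where "c = chart_at A q"
    have c: "c \<in> A" "q \<in> cdom c" unfolding c_def by (rule chart_at_in[OF A], rule chart_at_dom[OF A])
    interpret chart_geometry A g c "\<lambda>x. orient c (cinv c x)" by (rule chart_geometry[OF c(1)])
    have "tmc (KK (snd c q)) (\<lambda>v. tensor_comp A s c v (snd c q)) w = 0"
      by (rule parallel_unbalanced[where T="\<lambda>x v. tensor_comp A s c v x", OF smooth[OF c(1)] par[OF c(1)] _ c(1) curv w])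
        (use c in auto)
    then show ?thesis using coeff[OF c, of w] by auto
  qed
  have const: "lk (F q) w = lk (F q') w" if w: "wcharge w = 0" for q q' w
  proof (rule connected_local_const[OF conn])
    show "\<forall>q\<in>UNIV. \<forall>\<^sub>F q' in at q within UNIV. lk (F q) w = lk (F q') w"
    proof
      fix q :: 'm
      define c where "c = chart_at A q"
      have c: "c \<in> A" "q \<in> cdom c" unfolding c_def by (rule chart_at_in[OF A], rule chart_at_dom[OF A])
      note ch = smooth_atlas_chart[OF A c(1)]
      interpret chart_geometry A g c "\<lambda>x. orient c (cinv c x)" by (rule chart_geometry[OF c(1)])
      let ?f = "\<lambda>x. tmc (KK x) (\<lambda>v. tensor_comp A s c v x) w"
      have f: "smooth_on (cimg c) ?f"
        by (rule tmc_smooth[where T="\<lambda>x v. tensor_comp A s c v x", OF S_open smooth_KK smooth[OF c(1)]])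
      have 0: "pd i ?f y = 0" if "y \<in> cimg c" for i y
        using parallel_coeff[where T="\<lambda>x v. tensor_comp A s c v x" and w=w and a=i, OF that smooth[OF c(1)] par[OF c(1) that]] w by simp
      have x: "snd c q \<in> cimg c" using c by auto
      obtain e where e: "e > 0" "ball (snd c q) e \<subseteq> cimg c" "\<And>y. y \<in> ball (snd c q) e \<Longrightarrow> ?f y = ?f (snd c q)"
        using zero_derivative_locally_constant[OF S_open x f 0] by blast
      have fF: "?f (snd c q') = lk (F q') w" if "q' \<in> cdom c" for q'
        using coeff[OF c(1) that, of w] w by auto
      have "continuous_on (cdom c) (snd c)" using is_chartD(6)[OF ch] by (simp add: homeomorphism_def)
      then have "open (cdom c \<inter> snd c -` ball (snd c q) e)"
        by (rule continuous_open_preimage[OF _ is_chartD(1)[OF ch] open_ball])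
      moreover have "q \<in> cdom c \<inter> snd c -` ball (snd c q) e" using c e by simp
      ultimately have "\<forall>\<^sub>F q' in at q. q' \<in> cdom c \<inter> snd c -` ball (snd c q) e"
        by (rule eventually_at_topological[THEN iffD2, OF exI[where x="cdom c \<inter> snd c -` ball (snd c q) e"], OF conjI[OF _ conjI]]) auto
      then show "\<forall>\<^sub>F q' in at q within UNIV. lk (F q) w = lk (F q') w"
        by (rule eventually_mono) (use e(3) fF c in \<open>metis Int_iff vimageE\<close>)
    qed
  qed auto
  have pos: "lk (F q) w \<noteq> 0 \<Longrightarrow> w \<in> positive" for q w
    using s tmap_tensor_alg[of "s q" "ifr q"] unfolding F_def parallel_sections_def tensor_alg_iff by blast
  show "tmap (ifr q) (s q) = tmap (ifr q') (s q')"
    unfolding F_def[symmetric] using unbalanced const by (intro poly_mapping_eqI) metis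
  show "lk (tmap (ifr q) (s q)) w \<noteq> 0 \<Longrightarrow> w \<in> positive \<and> wcharge w = 0"
    unfolding F_def[symmetric] using unbalanced pos by blast
qed

lemma evaluation_inj: "inj_on (\<lambda>s. s p) (parallel_sections A g)"
proof (rule inj_onI, rule ext)
  fix s s' q assume s: "s \<in> parallel_sections A g" "s' \<in> parallel_sections A g" and eq: "s p = s' p"
  have "tmap (ifr q) (s q) = tmap (ifr q) (s' q)"
    using parallel_section_constant(1)[OF s(1), of q p] parallel_section_constant(1)[OF s(2), of q p] eq by simp
  then have "tmap (fr q) (tmap (ifr q) (s q)) = tmap (fr q) (tmap (ifr q) (s' q))" by simp
  then show "s q = s' q" by (simp add: fr_ifr flip: tmap_mult)
qed

text \<open>The criterion of \<open>mv_span\<close> with \<open>ifr p\<close> for K, which will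
  identify V with the span. A coefficient vector of charge 0 extends from p to all points along
  \<open>fr\<close>.\<close>

lemma V_par_iff: "t \<in> V_par A g p \<longleftrightarrow> (\<forall>w. lk (tmap (ifr p) t) w \<noteq> 0 \<longrightarrow> w \<in> wordof ` balanced)"
proof
  assume "t \<in> V_par A g p"
  then show "\<forall>w. lk (tmap (ifr p) t) w \<noteq> 0 \<longrightarrow> w \<in> wordof ` balanced"
    unfolding V_par_def wordof_balanced using parallel_section_constant(2) by blast
next
  assume "\<forall>w. lk (tmap (ifr p) t) w \<noteq> 0 \<longrightarrow> w \<in> wordof ` balanced"
  then have "(\<lambda>q. tmap (fr q) (tmap (ifr p) t)) \<in> parallel_sections A g"
    by (intro frame_section) (auto simp: wordof_balanced)
  moreover have "tmap (fr p) (tmap (ifr p) t) = t" by (simp add: fr_ifr flip: tmap_mult)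
  ultimately show "t \<in> V_par A g p" unfolding V_par_def by (metis imageI)
qed

end

lemma frame_hvec_null:
  assumes b: "bilinear b" and sym: "b e2 e1 = b e1 e2" and on: "b e1 e1 = 1" "b e2 e2 = 1" "b e1 e2 = 0"
  shows "transpose (frame (hvec e1 e2)) ** cmat (\<chi> i j. b (axis i 1) (axis j 1)) ** frame (hvec e1 e2) = null_gram"
    and "det (frame (hvec e1 e2)) = 2 * (\<i> * of_real (det (mk2 (e1 $ 1) (e2 $ 1) (e1 $ 2) (e2 $ 2))))"
    and "det (mk2 (e1 $ 1) (e2 $ 1) (e1 $ 2) (e2 $ 2)) ^ 2 * det (\<chi> i j. b (axis i 1) (axis j 1)) = (1::real)"
proof -
  let ?E = "mk2 (e1 $ 1) (e2 $ 1) (e1 $ 2) (e2 $ 2)" and ?g = "\<chi> i j. b (axis i 1) (axis j 1)"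
  \<comment> \<open>Passage from an orthonormal basis to h_+, h_-: transpose(U) U =
    \<open>null_gram\<close> and det U = 2i.\<close>
  let ?U = "mk2 1 1 (- \<i>) \<i>"
  have f: "frame (hvec e1 e2) = cmat ?E ** ?U"
    by (simp add: mat2_eq_iff mult2_nth frame_def hvec_def complexify_def mult.commute)
  have c: "column 1 ?E = e1" "column 2 ?E = e2" by (simp_all add: column_def vec_eq_iff forall_2)
  have "column i (mat 1 :: real^2^2) = axis i 1" for i
    by (simp add: vec_eq_iff column_def mat_def axis_def)
  then have "(\<chi> i j. b (column i ?E) (column j ?E)) = transpose ?E ** ?g ** ?E"
    using gram_transform[OF b, of "mat 1" ?E] by simp
  moreover have "(\<chi> i j. b (column i ?E) (column j ?E)) = mat 1"
    by (simp add: mat2_eq_iff c on sym mat_def)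
  ultimately have E: "transpose ?E ** ?g ** ?E = mat 1" by simp
  have "transpose (cmat ?E ** ?U) ** cmat ?g ** (cmat ?E ** ?U) = transpose ?U ** cmat (transpose ?E ** ?g ** ?E) ** ?U"
    by (simp add: cmat_mult cmat_transpose matrix_transpose_mul matrix_mul_assoc)
  also have "\<dots> = null_gram" unfolding E by (simp add: mat2_eq_iff mult2_nth null_gram_def)
  finally show "transpose (frame (hvec e1 e2)) ** cmat ?g ** frame (hvec e1 e2) = null_gram" unfolding f .
  show "det (frame (hvec e1 e2)) = 2 * (\<i> * of_real (det ?E))"
    unfolding f det_mul det_cmat by (simp add: det_2[of ?U])
  show "det ?E ^ 2 * det ?g = 1"
    using arg_cong[OF E, of det] by (simp add: det_mul det_transpose power2_eq_square mult_ac)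
qed

theorem theorem3p13:
  fixes A :: "'m::{t2_space, second_countable_topology} chart set"
    and g :: "'m metric" and K :: real and l :: complex
    and p :: 'm and e1 e2 :: "real^2"
  assumes "smooth_atlas A" and "riemannian_metric A g"
    and "connected (UNIV :: 'm set)" and "geodesically_complete A g" and "orientable A"
    and "constant_curvature A g K" and "K \<noteq> 0"
    and "g p e1 e1 = 1" and "g p e2 e2 = 1" and "g p e1 e2 = 0"
    and "l \<noteq> 0"
  defines "V \<equiv> V_par A g p"
    and "h \<equiv> hvec e1 e2"
    and "G \<equiv> cmetric g p"
  shows "inj_on (\<lambda>s. s p) (parallel_sections A g) \<and>
    (inj_on (mode_vec G l h) balanced \<and>
     \<not> module.dependent scaleT (mode_vec G l h ` balanced) \<and>
     module.span scaleT (mode_vec G l h ` balanced) = V) \<and>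
    (\<exists>Y. (\<forall>ws\<in>balanced. \<forall>v\<in>V. \<forall>n. Y (mode_vec G l h ws) v n = vertex_coeff G l h ws v n) \<and>
         is_MOSVA scaleT V
           (\<lambda>n. module.span scaleT (mode_vec G l h ` {ws \<in> balanced. weight ws = n})) Y vac)"
proof -
  obtain B where B: "smooth_atlas B" "smooth_atlas (A \<union> B)"
    "\<And>c d q. c \<in> B \<Longrightarrow> d \<in> B \<Longrightarrow> q \<in> cdom c \<Longrightarrow> q \<in> cdom d \<Longrightarrow> det (jac c d q) > 0"
    using assms(5) unfolding orientable_def by blast
  let ?E = "mk2 (e1 $ 1) (e2 $ 1) (e1 $ 2) (e2 $ 2)"
  define c where "c = chart_at A p"
  have c: "c \<in> A" "p \<in> cdom c"
    using chart_at_in[OF assms(1)] chart_at_dom[OF assms(1)] by (auto simp: c_def)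
  have bil: "bilinear (g p)" "g p e2 e1 = g p e1 e2"
    using assms(2) unfolding riemannian_metric_def by auto
  note fh = frame_hvec_null[OF bil assms(8-10)]
  let ?j = "det (jac c (chart_at B p) p)"
  have j: "?j \<noteq> 0"
    by (rule det_jac_nonzero[OF B(2)]) (use c chart_at_in[OF B(1)] chart_at_dom[OF B(1)] in auto)
  have E: "det ?E \<noteq> 0" using fh(3) by auto
  \<comment> \<open>Makes \<open>orient c p\<close> the sign of det(e_1, e_2) in the preferred chart
    at p.\<close>
  define \<tau> where "\<tau> = sgn (det ?E) * sgn ?j"
  interpret oriented_surface A B g \<tau>
    by unfold_locales (use assms B j E in \<open>auto simp: \<tau>_def sgn_if\<close>)
  have gm: "gmat A g c (snd c p) = gram p"
    using gmat_gram[OF c] jac_self[OF assms(1) c] by (simp add: c_def transpose_mat)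
  have "sgn ?j * sgn ?j = 1" using j by (simp add: sgn_if)
  then have orient_p: "orient c p = sgn (det ?E)" unfolding orient_def unfolding \<tau>_def by (simp add: mult.assoc)
  have "det ?E ^ 2 * det (gram p) = 1" using fh(3) by (simp add: gram_def)
  then have "(\<bar>det ?E\<bar> * sqrt (det (gram p))) ^ 2 = 1"
    using gram_pos(2)[of p] by (simp add: power_mult_distrib)
  moreover have "0 \<le> \<bar>det ?E\<bar> * sqrt (det (gram p))"
    using gram_pos(2)[of p] by (intro mult_nonneg_nonneg) auto
  ultimately have "\<bar>det ?E\<bar> * sqrt (det (gram p)) = 1"
    unfolding power2_eq_1_iff by linarith
  then have "inverse (sqrt (det (gram p))) = \<bar>det ?E\<bar>" by (simp add: inverse_unique mult.commute)
  then have det: "det ?E = orient c p * inverse (sqrt (det (gmat A g c (snd c p))))"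
    by (simp add: gm orient_p sgn_mult_abs)
  have framep: "oframe c p (frame h)"
    unfolding oframe_def det[symmetric] using fh(1,2) by (simp add: gm gram_def h_def)
  \<comment> \<open>At p the frame must be the given one, so that \<open>ifr p\<close> inverts
    \<open>frame h\<close>; elsewhere any positive null frame will do.\<close>
  define fr where "fr q = (if q = p then frame h else Hc (chart_at A q) (snd (chart_at A q) q))" for q
  interpret framed_surface A B g \<tau> fr K
    by unfold_locales (use framep assms oframe_Hc[OF chart_at_in[OF assms(1)] chart_at_dom[OF assms(1)]] in \<open>auto simp: fr_def c_def\<close>)
  have null: "cmetric g p (h s) (h s) = 0" for s
  proof -
    have "cmetric g p (h s) (h s) = (transpose (frame h) ** cmat (gram p) ** frame h) $ sidx s $ sidx s"
      by (cases s) (simp_all add: cmetric_def mult2_nth sum_2 frame_def gram_def algebra_simps)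
    also have "\<dots> = 0" using framep by (cases s) (simp_all add: oframe_def gm null_gram_def)
    finally show ?thesis .
  qed
  interpret null_frame g p l h "ifr p"
    by unfold_locales (use ifr_fr[of p] null in \<open>auto simp: fr_def\<close>)
  have V: "T.span (mode_vec G l h ` balanced) = V"
    unfolding G_def V_def using V_par_iff[of _ p] mv_span[OF balanced_positive] by blast
  have W: "W = V" using V by (simp add: W_def G_def)
  have "inj_on (mode_vec G l h) balanced"
    unfolding G_def by (rule inj_on_subset[OF mv_inj balanced_positive])
  moreover have "\<not> T.dependent (mode_vec G l h ` balanced)"
    unfolding G_def by (rule mv_independent[OF balanced_positive])
  moreover have "\<forall>ws\<in>balanced. \<forall>v\<in>V. \<forall>n. Y (mode_vec G l h ws) v n = vertex_coeff G l h ws v n"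
    unfolding G_def using vertex_coeff_Y W_tensor_alg balanced_positive W by blast
  moreover have "is_MOSVA scaleT V (\<lambda>n. T.span (mode_vec G l h ` {ws \<in> balanced. weight ws = n})) Y vac"
    using MOSVA unfolding W Wn_def[abs_def] G_def .
  ultimately show ?thesis using evaluation_inj[of p] V by blast
qed

end
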